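(* Let $G$ be a discrete countable group which admits a proper quasi-1-cocycle $c\colon G\to \ell^2 G^{\oplus\infty}$, and let $H$ be a group which is boundedly generated by a finite set of amenable subgroups. Then every group homomorphism $\phi\colon H\to G$ has amenable image.
   Context: $\ell^2 G$ is the Hilbert space with orthonormal basis $G$ with the left regular representation; $\ell^2G^{\oplus\infty}$ is the Hilbert space direct sum of countably infinitely many copies. For a unitary representation $\pi\colon G\to U(H_\pi)$, a quasi-1-cocycle is a map $c\colon G\to H_\pi$ such that $(g,h)\mapsto \pi(g)c(h)-c(gh)+c(g)$ is uniformly bounded on $G\times G$. It is proper if for every $R>0$ the set $\{g\in G: \|c(g)\|\le R\}$ is finite. A group $H$ is boundedly generated by a subset $X$ if there is $k\in\mathbb N$ such that each element of $H$ is a product of less than $k$ elements of $X\cup X^{-1}$. It is boundedly generated by a finite set of subgroups $\{H_i\}_{i\in I}$ if it is boundedly generated by $\bigcup_{i\in I}H_i$. All groups are considered as discrete groups. *)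

theory Defs
  imports
    "HOL-Analysis.Analysis"
    "HOL-Algebra.Coset"
    "HOL-Library.Function_Algebras"
begin

section \<open>The Hilbert space $\ell^2 G^{\oplus\infty}$ and the left regular representation\<close>

text \<open>Square-summable complex functions on the carrier of \<open>G\<close>, represented as functions on the
  ambient type that vanish off the carrier, so that equality of vectors is equality of functions
  and the vector operations are the pointwise ones.\<close>

definition ell2 :: "('g, 'm) monoid_scheme \<Rightarrow> ('g \<Rightarrow> complex) set" where
  "ell2 G = {f. (\<forall>x. x \<notin> carrier G \<longrightarrow> f x = 0) \<and>
                (\<lambda>x. (cmod (f x))\<^sup>2) summable_on carrier G}"

definition ell2_norm :: "('g, 'm) monoid_scheme \<Rightarrow> ('g \<Rightarrow> complex) \<Rightarrow> real" where
  "ell2_norm G f = sqrt (\<Sum>\<^sub>\<infinity>x\<in>carrier G. (cmod (f x))\<^sup>2)"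

text \<open>The unitary that sends the basis vector at \<open>x\<close> to the basis vector at \<open>g \<otimes> x\<close>.\<close>

definition left_regular ::
  "('g, 'm) monoid_scheme \<Rightarrow> 'g \<Rightarrow> ('g \<Rightarrow> complex) \<Rightarrow> ('g \<Rightarrow> complex)" where
  "left_regular G g f = (\<lambda>x. if x \<in> carrier G then f (inv\<^bsub>G\<^esub> g \<otimes>\<^bsub>G\<^esub> x) else 0)"

definition ell2_sum :: "('g, 'm) monoid_scheme \<Rightarrow> (nat \<Rightarrow> 'g \<Rightarrow> complex) set" where
  "ell2_sum G = {F. (\<forall>n. F n \<in> ell2 G) \<and> summable (\<lambda>n. (ell2_norm G (F n))\<^sup>2)}"

definition ell2_sum_norm :: "('g, 'm) monoid_scheme \<Rightarrow> (nat \<Rightarrow> 'g \<Rightarrow> complex) \<Rightarrow> real" where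
  "ell2_sum_norm G F = sqrt (\<Sum>n. (ell2_norm G (F n))\<^sup>2)"

definition left_regular_sum ::
  "('g, 'm) monoid_scheme \<Rightarrow> 'g \<Rightarrow> (nat \<Rightarrow> 'g \<Rightarrow> complex) \<Rightarrow> (nat \<Rightarrow> 'g \<Rightarrow> complex)" where
  "left_regular_sum G g F = (\<lambda>n. left_regular G g (F n))"

text \<open>The diagonal action is an isometric representation: by additivity, invertibility and
  preservation of the norm it is unitary (complex homogeneity is immediate from the definition).\<close>

lemma left_regular_bij:
  assumes "group G" "g \<in> carrier G"
  shows "bij_betw (\<lambda>x. inv\<^bsub>G\<^esub> g \<otimes>\<^bsub>G\<^esub> x) (carrier G) (carrier G)"
proof -
  interpret group G by fact
  show ?thesis
    by (rule bij_betwI[where g = "\<lambda>x. g \<otimes>\<^bsub>G\<^esub> x"]) (use assms(2) in \<open>auto simp: m_assoc[symmetric]\<close>)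
qed

lemma left_regular_norm:
  assumes "group G" "g \<in> carrier G"
  shows "ell2_norm G (left_regular G g f) = ell2_norm G f"
proof -
  have "(\<Sum>\<^sub>\<infinity>x\<in>carrier G. (cmod (left_regular G g f x))\<^sup>2)
      = (\<Sum>\<^sub>\<infinity>x\<in>carrier G. (cmod (f (inv\<^bsub>G\<^esub> g \<otimes>\<^bsub>G\<^esub> x)))\<^sup>2)"
    by (rule infsum_cong) (simp add: left_regular_def)
  also have "\<dots> = (\<Sum>\<^sub>\<infinity>x\<in>carrier G. (cmod (f x))\<^sup>2)"
    by (rule infsum_reindex_bij_betw[OF left_regular_bij[OF assms]])
  finally show ?thesis by (simp add: ell2_norm_def)
qed

lemma left_regular_closed:
  assumes "group G" "g \<in> carrier G" "f \<in> ell2 G"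
  shows "left_regular G g f \<in> ell2 G"
proof -
  have "(\<lambda>x. (cmod (f (inv\<^bsub>G\<^esub> g \<otimes>\<^bsub>G\<^esub> x)))\<^sup>2) summable_on carrier G"
    using assms(3) summable_on_reindex_bij_betw[OF left_regular_bij[OF assms(1,2)],
        of "\<lambda>x. (cmod (f x))\<^sup>2"]
    by (simp add: ell2_def)
  then have "(\<lambda>x. (cmod (left_regular G g f x))\<^sup>2) summable_on carrier G"
    by (rule summable_on_cong[THEN iffD1, rotated]) (simp add: left_regular_def)
  then show ?thesis by (simp add: ell2_def left_regular_def)
qed

lemma left_regular_sum_closed:
  assumes "group G" "g \<in> carrier G" "F \<in> ell2_sum G"
  shows "left_regular_sum G g F \<in> ell2_sum G"
  using assms by (simp add: ell2_sum_def left_regular_sum_def left_regular_norm left_regular_closed)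

lemma left_regular_sum_norm:
  assumes "group G" "g \<in> carrier G"
  shows "ell2_sum_norm G (left_regular_sum G g F) = ell2_sum_norm G F"
  using assms by (simp add: ell2_sum_norm_def left_regular_sum_def left_regular_norm)

lemma left_regular_sum_add:
  "left_regular_sum G g (F + F') = left_regular_sum G g F + left_regular_sum G g F'"
  by (simp add: left_regular_sum_def left_regular_def fun_eq_iff)

lemma left_regular_sum_mult:
  assumes "group G" "g \<in> carrier G" "h \<in> carrier G"
  shows "left_regular_sum G (g \<otimes>\<^bsub>G\<^esub> h) F = left_regular_sum G g (left_regular_sum G h F)"
proof -
  interpret group G by fact
  show ?thesis using assms(2,3)
    by (auto simp: left_regular_sum_def left_regular_def fun_eq_iff inv_mult_group m_assoc)
qed

lemma left_regular_sum_one: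
  assumes "group G" "F \<in> ell2_sum G"
  shows "left_regular_sum G \<one>\<^bsub>G\<^esub> F = F"
proof -
  interpret group G by fact
  show ?thesis using assms(2)
    by (auto simp: left_regular_sum_def left_regular_def fun_eq_iff ell2_sum_def ell2_def)
qed

section \<open>Quasi-1-cocycles\<close>

text \<open>\<open>V\<close> is the underlying set of the representation space, \<open>nrm\<close> its norm and \<open>\<pi>\<close> the action.
  For functions into a group the operations \<open>+\<close> and \<open>-\<close> are the pointwise ones.\<close>

definition quasi_1_cocycle ::
  "('g, 'm) monoid_scheme \<Rightarrow> 'v::ab_group_add set \<Rightarrow> ('v \<Rightarrow> real) \<Rightarrow> ('g \<Rightarrow> 'v \<Rightarrow> 'v)
    \<Rightarrow> ('g \<Rightarrow> 'v) \<Rightarrow> bool" where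
  "quasi_1_cocycle G V nrm \<pi> c \<longleftrightarrow>
     c \<in> carrier G \<rightarrow> V \<and>
     (\<exists>C. \<forall>g\<in>carrier G. \<forall>h\<in>carrier G. nrm (\<pi> g (c h) - c (g \<otimes>\<^bsub>G\<^esub> h) + c g) \<le> C)"

definition proper_on_group :: "('g, 'm) monoid_scheme \<Rightarrow> ('v \<Rightarrow> real) \<Rightarrow> ('g \<Rightarrow> 'v) \<Rightarrow> bool" where
  "proper_on_group G nrm c \<longleftrightarrow> (\<forall>R>0. finite {g \<in> carrier G. nrm (c g) \<le> R})"

section \<open>Bounded generation\<close>

definition boundedly_generated :: "('h, 'm) monoid_scheme \<Rightarrow> 'h set \<Rightarrow> bool" where
  "boundedly_generated H X \<longleftrightarrow>
     X \<subseteq> carrier H \<and>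
     (\<exists>k::nat. \<forall>h\<in>carrier H. \<exists>xs. length xs < k \<and> set xs \<subseteq> X \<union> m_inv H ` X \<and>
        h = foldr (mult H) xs \<one>\<^bsub>H\<^esub>)"

definition boundedly_generated_by_subgroups ::
  "('h, 'm) monoid_scheme \<Rightarrow> 'h set set \<Rightarrow> bool" where
  "boundedly_generated_by_subgroups H \<K> \<longleftrightarrow>
     finite \<K> \<and> (\<forall>K\<in>\<K>. subgroup K H) \<and> boundedly_generated H (\<Union>\<K>)"

section \<open>Amenability of discrete groups\<close>

definition bounded_funs :: "('g, 'm) monoid_scheme \<Rightarrow> ('g \<Rightarrow> real) set" where
  "bounded_funs G = {f. bounded (f ` carrier G)}"

text \<open>A left invariant mean on the bounded real functions on \<open>G\<close>. By linearity and positivity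
  \<open>m f\<close> depends only on the restriction of \<open>f\<close> to the carrier.\<close>

definition left_invariant_mean :: "('g, 'm) monoid_scheme \<Rightarrow> (('g \<Rightarrow> real) \<Rightarrow> real) \<Rightarrow> bool" where
  "left_invariant_mean G m \<longleftrightarrow>
     (\<forall>f\<in>bounded_funs G. \<forall>f'\<in>bounded_funs G. m (\<lambda>x. f x + f' x) = m f + m f') \<and>
     (\<forall>a. \<forall>f\<in>bounded_funs G. m (\<lambda>x. a * f x) = a * m f) \<and>
     (\<forall>f\<in>bounded_funs G. (\<forall>x\<in>carrier G. 0 \<le> f x) \<longrightarrow> 0 \<le> m f) \<and>
     m (\<lambda>x. 1) = 1 \<and>
     (\<forall>g\<in>carrier G. \<forall>f\<in>bounded_funs G. m (\<lambda>x. f (g \<otimes>\<^bsub>G\<^esub> x)) = m f)"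

definition amenable :: "('g, 'm) monoid_scheme \<Rightarrow> bool" where
  "amenable G \<longleftrightarrow> group G \<and> (\<exists>m. left_invariant_mean G m)"

definition amenable_subgroup :: "'g set \<Rightarrow> ('g, 'm) monoid_scheme \<Rightarrow> bool" where
  "amenable_subgroup K G \<longleftrightarrow> subgroup K G \<and> amenable (G\<lparr>carrier := K\<rparr>)"

end

theory Submission
  imports Defs
begin

text \<open>Let \<open>L\<close> be the image of \<open>\<phi>\<close>. It is boundedly generated by the images \<open>A\<^sub>j\<close> of the given amenable subgroups,
and as a representation of \<open>L\<close> the space \<open>\<ell>\<^sup>2 G\<^sup>\<oplus>\<^sup>\<infinity>\<close> is a direct sum of copies of \<open>\<ell>\<^sup>2 L\<close>, one for each element
of an index set (cosets, summands, real and imaginary parts). Suppose that \<open>L\<close> is not amenable. Then \<open>c\<close>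
is shown to be bounded on \<open>L\<close>; as \<open>c\<close> is proper, \<open>L\<close> is finite, and finite groups are amenable.

Why \<open>c\<close> is bounded on \<open>L\<close>. Since \<open>L\<close> is not amenable, its regular representation has a spectral gap
(\<open>spectral_gap\<close>). A bounded quasi-cocycle is close to a coboundary \<open>g \<mapsto> (1 - g)\<xi>\<close>, where \<open>\<xi>\<close> is an approximate
circumcentre of its range, and by the gap \<open>\<xi>\<close> cannot be long. So a quasi-cocycle that is bounded at
all is bounded by a constant that depends only on its defect, its values at finitely many elements
and the gap (\<open>bounded_quasi_cocycle_uniform_bound\<close>). Hence it is enough to find contractions \<open>Q\<close> that
commute with left translations, are as close to the identity as desired on a given vector, and make
\<open>g \<mapsto> Q (c g)\<close> bounded on every \<open>A\<^sub>j\<close>: then \<open>Q \<circ> c\<close> is bounded on \<open>L\<close> by bounded generation, the bound does not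
depend on \<open>Q\<close>, and \<open>Q\<close> may tend to the identity (\<open>quasi_cocycle_bounded\<close>).

Why such contractions exist (\<open>bounding_operator\<close>). Work with one copy of \<open>\<ell>\<^sup>2 L\<close> and infinite \<open>A\<^sub>j\<close>; on finite
ones \<open>c\<close> is bounded anyway. Suppose first that \<open>c a = (1 - a)\<xi>\<^sub>j\<close> for \<open>a \<in> A\<^sub>j\<close>, with a finitely supported \<open>\<xi>\<^sub>j\<close> about
whose length nothing is known. Let \<open>V\<^sub>j v\<close> be the function \<open>x \<mapsto> \<langle>x\<xi>\<^sub>j, v\<rangle>\<close> and \<open>R = (1 + t \<Sum>\<^sub>j V\<^sub>j\<^sup>* V\<^sub>j)\<^sup>-\<^sup>1\<close>. As \<open>\<xi>\<^sub>j\<close> is \<open>V\<^sub>j\<^sup>*\<close> of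
the basis vector \<open>\<delta>\<close> at the neutral element, \<open>\<parallel>R \<xi>\<^sub>j\<parallel> \<le> 1 / (2\<surd>t)\<close>, so \<open>R \<circ> c\<close> is bounded by \<open>1 / \<surd>t\<close> on \<open>A\<^sub>j\<close>. On the other hand the
trace property of the group von Neumann algebra gives \<open>1 - \<langle>R\<delta>, \<delta>\<rangle> = \<Sum>\<^sub>j t\<langle>\<xi>\<^sub>j, R\<xi>\<^sub>j\<rangle>\<close>. The function
\<open>x \<mapsto> t\<langle>x\<xi>\<^sub>j, R\<xi>\<^sub>j\<rangle>\<close> has norm at most \<open>1\<close> and changes by at most \<open>\<surd>t / 2 \<cdot> \<parallel>c s\<parallel>\<close> between the neutral element and
\<open>s \<in> A\<^sub>j\<close>, so its value at the neutral element is at most \<open>1 / \<surd>N + \<surd>t / 2 \<cdot> max \<parallel>c s\<parallel>\<close> for any \<open>N\<close> elements \<open>s\<close> of \<open>A\<^sub>j\<close>. For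
\<open>N\<close> large and then \<open>t\<close> small, \<open>R\<close> is close to the identity. None of these estimates involves the length
of \<open>\<xi>\<^sub>j\<close>, so a limit along an ultrafilter reduces the case of a general \<open>c\<close> to this one, provided that on
each \<open>A\<^sub>j\<close> the quasi-cocycle \<open>c\<close> is approximated by coboundaries up to a bounded error.

Why \<open>c\<close> is approximated (\<open>quasi_cocycle_approximation\<close>). On an amenable group \<open>A\<close> averaging replaces \<open>c\<close> by a
nearby cocycle, which is the formal coboundary of a function \<open>f\<close>. It lies in the closure of the
coboundaries of finitely supported vectors if it is orthogonal to every square-summable cycle. This
orthogonality (\<open>coboundary_orthogonal_cycle\<close>) says that the first reduced \<open>\<ell>\<^sup>2\<close>-cohomology of an infinite
amenable group vanishes; it is proved by the same resolvent, now for the matrix \<open>f (g h\<^sup>-\<^sup>1)\<close> on a Foelner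
set, where the trace is an average over the set and all boundary terms are small. Foelner sets are
obtained from the invariant mean: without them, Hall's marriage theorem gives a two-to-one
matching, on which no invariant mean exists (\<open>folner\<close>).\<close>

section \<open>The Hilbert space of square-summable families\<close>

text \<open>Square-summability over a whole type makes the Hilbert space a type, so that the classes
\<open>real_inner\<close> and \<open>complete_space\<close> apply. Real coefficients suffice, as a complex vector is a pair of real
ones.\<close>

typedef 'a l2 = "{f :: 'a \<Rightarrow> real. (\<lambda>x. (f x)\<^sup>2) summable_on UNIV}"
  morphisms coord Abs_l2
  by (rule exI[of _ "\<lambda>_. 0"]) simp

setup_lifting type_definition_l2

lemma l2_eqI: "(\<And>x. coord u x = coord v x) \<Longrightarrow> u = v"
  by (metis coord_inject ext)

lemma coord_square_summable: "(\<lambda>x. (coord u x)\<^sup>2) summable_on A"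
proof -
  have "(\<lambda>x. (coord u x)\<^sup>2) summable_on UNIV"
    using coord[of u] by simp
  then show ?thesis by (rule summable_on_subset_banach) simp
qed

lemma square_summable_times:
  fixes f g :: "'a \<Rightarrow> real"
  assumes "(\<lambda>x. (f x)\<^sup>2) summable_on A" "(\<lambda>x. (g x)\<^sup>2) summable_on A"
  shows "(\<lambda>x. f x * g x) summable_on A"
proof -
  have "(\<lambda>x. (f x)\<^sup>2 + (g x)\<^sup>2) summable_on A"
    using assms by (rule summable_on_add)
  moreover have "norm (f x * g x) \<le> (f x)\<^sup>2 + (g x)\<^sup>2" for x
  proof -
    have "2 * (\<bar>f x\<bar> * \<bar>g x\<bar>) \<le> (f x)\<^sup>2 + (g x)\<^sup>2" "0 \<le> \<bar>f x\<bar> * \<bar>g x\<bar>"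
      using sum_squares_bound[of "\<bar>f x\<bar>" "\<bar>g x\<bar>"] by (simp_all add: mult.assoc)
    then show ?thesis unfolding real_norm_def abs_mult by linarith
  qed
  ultimately show ?thesis
    by (rule abs_summable_summable[OF Infinite_Sum.abs_summable_on_comparison_test'])
qed

instantiation l2 :: (type) real_vector
begin

lift_definition zero_l2 :: "'a l2" is "\<lambda>_. 0" by simp

lift_definition plus_l2 :: "'a l2 \<Rightarrow> 'a l2 \<Rightarrow> 'a l2" is "\<lambda>f g x. f x + g x"
proof -
  fix f g :: "'a \<Rightarrow> real"
  assume f: "(\<lambda>x. (f x)\<^sup>2) summable_on UNIV" and g: "(\<lambda>x. (g x)\<^sup>2) summable_on UNIV"
  have "(\<lambda>x. (f x)\<^sup>2 + (g x)\<^sup>2 + 2 * (f x * g x)) summable_on UNIV"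
    by (intro summable_on_add summable_on_cmult_right f g square_summable_times)
  moreover have "(\<lambda>x. (f x)\<^sup>2 + (g x)\<^sup>2 + 2 * (f x * g x)) = (\<lambda>x. (f x + g x)\<^sup>2)"
    by (rule ext) (simp only: power2_sum mult.assoc)
  ultimately show "(\<lambda>x. (f x + g x)\<^sup>2) summable_on UNIV"
    by (simp only:)
qed

lift_definition scaleR_l2 :: "real \<Rightarrow> 'a l2 \<Rightarrow> 'a l2" is "\<lambda>r f x. r * f x"
  by (simp add: power_mult_distrib summable_on_cmult_right)

lift_definition uminus_l2 :: "'a l2 \<Rightarrow> 'a l2" is "\<lambda>f x. - f x" by simp

definition minus_l2 :: "'a l2 \<Rightarrow> 'a l2 \<Rightarrow> 'a l2" where "minus_l2 u v = u + (- v)"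

lemma coord_zero [simp]: "coord 0 x = 0" by transfer simp
lemma coord_add [simp]: "coord (u + v) x = coord u x + coord v x" by transfer simp
lemma coord_scaleR [simp]: "coord (r *\<^sub>R u) x = r * coord u x" by transfer simp
lemma coord_uminus [simp]: "coord (- u) x = - coord u x" by transfer simp
lemma coord_diff [simp]: "coord (u - v) x = coord u x - coord v x"
  by (simp add: minus_l2_def)

instance
  by standard (rule l2_eqI, simp add: distrib_left distrib_right)+

end

lemma coord_sum [simp]: "coord (\<Sum>i\<in>I. u i) x = (\<Sum>i\<in>I. coord (u i) x)"
  by (induction I rule: infinite_finite_induct) auto

lemma coord_times_summable: "(\<lambda>x. coord u x * coord v x) summable_on A"
  by (intro square_summable_times coord_square_summable)

instantiation l2 :: (type) real_inner
begin

definition inner_l2 :: "'a l2 \<Rightarrow> 'a l2 \<Rightarrow> real" where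
  "inner_l2 u v = (\<Sum>\<^sub>\<infinity>x. coord u x * coord v x)"

definition norm_l2 :: "'a l2 \<Rightarrow> real" where "norm_l2 u = sqrt (inner u u)"

definition sgn_l2 :: "'a l2 \<Rightarrow> 'a l2" where "sgn_l2 u = u /\<^sub>R norm u"

definition dist_l2 :: "'a l2 \<Rightarrow> 'a l2 \<Rightarrow> real" where "dist_l2 u v = norm (u - v)"

definition uniformity_l2 :: "('a l2 \<times> 'a l2) filter" where
  "uniformity_l2 = (INF e\<in>{0<..}. principal {(u, v). dist u v < e})"

definition open_l2 :: "'a l2 set \<Rightarrow> bool" where
  "open_l2 U \<longleftrightarrow> (\<forall>x\<in>U. \<forall>\<^sub>F (x', y) in uniformity. x' = x \<longrightarrow> y \<in> U)"

instance
proof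
  fix u v w :: "'a l2" and r :: real
  show "inner u v = inner v u"
    by (simp add: inner_l2_def mult.commute)
  show "inner (u + v) w = inner u w + inner v w"
    by (simp add: inner_l2_def distrib_right infsum_add coord_times_summable)
  show "inner (r *\<^sub>R u) v = r * inner u v"
    unfolding inner_l2_def coord_scaleR mult.assoc by (rule infsum_cmult_right')
  show "0 \<le> inner u u"
    by (simp add: inner_l2_def infsum_nonneg)
  show "inner u u = 0 \<longleftrightarrow> u = 0"
  proof
    assume "inner u u = 0"
    then have "coord u x * coord u x = 0" for x
      by (intro nonneg_infsum_le_0D[of "\<lambda>x. coord u x * coord u x" UNIV])
        (auto simp: inner_l2_def coord_times_summable)
    then show "u = 0" by (intro l2_eqI) simp
  qed (simp add: inner_l2_def)
  show "norm u = sqrt (inner u u)" by (simp add: norm_l2_def)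
qed (simp_all add: sgn_l2_def dist_l2_def uniformity_l2_def open_l2_def)

end

lemma inner_coord: "inner u v = (\<Sum>\<^sub>\<infinity>x. coord u x * coord v x)"
  by (simp add: inner_l2_def)

lemma norm_square_coord: "(norm u)\<^sup>2 = (\<Sum>\<^sub>\<infinity>x. (coord u x)\<^sup>2)"
  unfolding power2_norm_eq_inner inner_coord by (simp add: power2_eq_square)

lemma sum_coord_square_le:
  assumes "finite F"
  shows "(\<Sum>x\<in>F. (coord u x)\<^sup>2) \<le> (norm u)\<^sup>2"
  unfolding norm_square_coord
  by (rule finite_sum_le_infsum) (auto simp: coord_square_summable assms)

lemma abs_coord_le: "\<bar>coord u x\<bar> \<le> norm u"
  using sum_coord_square_le[of "{x}" u] by (simp add: power2_le_iff_abs_le)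

text \<open>Membership in \<open>l2\<close> and the bound on the norm are read off from finite sets of coordinates.\<close>

definition l2_of :: "('a \<Rightarrow> real) \<Rightarrow> 'a l2" where "l2_of f = Abs_l2 f"

lemma coord_l2_of: "(\<lambda>x. (f x)\<^sup>2) summable_on UNIV \<Longrightarrow> coord (l2_of f) = f"
  unfolding l2_of_def by (rule Abs_l2_inverse) simp

lemma
  assumes "\<And>F. finite F \<Longrightarrow> (\<Sum>x\<in>F. (f x)\<^sup>2) \<le> C\<^sup>2"
  shows coord_l2_of_bounded: "coord (l2_of f) = f"
    and norm_l2_of_bounded: "0 \<le> C \<Longrightarrow> norm (l2_of f) \<le> C"
proof -
  have s: "(\<lambda>x. (f x)\<^sup>2) summable_on UNIV"
    by (rule nonneg_bdd_above_summable_on) (use assms in \<open>auto intro!: bdd_aboveI[of _ "C\<^sup>2"]\<close>)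
  then show c: "coord (l2_of f) = f" by (rule coord_l2_of)
  assume "0 \<le> C"
  have "(norm (l2_of f))\<^sup>2 \<le> C\<^sup>2"
    unfolding norm_square_coord c
    by (rule infsum_le_finite_sums[OF s]) (use assms in auto)
  then show "norm (l2_of f) \<le> C" using \<open>0 \<le> C\<close> by (simp add: power2_le_iff_abs_le)
qed

lemma norm_le_coord:
  assumes "\<And>F. finite F \<Longrightarrow> (\<Sum>x\<in>F. (coord u x)\<^sup>2) \<le> C\<^sup>2" "0 \<le> C"
  shows "norm u \<le> C"
  using norm_l2_of_bounded[of "coord u" C] assms by (simp add: l2_of_def coord_inverse)

instance l2 :: (type) complete_space
proof
  fix X :: "nat \<Rightarrow> 'a l2"
  assume X: "Cauchy X"
  have "Cauchy (\<lambda>n. coord (X n) x)" for x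
  proof (rule metric_CauchyI)
    fix e :: real assume "0 < e"
    then obtain M where M: "\<forall>m\<ge>M. \<forall>n\<ge>M. dist (X m) (X n) < e"
      using metric_CauchyD[OF X] by blast
    have "dist (coord (X m) x) (coord (X n) x) \<le> dist (X m) (X n)" for m n
      using abs_coord_le[of "X m - X n" x] by (simp add: dist_norm)
    then show "\<exists>M. \<forall>m\<ge>M. \<forall>n\<ge>M. dist (coord (X m) x) (coord (X n) x) < e"
      using M by (intro exI[of _ M]) (blast intro: le_less_trans)
  qed
  then have "\<forall>x. \<exists>l. (\<lambda>n. coord (X n) x) \<longlonglongrightarrow> l"
    unfolding Cauchy_convergent_iff convergent_def by blast
  then obtain f where f: "\<And>x. (\<lambda>n. coord (X n) x) \<longlonglongrightarrow> f x"
    by metis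
  have key: "(\<Sum>x\<in>F. (coord (X n) x - f x)\<^sup>2) \<le> e\<^sup>2"
    if F: "finite F" and e: "0 < e" and N: "\<And>m. m \<ge> N \<Longrightarrow> dist (X n) (X m) < e" for F n e N
  proof (rule tendsto_upperbound)
    show "(\<lambda>m. \<Sum>x\<in>F. (coord (X n) x - coord (X m) x)\<^sup>2) \<longlonglongrightarrow> (\<Sum>x\<in>F. (coord (X n) x - f x)\<^sup>2)"
      by (intro tendsto_intros f)
    show "\<forall>\<^sub>F m in sequentially. (\<Sum>x\<in>F. (coord (X n) x - coord (X m) x)\<^sup>2) \<le> e\<^sup>2"
    proof (rule eventually_sequentiallyI[of N])
      fix m assume "N \<le> m"
      have "(\<Sum>x\<in>F. (coord (X n) x - coord (X m) x)\<^sup>2) \<le> (norm (X n - X m))\<^sup>2"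
        using sum_coord_square_le[OF F, of "X n - X m"] by simp
      also have "\<dots> \<le> e\<^sup>2"
        using N[OF \<open>N \<le> m\<close>] by (intro power_mono) (auto simp: dist_norm)
      finally show "(\<Sum>x\<in>F. (coord (X n) x - coord (X m) x)\<^sup>2) \<le> e\<^sup>2" .
    qed
  qed simp
  obtain N where N: "\<forall>m\<ge>N. \<forall>n\<ge>N. dist (X m) (X n) < 1"
    using metric_CauchyD[OF X, of 1] by auto
  define d where "d = l2_of (\<lambda>x. coord (X N) x - f x)"
  have d: "coord d = (\<lambda>x. coord (X N) x - f x)"
    unfolding d_def
  proof (rule coord_l2_of_bounded)
    fix F :: "'a set" assume "finite F"
    then show "(\<Sum>x\<in>F. (coord (X N) x - f x)\<^sup>2) \<le> 1\<^sup>2"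
      by (rule key[where N = N]) (use N in auto)
  qed
  define L where "L = X N - d"
  have L: "coord L x = f x" for x
    by (simp add: L_def d)
  have "X \<longlonglongrightarrow> L"
  proof (rule metric_LIMSEQ_I)
    fix e :: real assume e: "0 < e"
    then obtain N where N: "\<forall>m\<ge>N. \<forall>n\<ge>N. dist (X m) (X n) < e / 2"
      using metric_CauchyD[OF X, of "e/2"] by auto
    have "norm (X n - L) \<le> e / 2" if "n \<ge> N" for n
    proof (rule norm_le_coord)
      fix F :: "'a set" assume "finite F"
      then have "(\<Sum>x\<in>F. (coord (X n) x - f x)\<^sup>2) \<le> (e / 2)\<^sup>2"
        by (rule key[where N = N]) (use N e that in auto)
      then show "(\<Sum>x\<in>F. (coord (X n - L) x)\<^sup>2) \<le> (e / 2)\<^sup>2"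
        by (simp only: coord_diff L)
    qed (use e in simp)
    then show "\<exists>N. \<forall>n\<ge>N. dist (X n) L < e"
      using e by (intro exI[of _ N]) (force simp: dist_norm)
  qed
  then show "convergent X" by (auto simp: convergent_def)
qed

definition basis :: "'a \<Rightarrow> 'a l2" where "basis x = l2_of (\<lambda>y. if y = x then 1 else 0)"

lemma coord_basis: "coord (basis x) y = (if y = x then 1 else 0)"
proof -
  have "(\<Sum>y\<in>F. (if y = x then 1 else 0 :: real)\<^sup>2) \<le> 1\<^sup>2" if "finite F" for F
  proof -
    have "(\<Sum>y\<in>F. (if y = x then 1 else 0 :: real)\<^sup>2) = (\<Sum>y\<in>F. if y = x then 1 else 0)"
      by (rule sum.cong) auto
    also have "\<dots> \<le> 1" using that by simp
    finally show ?thesis by simp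
  qed
  then show ?thesis
    unfolding basis_def by (subst coord_l2_of_bounded[where C = 1]) simp_all
qed

lemma inner_basis_left [simp]: "inner (basis x) u = coord u x"
proof -
  have "inner (basis x) u = (\<Sum>\<^sub>\<infinity>y\<in>{x}. coord u y)"
    unfolding inner_coord by (rule infsum_cong_neutral) (auto simp: coord_basis)
  then show ?thesis by simp
qed

lemma inner_basis_right [simp]: "inner u (basis x) = coord u x"
  by (metis inner_basis_left inner_commute)

lemma norm_basis [simp]: "norm (basis x) = 1"
  by (simp add: norm_eq_sqrt_inner coord_basis)

definition trunc :: "'a set \<Rightarrow> 'a l2 \<Rightarrow> 'a l2" where
  "trunc F u = (\<Sum>x\<in>F. coord u x *\<^sub>R basis x)"

lemma coord_trunc: "finite F \<Longrightarrow> coord (trunc F u) y = (if y \<in> F then coord u y else 0)"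
  by (simp add: trunc_def coord_basis if_distrib if_distribR sum.delta' cong: if_cong)

lemma norm_minus_trunc:
  assumes "finite F"
  shows "(norm (u - trunc F u))\<^sup>2 = (norm u)\<^sup>2 - (\<Sum>x\<in>F. (coord u x)\<^sup>2)"
proof -
  have "inner u (trunc F u) = (\<Sum>x\<in>F. (coord u x)\<^sup>2)"
    by (simp add: trunc_def inner_sum_right power2_eq_square)
  moreover have "inner (trunc F u) (trunc F u) = (\<Sum>x\<in>F. (coord u x)\<^sup>2)"
    using assms by (subst (1) trunc_def) (simp add: inner_sum_left power2_eq_square coord_trunc)
  ultimately show ?thesis
    by (simp add: power2_norm_eq_inner inner_diff_left inner_diff_right inner_commute)
qed

lemma trunc_approx:
  assumes "0 < e"
  obtains F where "finite F" "norm (u - trunc F u) < e"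
proof -
  have "(norm u)\<^sup>2 - e\<^sup>2 < (\<Sum>\<^sub>\<infinity>x. (coord u x)\<^sup>2)"
    using assms by (simp add: norm_square_coord)
  moreover have "((\<lambda>x. (coord u x)\<^sup>2) has_sum (\<Sum>\<^sub>\<infinity>x. (coord u x)\<^sup>2)) UNIV"
    by (simp add: coord_square_summable)
  ultimately have "\<forall>\<^sub>F F in finite_subsets_at_top UNIV. (norm u)\<^sup>2 - e\<^sup>2 < (\<Sum>x\<in>F. (coord u x)\<^sup>2)"
    unfolding has_sum_def by (rule order_tendstoD(1)[rotated])
  then obtain F where F: "finite F" "(norm u)\<^sup>2 - e\<^sup>2 < (\<Sum>x\<in>F. (coord u x)\<^sup>2)"
    unfolding eventually_finite_subsets_at_top by (metis order_refl subset_UNIV)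
  then have "(norm (u - trunc F u))\<^sup>2 < e\<^sup>2"
    by (simp add: norm_minus_trunc)
  then have "norm (u - trunc F u) < e"
    using assms by (simp add: power2_less_imp_less)
  with F(1) show ?thesis by (rule that)
qed

definition permute :: "('a \<Rightarrow> 'a) \<Rightarrow> 'a l2 \<Rightarrow> 'a l2" where
  "permute p u = l2_of (\<lambda>x. coord u (p x))"

lemma coord_permute:
  assumes "inj p"
  shows "coord (permute p u) x = coord u (p x)"
proof -
  have "(\<lambda>x. (coord u (p x))\<^sup>2) summable_on UNIV"
    using summable_on_reindex[OF assms, of "\<lambda>x. (coord u x)\<^sup>2"] coord_square_summable[of u "range p"]
    by (simp add: o_def)
  then show ?thesis by (simp add: permute_def coord_l2_of)
qed

lemma inner_permute:
  assumes "bij p"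
  shows "inner (permute p u) (permute p v) = inner u v"
  unfolding inner_coord coord_permute[OF bij_is_inj[OF assms]]
  using infsum_reindex_bij_betw[OF assms, of "\<lambda>x. coord u x * coord v x"] by simp

lemma norm_permute: "bij p \<Longrightarrow> norm (permute p u) = norm u"
  by (simp add: norm_eq_sqrt_inner inner_permute)

text \<open>The infinitude of an amenable subgroup is used through this bound, which tends to \<open>0\<close> as the number of
its elements in \<open>S\<close> grows.\<close>

lemma le_one_over_sqrt_card:
  assumes S: "finite S" "S \<noteq> {}" and inj: "inj_on p S"
    and y: "\<And>s. s \<in> S \<Longrightarrow> y \<le> coord u (p s)" and u: "norm u \<le> 1"
  shows "y \<le> 1 / sqrt (card S)"
proof (cases "0 \<le> y")
  case True
  have "card S * y\<^sup>2 = (\<Sum>s\<in>S. y\<^sup>2)" by simp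
  also have "\<dots> \<le> (\<Sum>s\<in>S. (coord u (p s))\<^sup>2)"
    using y True by (intro sum_mono power_mono) auto
  also have "\<dots> = (\<Sum>x\<in>p ` S. (coord u x)\<^sup>2)" using inj by (simp add: sum.reindex)
  also have "\<dots> \<le> (norm u)\<^sup>2" using S(1) by (intro sum_coord_square_le) auto
  also have "\<dots> \<le> 1" using u by (simp add: power_le_one)
  finally have "y\<^sup>2 \<le> 1 / card S" using S by (simp add: field_simps card_gt_0_iff)
  then have "y \<le> sqrt (1 / card S)" by (rule real_le_rsqrt)
  then show ?thesis by (simp add: real_sqrt_divide)
qed (auto intro: order_trans[of _ 0])

section \<open>Resolvents and orthogonal vectors\<close>

lemma norm_diff_square:
  fixes u v :: "'h :: real_inner"
  shows "(norm (u - v))\<^sup>2 = (norm u)\<^sup>2 - 2 * inner u v + (norm v)\<^sup>2"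
  unfolding power2_norm_eq_inner
  by (simp add: inner_diff_left inner_diff_right inner_commute[of v u])

text \<open>The equation \<open>B v = u\<close> is the fixed point equation of \<open>v \<mapsto> v - k (B v - u)\<close>, and for a small step \<open>k\<close> the
coercivity of \<open>B\<close> makes this map a contraction.\<close>

lemma coercive_bij:
  fixes B :: "'h :: {real_inner, complete_space} \<Rightarrow> 'h"
  assumes B: "bounded_linear B" and coercive: "\<And>v. (norm v)\<^sup>2 \<le> inner (B v) v"
  shows "bij B"
proof -
  interpret B: bounded_linear B by fact
  obtain K where K: "0 < K" "\<And>v. norm (B v) \<le> norm v * K"
    using B.pos_bounded by blast
  define K1 where "K1 = max K 1"
  have K1: "1 \<le> K1" "\<And>v. norm (B v) \<le> K1 * norm v"
    unfolding K1_def by simp (metis K(2) mult.commute mult_right_mono max.cobounded1 norm_ge_zero order_trans)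
  \<comment> \<open>the step that minimises the bound \<open>1 - 2 k + k\<^sup>2 K1\<^sup>2\<close> for the squared Lipschitz constant\<close>
  define k where "k = 1 / K1\<^sup>2"
  have k: "0 < k" "k \<le> 1" "k * K1\<^sup>2 = 1"
    using K1(1) by (auto simp: k_def one_le_power)
  define q where "q = sqrt (1 - k)"
  have q: "0 \<le> q" "q < 1" "q\<^sup>2 = 1 - k"
    using k by (auto simp: q_def)
  have contr: "norm (v - k *\<^sub>R B v) \<le> q * norm v" for v
  proof -
    have "(norm (v - k *\<^sub>R B v))\<^sup>2 = (norm v)\<^sup>2 - 2 * k * inner (B v) v + k\<^sup>2 * (norm (B v))\<^sup>2"
      unfolding norm_diff_square by (simp add: inner_commute power_mult_distrib)
    also have "\<dots> \<le> (norm v)\<^sup>2 - 2 * k * (norm v)\<^sup>2 + k\<^sup>2 * (K1 * norm v)\<^sup>2"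
      using coercive[of v] K1(2)[of v] k(1) by (intro add_mono diff_mono mult_left_mono power_mono) auto
    also have "k\<^sup>2 * (K1 * norm v)\<^sup>2 = k * (k * K1\<^sup>2) * (norm v)\<^sup>2"
      by (simp add: power_mult_distrib power2_eq_square algebra_simps)
    also have "(norm v)\<^sup>2 - 2 * k * (norm v)\<^sup>2 + k * (k * K1\<^sup>2) * (norm v)\<^sup>2 = (q * norm v)\<^sup>2"
      by (simp add: k(3) q(3) power_mult_distrib algebra_simps)
    finally show ?thesis
      by (rule power2_le_imp_le) (use q in simp)
  qed
  have ex1: "\<exists>!v. B v = u" for u
  proof -
    have "\<exists>!v. v - k *\<^sub>R (B v - u) = v"
    proof (rule banach_fix_type[OF q(1,2)], intro allI)
      fix v w
      have eq: "(v - k *\<^sub>R (B v - u)) - (w - k *\<^sub>R (B w - u)) = (v - w) - k *\<^sub>R B (v - w)"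
        by (simp add: B.diff algebra_simps)
      show "dist (v - k *\<^sub>R (B v - u)) (w - k *\<^sub>R (B w - u)) \<le> q * dist v w"
        unfolding dist_norm eq by (rule contr)
    qed
    then show ?thesis using k(1) by simp
  qed
  show ?thesis
    unfolding bij_iff using ex1 by metis
qed

text \<open>The resolvent \<open>R = (1 + t A\<^sup>* A)\<^sup>-\<^sup>1\<close> of an operator \<open>A\<close> about whose size nothing is known. All bounds
below depend on \<open>t\<close> only; this uniformity is what makes the resolvent useful. It will be used for the
matrix of a potential on a Foelner set and for the frame operator of the translates of finitely many
vectors.\<close>

locale regularisation =
  fixes A :: "'h :: {real_inner, complete_space} \<Rightarrow> 'k :: real_inner"
    and A' :: "'k \<Rightarrow> 'h" and t :: real
  assumes bounded_A: "bounded_linear A" and bounded_A': "bounded_linear A'"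
    and adjoint_A: "\<And>v k. inner (A v) k = inner v (A' k)" and t_pos: "0 < t"
begin

definition B :: "'h \<Rightarrow> 'h" where "B v = v + t *\<^sub>R A' (A v)"

definition R :: "'h \<Rightarrow> 'h" where "R = inv_into UNIV B"

lemma bounded_B: "bounded_linear B"
  unfolding B_def
  by (intro bounded_linear_add bounded_linear_ident bounded_linear_const_scaleR
      bounded_linear_compose[OF bounded_A'] bounded_A)

lemma inner_B: "inner (B u) v = inner u v + t * inner (A u) (A v)"
  using adjoint_A[of v "A u"] by (simp add: B_def inner_add_left inner_add_right inner_commute)

lemma bij_B: "bij B"
proof (rule coercive_bij[OF bounded_B])
  show "(norm v)\<^sup>2 \<le> inner (B v) v" for v
    using t_pos by (simp add: inner_B power2_norm_eq_inner)
qed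

lemma B_R: "B (R v) = v"
  unfolding R_def by (rule surj_f_inv_f[OF bij_is_surj[OF bij_B]])

lemma R_B: "R (B v) = v"
  unfolding R_def by (rule inv_f_f[OF bij_is_inj[OF bij_B]])

lemma R_eqI: "B w = v \<Longrightarrow> R v = w"
  using R_B by blast

lemma linear_R: "linear R"
proof -
  interpret B: bounded_linear B by (rule bounded_B)
  show ?thesis
    by (rule linearI; rule R_eqI) (simp_all add: B.add B.scaleR B_R)
qed

lemma diff_R: "v - R v = t *\<^sub>R A' (A (R v))"
  using B_R[of v] by (simp add: B_def algebra_simps)

lemma R_symmetric: "inner (R u) v = inner u (R v)"
proof -
  have "inner (R u) v = inner (R u) (B (R v))" by (simp add: B_R)
  also have "\<dots> = inner (B (R u)) (R v)"
    by (metis inner_B inner_commute)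
  finally show ?thesis by (simp add: B_R)
qed

lemma energy_R: "(norm (R v))\<^sup>2 + t * (norm (A (R v)))\<^sup>2 = inner v (R v)"
  using inner_B[of "R v" "R v"] by (simp add: B_R power2_norm_eq_inner)

lemma norm_R_le: "norm (R v) \<le> norm v"
proof (cases "R v = 0")
  case False
  have "(norm (R v))\<^sup>2 \<le> inner v (R v)"
    unfolding energy_R[symmetric] using t_pos by simp
  also have "\<dots> \<le> norm v * norm (R v)" by (rule norm_cauchy_schwarz)
  finally show ?thesis using False by (simp add: power2_eq_square)
qed simp

text \<open>This is \<open>(1 - R)\<^sup>2 \<le> 1 - R\<close>.\<close>

lemma norm_diff_R_le: "(norm (v - R v))\<^sup>2 \<le> inner v (v - R v)"
proof -
  have "inner (v - R v) (R v) = t * (norm (A (R v)))\<^sup>2"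
    using energy_R[of v] by (simp add: inner_diff_left power2_norm_eq_inner)
  then have "0 \<le> inner (v - R v) (R v)"
    using t_pos by simp
  then show ?thesis
    by (simp add: power2_norm_eq_inner inner_diff_left inner_diff_right inner_commute)
qed

text \<open>The operator \<open>R A'\<close> is \<open>(1 + t A' A)\<^sup>-\<^sup>1 A'\<close>; its singular values are \<open>s / (1 + t s\<^sup>2)\<close>, those of
  \<open>t A R A'\<close> are \<open>t s\<^sup>2 / (1 + t s\<^sup>2)\<close>.\<close>

lemma norm_R_adjoint_le: "norm (R (A' k)) \<le> norm k / (2 * sqrt t)"
  and norm_A_R_adjoint_le: "t * norm (A (R (A' k))) \<le> norm k"
proof -
  define w where "w = R (A' k)"
  define x where "x = norm (A w)"
  have "inner (A' k) w = inner (A w) k"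
    by (metis adjoint_A inner_commute)
  then have "(norm w)\<^sup>2 + t * x\<^sup>2 = inner (A w) k"
    using energy_R[of "A' k"] by (simp add: w_def x_def)
  also have "\<dots> \<le> x * norm k"
    unfolding x_def by (rule norm_cauchy_schwarz)
  finally have le: "(norm w)\<^sup>2 + t * x\<^sup>2 \<le> x * norm k" .
  show "t * norm (A (R (A' k))) \<le> norm k"
  proof (cases "x = 0")
    case False
    then have "0 < x" by (simp add: x_def)
    moreover have "x * (t * x) \<le> x * norm k"
    proof -
      have "x * (t * x) = t * x\<^sup>2" by (simp add: power2_eq_square)
      then show ?thesis using le zero_le_power2[of "norm w"] by linarith
    qed
    ultimately show ?thesis by (simp add: x_def w_def)
  qed (simp add: x_def w_def)
  have "0 \<le> (norm k - 2 * t * x)\<^sup>2" by simp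
  then have "4 * t * (x * norm k - t * x\<^sup>2) \<le> (norm k)\<^sup>2"
    by (simp add: power2_eq_square algebra_simps)
  moreover have "4 * t * (norm w)\<^sup>2 \<le> 4 * t * (x * norm k - t * x\<^sup>2)"
    using le t_pos by (intro mult_left_mono) auto
  ultimately have "4 * t * (norm w)\<^sup>2 \<le> (norm k)\<^sup>2" by simp
  then have "(2 * sqrt t * norm w)\<^sup>2 \<le> (norm k)\<^sup>2"
    using t_pos by (simp add: power_mult_distrib)
  then have "2 * sqrt t * norm w \<le> norm k"
    by (rule power2_le_imp_le) simp
  then show "norm (R (A' k)) \<le> norm k / (2 * sqrt t)"
    using t_pos by (simp add: w_def field_simps)
qed

end

text \<open>The vector \<open>e\<close> is the component of \<open>c\<close> orthogonal to the closure of \<open>Z\<close>; a sequence in \<open>Z\<close> whose distances to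
\<open>c\<close> approach the infimum is Cauchy by the parallelogram law.\<close>

lemma orthogonal_witness:
  fixes c :: "'h :: {real_inner, complete_space}"
  assumes Z: "subspace Z" and c: "c \<notin> closure Z"
  obtains e where "\<And>z. z \<in> Z \<Longrightarrow> inner e z = 0" "inner e c \<noteq> 0"
proof -
  define d where "d = (INF z\<in>Z. norm (c - z))"
  have ne: "Z \<noteq> {}" using subspace_0[OF Z] by auto
  have bb: "bdd_below ((\<lambda>z. norm (c - z)) ` Z)" by (rule bdd_belowI[of _ 0]) auto
  have d_le: "d \<le> norm (c - z)" if "z \<in> Z" for z
    unfolding d_def by (rule cINF_lower[OF bb that])
  have d0: "0 \<le> d" unfolding d_def by (rule cINF_greatest[OF ne]) simp
  have "\<exists>z\<in>Z. norm (c - z) < sqrt (d\<^sup>2 + 1 / Suc n)" for n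
  proof -
    have "d < sqrt (d\<^sup>2 + 1 / Suc n)"
      by (rule real_less_rsqrt) simp
    then show ?thesis
      unfolding d_def using cINF_less_iff[OF ne bb] by blast
  qed
  then obtain z where z: "\<And>n. z n \<in> Z" "\<And>n. norm (c - z n) < sqrt (d\<^sup>2 + 1 / Suc n)"
    by metis
  have z2: "(norm (c - z n))\<^sup>2 \<le> d\<^sup>2 + 1 / Suc n" for n
  proof -
    have "(norm (c - z n))\<^sup>2 \<le> (sqrt (d\<^sup>2 + 1 / Suc n))\<^sup>2"
      using z(2)[of n] by (intro power_mono) auto
    then show ?thesis by simp
  qed
  have par: "(norm (z n - z m))\<^sup>2 \<le> 2 / Suc n + 2 / Suc m" for n m
  proof -
    have "(1/2) *\<^sub>R (z n + z m) \<in> Z"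
      by (intro subspace_scale[OF Z] subspace_add[OF Z] z(1))
    then have "d\<^sup>2 \<le> (norm (c - (1/2) *\<^sub>R (z n + z m)))\<^sup>2"
      using d_le d0 by (intro power_mono) auto
    moreover have "(norm (z n - z m))\<^sup>2 + 4 * (norm (c - (1/2) *\<^sub>R (z n + z m)))\<^sup>2
        = 2 * (norm (c - z n))\<^sup>2 + 2 * (norm (c - z m))\<^sup>2"
      by (simp add: power2_norm_eq_inner inner_diff_left inner_diff_right inner_add_left
          inner_add_right inner_commute algebra_simps)
    ultimately show ?thesis using z2[of n] z2[of m] by simp
  qed
  have "Cauchy z"
  proof (rule metric_CauchyI)
    fix e :: real assume e: "0 < e"
    obtain N :: nat where N: "4 / e\<^sup>2 < N" using reals_Archimedean2 by blast
    have "dist (z m) (z n) < e" if "m \<ge> N" "n \<ge> N" for m n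
    proof -
      have pos: "0 < real N" using N e by (smt (verit) divide_nonneg_nonneg zero_le_power2)
      have "(norm (z m - z n))\<^sup>2 \<le> 2 / Suc m + 2 / Suc n" by (rule par)
      also have "\<dots> \<le> 2 / N + 2 / N"
        using that pos by (intro add_mono divide_left_mono) auto
      also have "\<dots> < e\<^sup>2" using N e pos by (simp add: field_simps)
      finally show ?thesis using e by (simp add: dist_norm power2_less_imp_less)
    qed
    then show "\<exists>M. \<forall>m\<ge>M. \<forall>n\<ge>M. dist (z m) (z n) < e" by blast
  qed
  then obtain y where y: "z \<longlonglongrightarrow> y"
    by (metis Cauchy_convergent_iff convergent_def)
  have "y \<in> closure Z"
    using y z(1) closure_sequential by blast
  define e where "e = c - y"
  have e0: "e \<noteq> 0" using c \<open>y \<in> closure Z\<close> by (auto simp: e_def)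
  have lim: "(\<lambda>n. norm (c - z n)) \<longlonglongrightarrow> norm e"
    unfolding e_def by (intro tendsto_intros y)
  have "(norm e)\<^sup>2 \<le> d\<^sup>2"
  proof (rule LIMSEQ_le)
    show "(\<lambda>n. (norm (c - z n))\<^sup>2) \<longlonglongrightarrow> (norm e)\<^sup>2" by (intro tendsto_intros lim)
    have "(\<lambda>n. d\<^sup>2 + inverse (real (Suc n))) \<longlonglongrightarrow> d\<^sup>2 + 0"
      by (intro tendsto_intros LIMSEQ_inverse_real_of_nat)
    then show "(\<lambda>n. d\<^sup>2 + 1 / Suc n) \<longlonglongrightarrow> d\<^sup>2" by (simp add: inverse_eq_divide)
    show "\<exists>N. \<forall>n\<ge>N. (norm (c - z n))\<^sup>2 \<le> d\<^sup>2 + 1 / Suc n" using z2 by blast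
  qed
  have orth: "inner e x = 0" if x: "x \<in> Z" for x
  proof (rule ccontr)
    assume n0: "inner e x \<noteq> 0"
    have ge: "(norm e)\<^sup>2 \<le> (norm (e - s *\<^sub>R x))\<^sup>2" for s
    proof -
      have "d \<le> norm (e - s *\<^sub>R x)"
      proof (rule tendsto_lowerbound)
        show "(\<lambda>n. norm ((c - z n) - s *\<^sub>R x)) \<longlonglongrightarrow> norm (e - s *\<^sub>R x)"
          unfolding e_def by (intro tendsto_intros y)
        have "d \<le> norm ((c - z n) - s *\<^sub>R x)" for n
          using d_le[of "z n + s *\<^sub>R x"] subspace_add[OF Z z(1) subspace_scale[OF Z x]]
          by (simp add: diff_diff_add)
        then show "\<forall>\<^sub>F n in sequentially. d \<le> norm ((c - z n) - s *\<^sub>R x)" by simp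
      qed simp
      then have "d\<^sup>2 \<le> (norm (e - s *\<^sub>R x))\<^sup>2" using d0 by (intro power_mono)
      with \<open>(norm e)\<^sup>2 \<le> d\<^sup>2\<close> show ?thesis by (rule order_trans)
    qed
    have x0: "0 < inner x x" using n0 by (auto simp: inner_gt_zero_iff)
    define s where "s = inner e x / inner x x"
    have "(norm (s *\<^sub>R x))\<^sup>2 = s\<^sup>2 * inner x x"
      unfolding power2_norm_eq_inner by (simp add: power2_eq_square)
    then have "(norm (e - s *\<^sub>R x))\<^sup>2 = (norm e)\<^sup>2 - 2 * (s * inner e x) + s\<^sup>2 * inner x x"
      by (simp only: norm_diff_square inner_scaleR_right)
    also have "\<dots> = (norm e)\<^sup>2 - (inner e x)\<^sup>2 / inner x x"
      using x0 by (simp add: s_def power2_eq_square)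
    finally have "(norm (e - s *\<^sub>R x))\<^sup>2 = (norm e)\<^sup>2 - (inner e x)\<^sup>2 / inner x x" .
    moreover have "0 < (inner e x)\<^sup>2 / inner x x"
      using n0 x0 by simp
    ultimately show False using ge[of s] by simp
  qed
  have "inner e y = 0"
  proof (rule LIMSEQ_unique)
    show "(\<lambda>n. inner e (z n)) \<longlonglongrightarrow> inner e y" by (intro tendsto_intros y)
    show "(\<lambda>n. inner e (z n)) \<longlonglongrightarrow> 0" using orth z(1) by simp
  qed
  then have "inner e c = inner e e" by (simp add: e_def inner_diff_right)
  then have "inner e c \<noteq> 0" using e0 by simp
  with orth show ?thesis by (rule that)
qed

section \<open>Bounded quasi-cocycles\<close>

text \<open>The maps \<open>v \<mapsto> \<pi> g v + b g\<close> almost preserve the range of \<open>b\<close>, up to the defect. They must therefore almost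
fix an approximate circumcentre \<open>\<xi>\<close> of the range: otherwise the midpoint of \<open>\<xi>\<close> and its image would be the
centre of a noticeably smaller ball around the range. The error grows only like the square root of
the bound \<open>M\<close>.\<close>

lemma bounded_quasi_cocycle_near_coboundary:
  fixes b :: "'g \<Rightarrow> 'h :: real_inner" and \<pi> :: "'g \<Rightarrow> 'h \<Rightarrow> 'h" and m :: "'g \<Rightarrow> 'g \<Rightarrow> 'g"
  assumes isometry: "\<And>g u v. norm (\<pi> g u - \<pi> g v) = norm (u - v)"
    and surj: "\<And>g x. \<exists>h. x = m g h"
    and defect: "\<And>g h. norm (\<pi> g (b h) - b (m g h) + b g) \<le> D"
    and bound: "\<And>g. norm (b g) \<le> M"
  obtains \<xi> where "\<And>g. norm (b g - (\<xi> - \<pi> g \<xi>)) \<le> 2 * sqrt (1 + 2 * (M + 1) * D + D\<^sup>2)"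
proof -
  have D0: "0 \<le> D" using order_trans[OF norm_ge_zero defect] .
  have M0: "0 \<le> M" using order_trans[OF norm_ge_zero bound] .
  define r where "r \<xi> = (SUP g. norm (b g - \<xi>))" for \<xi>
  have ba: "bdd_above (range (\<lambda>g. norm (b g - \<xi>)))" for \<xi>
  proof (rule bdd_aboveI2)
    fix g
    show "norm (b g - \<xi>) \<le> M + norm \<xi>"
      using norm_triangle_ineq4[of "b g" \<xi>] bound[of g] by linarith
  qed
  have r_ge: "norm (b g - \<xi>) \<le> r \<xi>" for g \<xi>
    unfolding r_def by (rule cSUP_upper[OF _ ba]) simp
  have r_le: "r \<xi> \<le> C" if "\<And>g. norm (b g - \<xi>) \<le> C" for \<xi> C
    unfolding r_def by (rule cSUP_least) (use that in auto)
  have r_nonneg: "0 \<le> r \<xi>" for \<xi> using order_trans[OF norm_ge_zero r_ge] .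
  define r0 where "r0 = (INF \<xi>. r \<xi>)"
  have bb: "bdd_below (range r)" by (rule bdd_belowI[of _ 0]) (use r_nonneg in auto)
  have r0_le: "r0 \<le> r \<xi>" for \<xi> unfolding r0_def by (rule cINF_lower[OF bb]) simp
  have r0_nonneg: "0 \<le> r0" unfolding r0_def by (rule cINF_greatest) (use r_nonneg in auto)
  have "r0 < sqrt (r0\<^sup>2 + 1)" by (rule real_less_rsqrt) simp
  then obtain \<xi> where \<xi>: "r \<xi> < sqrt (r0\<^sup>2 + 1)"
    unfolding r0_def using cINF_less_iff[OF _ bb] by blast
  have "(r \<xi>)\<^sup>2 \<le> (sqrt (r0\<^sup>2 + 1))\<^sup>2" using \<xi> r_nonneg by (intro power_mono) auto
  then have r2: "(r \<xi>)\<^sup>2 \<le> r0\<^sup>2 + 1" by simp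
  have "r0 \<le> M" using r0_le[of 0] r_le[of 0 M] bound by (auto intro: order_trans)
  then have "r0\<^sup>2 \<le> M\<^sup>2" using r0_nonneg by (intro power_mono)
  then have "(r \<xi>)\<^sup>2 \<le> (M + 1)\<^sup>2" using r2 M0 by (simp add: power2_sum)
  then have rM: "r \<xi> \<le> M + 1" by (rule power2_le_imp_le) (use M0 in simp)
  show ?thesis
  proof (rule that[of \<xi>])
    fix g
    define \<alpha> where "\<alpha> = \<pi> g \<xi> + b g"
    define \<mu> where "\<mu> = (1/2) *\<^sub>R (\<xi> + \<alpha>)"
    have near: "norm (b x - \<alpha>) \<le> r \<xi> + D" for x
    proof -
      obtain h where x: "x = m g h" using surj by blast
      have eq: "b x - \<alpha> = (\<pi> g (b h) - \<pi> g \<xi>) - (\<pi> g (b h) - b (m g h) + b g)"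
        by (simp add: x \<alpha>_def algebra_simps)
      have "norm (b x - \<alpha>) \<le> norm (\<pi> g (b h) - \<pi> g \<xi>) + norm (\<pi> g (b h) - b (m g h) + b g)"
        unfolding eq by (rule norm_triangle_ineq4)
      then show ?thesis using isometry[of g "b h" \<xi>] r_ge[of h \<xi>] defect[of g h] by linarith
    qed
    have "(norm (b x - \<mu>))\<^sup>2 \<le> (r \<xi> + D)\<^sup>2 - (norm (\<xi> - \<alpha>))\<^sup>2 / 4" for x
    proof -
      have "4 * (norm (b x - \<mu>))\<^sup>2 + (norm (\<xi> - \<alpha>))\<^sup>2
          = 2 * (norm (b x - \<xi>))\<^sup>2 + 2 * (norm (b x - \<alpha>))\<^sup>2"
        by (simp add: \<mu>_def power2_norm_eq_inner inner_diff_left inner_diff_right inner_add_left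
            inner_add_right inner_commute algebra_simps)
      moreover have "(norm (b x - \<xi>))\<^sup>2 \<le> (r \<xi> + D)\<^sup>2"
        using r_ge[of x \<xi>] D0 by (intro power_mono) auto
      moreover have "(norm (b x - \<alpha>))\<^sup>2 \<le> (r \<xi> + D)\<^sup>2"
        using near[of x] by (intro power_mono) auto
      ultimately show ?thesis by simp
    qed
    note mid = this
    have pos: "0 \<le> (r \<xi> + D)\<^sup>2 - (norm (\<xi> - \<alpha>))\<^sup>2 / 4"
      using order_trans[OF zero_le_power2 mid[of g]] .
    have "r \<mu> \<le> sqrt ((r \<xi> + D)\<^sup>2 - (norm (\<xi> - \<alpha>))\<^sup>2 / 4)"
      by (rule r_le) (intro real_le_rsqrt mid)
    then have "r0 \<le> sqrt ((r \<xi> + D)\<^sup>2 - (norm (\<xi> - \<alpha>))\<^sup>2 / 4)"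
      using r0_le[of \<mu>] by simp
    then have "r0\<^sup>2 \<le> (sqrt ((r \<xi> + D)\<^sup>2 - (norm (\<xi> - \<alpha>))\<^sup>2 / 4))\<^sup>2"
      using r0_nonneg by (intro power_mono)
    also have "\<dots> = (r \<xi> + D)\<^sup>2 - (norm (\<xi> - \<alpha>))\<^sup>2 / 4" using pos by simp
    finally have "(norm (\<xi> - \<alpha>))\<^sup>2 \<le> 4 * (1 + 2 * r \<xi> * D + D\<^sup>2)"
      using r2 by (simp add: power2_sum)
    also have "\<dots> \<le> 4 * (1 + 2 * (M + 1) * D + D\<^sup>2)"
      using rM D0 by (intro mult_left_mono add_mono mult_right_mono) auto
    finally have "norm (\<xi> - \<alpha>) \<le> sqrt (4 * (1 + 2 * (M + 1) * D + D\<^sup>2))"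
      by (rule real_le_rsqrt)
    also have "\<dots> = 2 * sqrt (1 + 2 * (M + 1) * D + D\<^sup>2)"
      by (simp only: real_sqrt_mult real_sqrt_four)
    finally have "norm (\<alpha> - \<xi>) \<le> 2 * sqrt (1 + 2 * (M + 1) * D + D\<^sup>2)"
      by (simp only: norm_minus_commute)
    moreover have "b g - (\<xi> - \<pi> g \<xi>) = \<alpha> - \<xi>" by (simp add: \<alpha>_def)
    ultimately show "norm (b g - (\<xi> - \<pi> g \<xi>)) \<le> 2 * sqrt (1 + 2 * (M + 1) * D + D\<^sup>2)"
      by (simp only:)
  qed
qed

text \<open>The spectral gap bounds the vector \<open>\<xi>\<close> of the nearby coboundary in terms of finitely many values of \<open>b\<close>,
so the supremum \<open>M\<close> of \<open>b\<close> satisfies an inequality of the form \<open>M \<le> \<alpha> + \<beta> \<surd>M\<close>, which bounds \<open>M\<close>. That the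
resulting bound does not depend on \<open>M\<close> is the point of the lemma.\<close>

lemma bounded_quasi_cocycle_uniform_bound:
  fixes b :: "'g \<Rightarrow> 'h :: real_inner" and \<pi> :: "'g \<Rightarrow> 'h \<Rightarrow> 'h" and m :: "'g \<Rightarrow> 'g \<Rightarrow> 'g"
  assumes isometry: "\<And>g u v. norm (\<pi> g u - \<pi> g v) = norm (u - v)" and zero: "\<And>g. \<pi> g 0 = 0"
    and surj: "\<And>g x. \<exists>h. x = m g h"
    and defect: "\<And>g h. norm (\<pi> g (b h) - b (m g h) + b g) \<le> D"
    and bounded: "bounded (range b)"
    and gap: "\<And>\<xi>. norm \<xi> \<le> \<kappa> * (\<Sum>s\<in>S. norm (\<pi> s \<xi> - \<xi>))" and \<kappa>: "0 \<le> \<kappa>"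
    and S: "(\<Sum>s\<in>S. norm (b s)) \<le> \<beta>"
    and P: "P = 1 + 2 * \<kappa> * card S"
  shows "norm (b g) \<le> 2 * (P * (1 + D)\<^sup>2 + P * (4 * P * D + 1) + 2 * \<kappa> * \<beta>)"
proof -
  have D0: "0 \<le> D" using order_trans[OF norm_ge_zero defect] .
  define M where "M = (SUP g. norm (b g))"
  have ba: "bdd_above (range (\<lambda>g. norm (b g)))"
    using bounded by (auto simp: bounded_iff bdd_above_def)
  have bM: "norm (b g) \<le> M" for g
    unfolding M_def by (rule cSUP_upper[OF _ ba]) simp
  have M0: "0 \<le> M" using order_trans[OF norm_ge_zero bM] .
  define y where "y = 1 + 2 * (M + 1) * D + D\<^sup>2"
  have y0: "0 \<le> y" using D0 M0 by (simp add: y_def)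
  define \<epsilon> where "\<epsilon> = 2 * sqrt y"
  have \<epsilon>0: "0 \<le> \<epsilon>" using y0 by (simp add: \<epsilon>_def)
  obtain \<xi> where \<xi>: "\<And>g. norm (b g - (\<xi> - \<pi> g \<xi>)) \<le> \<epsilon>"
    unfolding \<epsilon>_def y_def
    by (rule bounded_quasi_cocycle_near_coboundary
        [where \<pi> = \<pi> and m = m and b = b, OF isometry surj defect bM]) blast
  have "norm (\<pi> s \<xi> - \<xi>) \<le> norm (b s) + \<epsilon>" for s
    using \<xi>[of s] norm_triangle_ineq4[of "b s - (\<xi> - \<pi> s \<xi>)" "b s"] by (simp add: algebra_simps)
  then have "(\<Sum>s\<in>S. norm (\<pi> s \<xi> - \<xi>)) \<le> (\<Sum>s\<in>S. norm (b s) + \<epsilon>)"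
    by (rule sum_mono)
  also have "\<dots> \<le> \<beta> + card S * \<epsilon>" using S by (simp add: sum.distrib)
  finally have "norm \<xi> \<le> \<kappa> * (\<beta> + card S * \<epsilon>)"
    using gap[of \<xi>] \<kappa> by (meson mult_left_mono order_trans)
  moreover have "norm (b g) \<le> \<epsilon> + 2 * norm \<xi>" for g
  proof -
    have "norm (\<pi> g \<xi>) = norm \<xi>" using isometry[of g \<xi> 0] zero by simp
    moreover have "norm (b g) \<le> norm (b g - (\<xi> - \<pi> g \<xi>)) + norm (\<xi> - \<pi> g \<xi>)"
      by (metis norm_triangle_sub add.commute)
    ultimately show ?thesis using \<xi>[of g] norm_triangle_ineq4[of \<xi> "\<pi> g \<xi>"] by linarith
  qed
  ultimately have "norm (b g) \<le> \<epsilon> + 2 * (\<kappa> * (\<beta> + card S * \<epsilon>))" for g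
    by (smt (verit))
  then have bP: "norm (b g) \<le> P * \<epsilon> + 2 * \<kappa> * \<beta>" for g
    by (simp add: P algebra_simps)
  then have M_le: "M \<le> P * \<epsilon> + 2 * \<kappa> * \<beta>"
    unfolding M_def by (intro cSUP_least) auto
  have P1: "1 \<le> P" using \<kappa> by (simp add: P)
  define l where "l = 4 * P * D + 1"
  have l1: "1 \<le> l" using P1 D0 by (simp add: l_def)
  \<comment> \<open>\<open>2 \<surd>y \<le> y / l + l\<close>, with \<open>l\<close> so large that the part of \<open>P y / l\<close> proportional to \<open>M\<close> is at most \<open>M / 2\<close>\<close>
  have "0 \<le> (sqrt y - l)\<^sup>2" by simp
  then have "2 * sqrt y * l \<le> y + l\<^sup>2" using y0 by (simp add: power2_diff)
  then have "\<epsilon> \<le> y / l + l" using l1 by (simp add: \<epsilon>_def field_simps power2_eq_square)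
  then have "P * \<epsilon> \<le> P * (y / l + l)" using P1 by (intro mult_left_mono) auto
  also have "\<dots> = P * (1 + D)\<^sup>2 / l + (2 * P * D / l) * M + P * l"
    by (simp add: y_def power2_eq_square add_divide_distrib algebra_simps)
  also have "\<dots> \<le> P * (1 + D)\<^sup>2 + 1/2 * M + P * l"
  proof (intro add_mono mult_right_mono order_refl M0)
    have "0 \<le> P * (1 + D)\<^sup>2" using P1 by simp
    then have "P * (1 + D)\<^sup>2 * 1 \<le> P * (1 + D)\<^sup>2 * l" using l1 by (intro mult_left_mono)
    then show "P * (1 + D)\<^sup>2 / l \<le> P * (1 + D)\<^sup>2" using l1 by (simp add: divide_le_eq)
    show "2 * P * D / l \<le> 1/2" using l1 by (simp add: divide_le_eq) (simp add: l_def)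
  qed (use l1 in simp)
  finally have "M \<le> 2 * (P * (1 + D)\<^sup>2 + P * l + 2 * \<kappa> * \<beta>)"
    using M_le by simp
  then show ?thesis using bM[of g] unfolding l_def by simp
qed

section \<open>A marriage theorem\<close>

text \<open>Hall's theorem for an infinite family of finite sets, by Rado's argument: a family that is minimal
among the subfamilies with Hall's condition consists of singletons, because if two different elements of one
member could not be removed, the two tight sets of indices that prevent this would contradict
submodularity. Minimal families exist by Zorn's lemma; the families are represented by the set \<open>D\<close> of
removed pairs, so that maximal \<open>D\<close> are needed.\<close>

lemma infinite_hall:
  fixes N :: "'i \<Rightarrow> 'b set"
  assumes fin: "\<And>i. i \<in> I \<Longrightarrow> finite (N i)"
    and hall: "\<And>J. finite J \<Longrightarrow> J \<subseteq> I \<Longrightarrow> card J \<le> card (\<Union>i\<in>J. N i)"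
  obtains f where "inj_on f I" "\<And>i. i \<in> I \<Longrightarrow> f i \<in> N i"
proof -
  define M where "M D i = {b \<in> N i. (i, b) \<notin> D}" for D i
  define ok where "ok D \<longleftrightarrow> (\<forall>J. finite J \<longrightarrow> J \<subseteq> I \<longrightarrow> card J \<le> card (\<Union>i\<in>J. M D i))" for D
  define \<A> where "\<A> = {D. D \<subseteq> Sigma I N \<and> ok D}"
  have "{} \<in> \<A>" using hall by (auto simp: \<A>_def ok_def M_def)
  have "\<exists>U\<in>\<A>. \<forall>X\<in>C. X \<subseteq> U" if C: "subset.chain \<A> C" for C
  proof (cases "C = {}")
    case False
    have CA: "X \<in> \<A>" if "X \<in> C" for X using C that by (auto simp: subset.chain_def)
    have "ok (\<Union>C)"
      unfolding ok_def
    proof (intro allI impI)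
      fix J assume J: "finite J" "J \<subseteq> I"
      \<comment> \<open>only finitely many removals concern \<open>J\<close>, so a single member of the chain contains them all\<close>
      have "finite (Sigma J N \<inter> \<Union>C)" using J fin by auto
      then obtain X where X: "X \<in> C" "Sigma J N \<inter> \<Union>C \<subseteq> X"
        using finite_subset_Union_chain[OF _ _ False C] by (metis inf_le2)
      have "M (\<Union>C) i = M X i" if "i \<in> J" for i
        using X that by (auto simp: M_def)
      then show "card J \<le> card (\<Union>i\<in>J. M (\<Union>C) i)"
        using CA[OF X(1)] J by (auto simp: \<A>_def ok_def)
    qed
    moreover have "\<Union>C \<subseteq> Sigma I N" using CA by (auto simp: \<A>_def)
    ultimately have "\<Union>C \<in> \<A>" by (simp add: \<A>_def)
    then show ?thesis by blast
  qed (use \<open>{} \<in> \<A>\<close> in blast)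
  then obtain D where D: "D \<in> \<A>" and max: "\<And>X. X \<in> \<A> \<Longrightarrow> D \<subseteq> X \<Longrightarrow> X = D"
    using subset_Zorn[of \<A>] by metis
  have okD: "card J \<le> card (\<Union>i\<in>J. M D i)" if "finite J" "J \<subseteq> I" for J
    using D that by (auto simp: \<A>_def ok_def)
  have finM: "finite (M D i)" if "i \<in> I" for i using fin[OF that] by (simp add: M_def)
  have tight: "\<exists>J. finite J \<and> J \<subseteq> I \<and> i \<notin> J \<and> card ((\<Union>j\<in>J. M D j) \<union> (M D i - {x})) \<le> card J"
    if i: "i \<in> I" and x: "x \<in> M D i" for i x
  proof -
    define D' where "D' = insert (i, x) D"
    have "(i, x) \<notin> D" "x \<in> N i" using x by (auto simp: M_def)
    then have "D' \<notin> \<A>" using max[of D'] by (auto simp: D'_def)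
    then have "\<not> ok D'" using D \<open>x \<in> N i\<close> i by (auto simp: \<A>_def D'_def)
    then obtain J where J: "finite J" "J \<subseteq> I" "card (\<Union>j\<in>J. M D' j) < card J"
      by (auto simp: ok_def not_le)
    have M': "M D' j = (if j = i then M D i - {x} else M D j)" for j
      by (auto simp: M_def D'_def)
    have "i \<in> J"
    proof (rule ccontr)
      assume "i \<notin> J"
      then have "(\<Union>j\<in>J. M D' j) = (\<Union>j\<in>J. M D j)" by (auto simp: M')
      then show False using J okD[of J] by simp
    qed
    define J0 where "J0 = J - {i}"
    have "(\<Union>j\<in>J. M D' j) = (\<Union>j\<in>J0. M D j) \<union> (M D i - {x})"
    proof -
      have "(\<Union>j\<in>J0. M D' j) = (\<Union>j\<in>J0. M D j)" by (rule SUP_cong) (auto simp: M' J0_def)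
      moreover have "J = insert i J0" using \<open>i \<in> J\<close> by (auto simp: J0_def)
      ultimately show ?thesis by (simp add: M'[of i] Un_commute)
    qed
    moreover have "card J = Suc (card J0)"
      using card_Suc_Diff1[OF J(1) \<open>i \<in> J\<close>] by (simp only: J0_def)
    ultimately show ?thesis
      using J by (intro exI[of _ J0]) (auto simp: J0_def)
  qed
  have single: "\<exists>x. M D i = {x}" if i: "i \<in> I" for i
  proof -
    have "card (M D i) \<noteq> 0" using okD[of "{i}"] i by auto
    then obtain x where x: "x \<in> M D i" by (metis card.empty ex_in_conv)
    have "y = x" if y: "y \<in> M D i" for y
    proof (rule ccontr)
      assume "y \<noteq> x"
      obtain J where J: "finite J" "J \<subseteq> I" "i \<notin> J"
          "card ((\<Union>j\<in>J. M D j) \<union> (M D i - {x})) \<le> card J" using tight[OF i x] by blast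
      obtain K where K: "finite K" "K \<subseteq> I" "i \<notin> K"
          "card ((\<Union>j\<in>K. M D j) \<union> (M D i - {y})) \<le> card K" using tight[OF i y] by blast
      let ?A = "(\<Union>j\<in>J. M D j) \<union> (M D i - {x})" and ?B = "(\<Union>j\<in>K. M D j) \<union> (M D i - {y})"
      have finAB: "finite ?A" "finite ?B" using J K finM i by auto
      have "card (insert i (J \<union> K)) \<le> card (\<Union>j\<in>insert i (J \<union> K). M D j)"
        using J K i by (intro okD) auto
      also have "(\<Union>j\<in>insert i (J \<union> K). M D j) = ?A \<union> ?B"
        using \<open>y \<noteq> x\<close> by auto
      finally have "Suc (card (J \<union> K)) \<le> card (?A \<union> ?B)" using J K by simp
      moreover have "card (J \<inter> K) \<le> card (?A \<inter> ?B)"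
      proof -
        have "card (J \<inter> K) \<le> card (\<Union>j\<in>J \<inter> K. M D j)" using J K by (intro okD) auto
        also have "\<dots> \<le> card (?A \<inter> ?B)" using finAB by (intro card_mono) auto
        finally show ?thesis .
      qed
      moreover have "card (?A \<union> ?B) + card (?A \<inter> ?B) = card ?A + card ?B"
        using card_Un_Int[OF finAB] by simp
      moreover have "card (J \<union> K) + card (J \<inter> K) = card J + card K"
        using card_Un_Int[OF J(1) K(1)] by simp
      ultimately show False using J(4) K(4) by linarith
    qed
    then show ?thesis using x by blast
  qed
  then obtain f where f: "\<And>i. i \<in> I \<Longrightarrow> M D i = {f i}" by metis
  show ?thesis
  proof (rule that[of f])
    show "inj_on f I"
    proof (rule inj_onI, rule ccontr)
      fix i j assume ij: "i \<in> I" "j \<in> I" "f i = f j" "i \<noteq> j"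
      then have "card {i, j} \<le> card (\<Union>k\<in>{i, j}. M D k)" by (intro okD) auto
      then show False using ij by (simp add: f)
    qed
    show "f i \<in> N i" if "i \<in> I" for i
      using f[OF that] by (auto simp: M_def)
  qed
qed

section \<open>Groups on a type and their amenable subgroups\<close>

text \<open>Group operations on a whole type: translations then act on the type \<open>l2\<close> by permutations of
the coordinates.\<close>

locale type_group =
  fixes mult :: "'a \<Rightarrow> 'a \<Rightarrow> 'a"  (infixl "\<odot>" 70) and neutral :: 'a ("\<u>") and inver :: "'a \<Rightarrow> 'a" ("\<iota>")
  assumes mult_assoc [simp]: "(x \<odot> y) \<odot> z = x \<odot> (y \<odot> z)"
    and neutral_left [simp]: "\<u> \<odot> x = x"
    and inver_left [simp]: "\<iota> x \<odot> x = \<u>"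
begin

sublocale G: Groups.group mult neutral inver
  by unfold_locales simp_all

lemma neutral_right [simp]: "x \<odot> \<u> = x" by (rule G.right_neutral)
lemma inver_right [simp]: "x \<odot> \<iota> x = \<u>" by (rule G.right_inverse)
lemma inver_left_cancel [simp]: "\<iota> x \<odot> (x \<odot> y) = y" by (simp flip: mult_assoc)
lemma inver_right_cancel [simp]: "x \<odot> (\<iota> x \<odot> y) = y" by (simp flip: mult_assoc)
lemma inver_mult [simp]: "\<iota> (x \<odot> y) = \<iota> y \<odot> \<iota> x" by (rule G.inverse_distrib_swap)
lemma inver_inver [simp]: "\<iota> (\<iota> x) = x" by (rule G.inverse_inverse)

lemma mult_left_cancel [simp]: "x \<odot> y = x \<odot> z \<longleftrightarrow> y = z" by (rule G.left_cancel)
lemma mult_right_cancel [simp]: "y \<odot> x = z \<odot> x \<longleftrightarrow> y = z" by (rule G.right_cancel)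

lemma bij_mult_left: "bij (\<lambda>x. g \<odot> x)"
  by (rule bij_betw_byWitness[where f' = "\<lambda>x. \<iota> g \<odot> x"]) auto

lemma bij_mult_right: "bij (\<lambda>x. x \<odot> g)"
  by (rule bij_betw_byWitness[where f' = "\<lambda>x. x \<odot> \<iota> g"]) auto

abbreviation group_on :: "'a set \<Rightarrow> 'a monoid" where
  "group_on A \<equiv> \<lparr>carrier = A, monoid.mult = mult, one = \<u>\<rparr>"

definition type_subgroup :: "'a set \<Rightarrow> bool" where
  "type_subgroup A \<longleftrightarrow> \<u> \<in> A \<and> (\<forall>x\<in>A. \<forall>y\<in>A. x \<odot> y \<in> A) \<and> (\<forall>x\<in>A. \<iota> x \<in> A)"

end

locale amenable_part = type_group +
  fixes A :: "'a set" and \<mu> :: "('a \<Rightarrow> real) \<Rightarrow> real"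
  assumes subgroup_A: "type_subgroup A" and mean: "left_invariant_mean (group_on A) \<mu>"
begin

lemma neutral_A [simp]: "\<u> \<in> A" and mult_A [simp]: "x \<in> A \<Longrightarrow> y \<in> A \<Longrightarrow> x \<odot> y \<in> A"
  and inver_A [simp]: "x \<in> A \<Longrightarrow> \<iota> x \<in> A"
  using subgroup_A by (auto simp: type_subgroup_def)

lemma mult_A_iff [simp]: "x \<in> A \<Longrightarrow> x \<odot> y \<in> A \<longleftrightarrow> y \<in> A"
  by (metis inver_A inver_left_cancel mult_A)

abbreviation bdd :: "('a \<Rightarrow> real) \<Rightarrow> bool" where "bdd f \<equiv> bounded (f ` A)"

lemma bddI: "(\<And>x. x \<in> A \<Longrightarrow> \<bar>f x\<bar> \<le> C) \<Longrightarrow> bdd f"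
  by (auto simp: bounded_iff)

lemma bdd_const [simp]: "bdd (\<lambda>_. c)" by (rule bddI) auto

lemma bdd_add: "bdd f \<Longrightarrow> bdd g \<Longrightarrow> bdd (\<lambda>x. f x + g x)" by (rule bounded_plus_comp)

lemma bdd_cmult: "bdd f \<Longrightarrow> bdd (\<lambda>x. c * f x)"
  using bounded_scaling[of "f ` A" c] by (simp add: image_image)

lemma bdd_uminus: "bdd f \<Longrightarrow> bdd (\<lambda>x. - f x)" using bdd_cmult[of f "-1"] by simp

lemma bdd_diff: "bdd f \<Longrightarrow> bdd g \<Longrightarrow> bdd (\<lambda>x. f x - g x)" by (rule bounded_minus_comp)

lemma bdd_sum: "(\<And>i. i \<in> I \<Longrightarrow> bdd (f i)) \<Longrightarrow> bdd (\<lambda>x. \<Sum>i\<in>I. f i x)"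
  by (induction I rule: infinite_finite_induct) (auto intro: bdd_add)

lemma bdd_square: "bdd f \<Longrightarrow> bdd (\<lambda>x. (f x)\<^sup>2)"
proof -
  assume "bdd f"
  then obtain C where C: "\<And>x. x \<in> A \<Longrightarrow> \<bar>f x\<bar> \<le> C" by (auto simp: bounded_iff)
  show ?thesis
  proof (rule bddI)
    fix x assume "x \<in> A"
    then show "\<bar>(f x)\<^sup>2\<bar> \<le> C\<^sup>2" using C[of x] power_mono[of "\<bar>f x\<bar>" C 2] by simp
  qed
qed

lemma mean_add: "bdd f \<Longrightarrow> bdd g \<Longrightarrow> \<mu> (\<lambda>x. f x + g x) = \<mu> f + \<mu> g"
  and mean_cmult: "bdd f \<Longrightarrow> \<mu> (\<lambda>x. c * f x) = c * \<mu> f"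
  and mean_nonneg: "bdd f \<Longrightarrow> (\<And>x. x \<in> A \<Longrightarrow> 0 \<le> f x) \<Longrightarrow> 0 \<le> \<mu> f"
  and mean_one: "\<mu> (\<lambda>_. 1) = 1"
  and mean_translate: "s \<in> A \<Longrightarrow> bdd f \<Longrightarrow> \<mu> (\<lambda>x. f (s \<odot> x)) = \<mu> f"
  using mean by (auto simp: left_invariant_mean_def bounded_funs_def)

lemma mean_uminus: "bdd f \<Longrightarrow> \<mu> (\<lambda>x. - f x) = - \<mu> f"
  using mean_cmult[of f "-1"] by simp

lemma mean_diff: "bdd f \<Longrightarrow> bdd g \<Longrightarrow> \<mu> (\<lambda>x. f x - g x) = \<mu> f - \<mu> g"
  using mean_add[of f "\<lambda>x. - g x"] by (simp add: mean_uminus bdd_uminus)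

lemma mean_const: "\<mu> (\<lambda>_. c) = c"
  using mean_cmult[of "\<lambda>_. 1" c] by (simp add: mean_one)

lemma mean_sum: "finite I \<Longrightarrow> (\<And>i. i \<in> I \<Longrightarrow> bdd (f i)) \<Longrightarrow> \<mu> (\<lambda>x. \<Sum>i\<in>I. f i x) = (\<Sum>i\<in>I. \<mu> (f i))"
proof (induction I rule: finite_induct)
  case (insert i I)
  then show ?case by (simp add: mean_add bdd_sum)
qed (simp add: mean_const)

lemma mean_mono:
  assumes "bdd f" "bdd g" "\<And>x. x \<in> A \<Longrightarrow> f x \<le> g x"
  shows "\<mu> f \<le> \<mu> g"
  using mean_nonneg[of "\<lambda>x. g x - f x"] assms by (simp add: mean_diff bdd_diff)

lemma mean_cong:
  assumes "bdd f" "\<And>x. x \<in> A \<Longrightarrow> f x = g x"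
  shows "\<mu> f = \<mu> g"
proof -
  have "bdd g" using assms by (metis image_cong)
  then show ?thesis
    using assms by (intro antisym mean_mono) auto
qed

lemma mean_square_le:
  assumes "bdd f"
  shows "(\<mu> f)\<^sup>2 \<le> \<mu> (\<lambda>x. (f x)\<^sup>2)"
proof -
  define c where "c = \<mu> f"
  have "0 \<le> \<mu> (\<lambda>x. (f x - c)\<^sup>2)"
    by (intro mean_nonneg bdd_square bdd_diff assms) auto
  also have "(\<lambda>x. (f x - c)\<^sup>2) = (\<lambda>x. ((f x)\<^sup>2 - 2 * c * f x) + c\<^sup>2)"
    by (rule ext) (simp add: power2_diff algebra_simps)
  also have "\<mu> \<dots> = \<mu> (\<lambda>x. (f x)\<^sup>2) - 2 * c * c + c\<^sup>2"
    using assms by (simp only: mean_add mean_diff mean_cmult mean_const bdd_square bdd_diff bdd_cmult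
        bdd_const c_def)
  finally show ?thesis by (simp add: c_def power2_eq_square)
qed

section \<open>Foelner sets from invariant means\<close>

definition setmult :: "'a set \<Rightarrow> 'a set \<Rightarrow> 'a set" (infixl "\<circledast>" 70) where
  "X \<circledast> Y = (\<Union>x\<in>X. (\<lambda>y. x \<odot> y) ` Y)"

text \<open>If every finite set grew by a fixed factor under the action of \<open>E\<close>, the powers of \<open>E\<close> would double every
finite set. By Hall's theorem there would then be an injection \<open>f\<close> of two copies of \<open>A\<close> into \<open>A\<close> that moves
points only by elements of a finite set \<open>V\<close>. Cutting the two copies into the finitely many pieces on
which \<open>f\<close> is a fixed translation, an invariant mean would give \<open>2 \<le> 1\<close>.\<close>

theorem folner:
  fixes \<epsilon> :: real
  assumes E: "finite E" "E \<subseteq> A" and \<epsilon>: "0 < \<epsilon>"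
  shows "\<exists>F. finite F \<and> F \<noteq> {} \<and> F \<subseteq> A \<and> real (card {g \<in> F. \<exists>s\<in>E. s \<odot> g \<notin> F}) \<le> \<epsilon> * card F"
proof (rule ccontr)
  assume neg: "\<not> ?thesis"
  have bad: "\<epsilon> * card F < card {g \<in> F. \<exists>s\<in>E. s \<odot> g \<notin> F}" if "finite F" "F \<noteq> {}" "F \<subseteq> A" for F
  proof (rule ccontr)
    assume "\<not> ?thesis"
    then have "real (card {g \<in> F. \<exists>s\<in>E. s \<odot> g \<notin> F}) \<le> \<epsilon> * card F" by simp
    with that neg show False by blast
  qed
  define E1 where "E1 = insert \<u> E"
  have E1: "finite E1" "E1 \<subseteq> A" using E by (auto simp: E1_def)
  define \<delta> where "\<delta> = \<epsilon> / (card E + 1)"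
  have \<delta>: "0 < \<delta>" using \<epsilon> by (simp add: \<delta>_def)
  have fin: "finite (X \<circledast> Y)" if "finite X" "finite Y" for X Y
    using that by (simp add: setmult_def)
  have sub: "X \<circledast> Y \<subseteq> A" if "X \<subseteq> A" "Y \<subseteq> A" for X Y
    using that by (auto simp: setmult_def intro!: mult_A)
  have assoc: "X \<circledast> (Y \<circledast> Z) = X \<circledast> Y \<circledast> Z" for X Y Z
    by (auto simp: setmult_def image_iff)
  have grow: "(1 + \<delta>) * card F \<le> card (E1 \<circledast> F)" if F: "finite F" "F \<subseteq> A" for F
  proof (cases "F = {}")
    case False
    let ?b = "{g \<in> F. \<exists>s\<in>E. s \<odot> g \<notin> F}"
    have "?b \<subseteq> (\<Union>s\<in>E. (\<lambda>h. \<iota> s \<odot> h) ` (E1 \<circledast> F - F))"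
    proof
      fix g assume "g \<in> ?b"
      then obtain s where s: "g \<in> F" "s \<in> E" "s \<odot> g \<notin> F" by blast
      then have "s \<odot> g \<in> E1 \<circledast> F - F" by (auto simp: setmult_def E1_def)
      then have "\<iota> s \<odot> (s \<odot> g) \<in> (\<lambda>h. \<iota> s \<odot> h) ` (E1 \<circledast> F - F)" by (rule imageI)
      then show "g \<in> (\<Union>s\<in>E. (\<lambda>h. \<iota> s \<odot> h) ` (E1 \<circledast> F - F))" using s(2) by auto
    qed
    then have "card ?b \<le> card (\<Union>s\<in>E. (\<lambda>h. \<iota> s \<odot> h) ` (E1 \<circledast> F - F))"
      using E F fin E1 by (intro card_mono) auto
    also have "\<dots> \<le> (\<Sum>s\<in>E. card ((\<lambda>h. \<iota> s \<odot> h) ` (E1 \<circledast> F - F)))"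
      by (rule card_UN_le[OF E(1)])
    also have "\<dots> \<le> (\<Sum>s\<in>E. card (E1 \<circledast> F - F))"
      using fin E1 F by (intro sum_mono card_image_le) auto
    finally have "card ?b \<le> card E * card (E1 \<circledast> F - F)" by simp
    then have "real (card ?b) \<le> card E * card (E1 \<circledast> F - F)"
      unfolding of_nat_mult[symmetric] by (rule of_nat_mono)
    also have "\<dots> \<le> (card E + 1) * card (E1 \<circledast> F - F)" by (simp add: mult_right_mono)
    finally have "\<epsilon> * card F \<le> (card E + 1) * card (E1 \<circledast> F - F)"
      using bad[OF F(1) False F(2)] by linarith
    then have "\<delta> * card F \<le> card (E1 \<circledast> F - F)" by (simp add: \<delta>_def field_simps)
    moreover have "F \<subseteq> E1 \<circledast> F" by (force simp: setmult_def E1_def)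
    then have "card (E1 \<circledast> F) = card F + card (E1 \<circledast> F - F)"
      using F fin[OF E1(1) F(1)] by (simp add: card_Diff_subset card_mono)
    ultimately show ?thesis by (simp add: algebra_simps)
  qed simp
  define W where "W n = ((\<lambda>X. E1 \<circledast> X) ^^ n) {\<u>}" for n
  have W: "finite (W n) \<and> W n \<subseteq> A \<and>
      (\<forall>F. finite F \<longrightarrow> F \<subseteq> A \<longrightarrow> (1 + \<delta>) ^ n * card F \<le> card (W n \<circledast> F))" for n
  proof (induction n)
    case 0
    have "W 0 \<circledast> F = F" for F by (force simp: W_def setmult_def)
    then show ?case by (auto simp: W_def)
  next
    case (Suc n)
    have Ws: "W (Suc n) = E1 \<circledast> W n" by (simp add: W_def)
    have "(1 + \<delta>) ^ Suc n * card F \<le> card (W (Suc n) \<circledast> F)" if F: "finite F" "F \<subseteq> A" for F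
    proof -
      have "(1 + \<delta>) ^ Suc n * card F = (1 + \<delta>) * ((1 + \<delta>) ^ n * card F)" by simp
      also have "\<dots> \<le> (1 + \<delta>) * card (W n \<circledast> F)"
        using Suc F \<delta> by (intro mult_left_mono) auto
      also have "\<dots> \<le> card (E1 \<circledast> (W n \<circledast> F))"
        using Suc F by (intro grow fin sub) auto
      finally show ?thesis by (simp add: Ws assoc)
    qed
    moreover have "finite (W (Suc n))" "W (Suc n) \<subseteq> A"
      using Suc E1 sub[of E1 "W n"] fin[of E1 "W n"] unfolding Ws by blast+
    ultimately show ?case by blast
  qed
  obtain n where n: "2 < (1 + \<delta>) ^ n"
    using real_arch_pow[of "1 + \<delta>" 2] \<delta> by auto
  define V where "V = W n"
  have V: "finite V" "V \<subseteq> A" using W by (auto simp: V_def)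
  have V2: "2 * card F \<le> card (V \<circledast> F)" if "finite F" "F \<subseteq> A" for F
  proof -
    have "2 * real (card F) \<le> (1 + \<delta>) ^ n * card F" using n by (intro mult_right_mono) auto
    then have "2 * real (card F) \<le> card (V \<circledast> F)" using W[of n] that by (fastforce simp: V_def)
    then show ?thesis by linarith
  qed
  obtain f where f: "inj_on f (A \<times> (UNIV :: bool set))" "\<And>i. i \<in> A \<times> UNIV \<Longrightarrow> f i \<in> V \<circledast> {fst i}"
  proof (rule infinite_hall[of "A \<times> (UNIV :: bool set)" "\<lambda>i. V \<circledast> {fst i}"])
    show "finite (V \<circledast> {fst i})" for i :: "'a \<times> bool" using V fin by simp
    fix J :: "('a \<times> bool) set" assume J: "finite J" "J \<subseteq> A \<times> UNIV"
    have "card J \<le> card (fst ` J \<times> (UNIV :: bool set))"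
      using J by (intro card_mono) (force simp: image_iff)+
    also have "\<dots> = 2 * card (fst ` J)" by (simp add: card_cartesian_product)
    also have "\<dots> \<le> card (V \<circledast> (fst ` J))" using J by (intro V2) auto
    also have "V \<circledast> (fst ` J) = (\<Union>i\<in>J. V \<circledast> {fst i})" by (force simp: setmult_def)
    finally show "card J \<le> card (\<Union>i\<in>J. V \<circledast> {fst i})" .
  qed blast
  \<comment> \<open>indicator function of the piece of the copy \<open>j\<close> on which \<open>f\<close> is translation by \<open>s\<close>\<close>
  define X where "X j s x = (if f (x, j) = s \<odot> x then 1 else 0 :: real)" for j s x
  have bX: "bdd (\<lambda>x. X j s (g \<odot> x))" for j s g by (rule bddI[of _ 1]) (auto simp: X_def)
  have bX': "bdd (X j s)" for j s by (rule bddI[of _ 1]) (auto simp: X_def)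
  have one: "1 = (\<Sum>s\<in>V. \<mu> (\<lambda>x. X j s (\<iota> s \<odot> x)))" for j
  proof -
    have "(\<Sum>s\<in>V. X j s x) = 1" if x: "x \<in> A" for x
    proof -
      obtain s where s: "s \<in> V" "f (x, j) = s \<odot> x" using f(2)[of "(x, j)"] x by (auto simp: setmult_def)
      have "X j s' x = (if s' = s then 1 else 0)" for s' by (auto simp: X_def s(2))
      then show ?thesis using V s(1) by simp
    qed
    then have "\<mu> (\<lambda>x. \<Sum>s\<in>V. X j s x) = \<mu> (\<lambda>_. 1)" by (intro mean_cong bdd_sum bX') auto
    then have "1 = (\<Sum>s\<in>V. \<mu> (X j s))" using V by (simp add: mean_one mean_sum bX')
    also have "\<dots> = (\<Sum>s\<in>V. \<mu> (\<lambda>x. X j s (\<iota> s \<odot> x)))"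
      using V by (intro sum.cong refl mean_translate[symmetric] bX') auto
    finally show ?thesis .
  qed
  have "(\<Sum>j\<in>UNIV. \<Sum>s\<in>V. X j s (\<iota> s \<odot> y)) \<le> 1" if y: "y \<in> A" for y
  proof -
    let ?P = "{(j, s). s \<in> V \<and> f (\<iota> s \<odot> y, j) = y}"
    have P: "p = q" if "p \<in> ?P" "q \<in> ?P" for p q
    proof -
      obtain j s k r where pq: "p = (j, s)" "q = (k, r)" by (metis surj_pair)
      have "(\<iota> s \<odot> y, j) = (\<iota> r \<odot> y, k)"
        using that V y by (intro inj_onD[OF f(1)]) (auto simp: pq)
      then show ?thesis by (simp add: pq) (metis inver_inver)
    qed
    have finP: "finite ?P" by (rule finite_subset[of _ "UNIV \<times> V"]) (use V in auto)
    have "(\<Sum>j\<in>UNIV. \<Sum>s\<in>V. X j s (\<iota> s \<odot> y)) = (\<Sum>p\<in>UNIV \<times> V. if p \<in> ?P then 1 else 0)"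
      by (subst sum.cartesian_product) (auto intro!: sum.cong simp: X_def)
    also have "\<dots> = card ((UNIV \<times> V) \<inter> ?P)"
      using V by (simp add: sum.If_cases)
    also have "\<dots> \<le> real 1"
      using P finP by (intro of_nat_mono) (auto simp: card_le_Suc0_iff_eq)
    finally show ?thesis by simp
  qed
  then have "\<mu> (\<lambda>y. \<Sum>j\<in>UNIV. \<Sum>s\<in>V. X j s (\<iota> s \<odot> y)) \<le> \<mu> (\<lambda>_. 1)"
    by (intro mean_mono bdd_sum bX) auto
  then have "(\<Sum>j\<in>(UNIV :: bool set). \<Sum>s\<in>V. \<mu> (\<lambda>x. X j s (\<iota> s \<odot> x))) \<le> 1"
    using V by (simp add: mean_sum mean_one bX bdd_sum)
  then show False by (simp flip: one)
qed

end

section \<open>Square-summable cycles of an amenable group\<close>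

lemma abs_sum_mult_le:
  fixes a b :: "'i \<Rightarrow> real"
  assumes "(\<Sum>i\<in>I. (a i)\<^sup>2) \<le> p\<^sup>2" "(\<Sum>i\<in>I. (b i)\<^sup>2) \<le> q\<^sup>2" "0 \<le> p" "0 \<le> q"
  shows "\<bar>\<Sum>i\<in>I. a i * b i\<bar> \<le> p * q"
proof -
  have "(\<Sum>i\<in>I. a i * b i)\<^sup>2 \<le> (\<Sum>i\<in>I. (a i)\<^sup>2) * (\<Sum>i\<in>I. (b i)\<^sup>2)"
    by (rule Cauchy_Schwarz_ineq_sum)
  also have "\<dots> \<le> p\<^sup>2 * q\<^sup>2"
    using assms by (intro mult_mono sum_nonneg) auto
  finally have "(\<Sum>i\<in>I. a i * b i)\<^sup>2 \<le> (p * q)\<^sup>2" by (simp add: power_mult_distrib)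
  then show ?thesis using assms by (simp add: power2_le_iff_abs_le)
qed

lemma abs_sum_inner_le:
  fixes u v :: "'i \<Rightarrow> 'h :: real_inner"
  assumes "(\<Sum>i\<in>I. (norm (u i))\<^sup>2) \<le> p\<^sup>2" "(\<Sum>i\<in>I. (norm (v i))\<^sup>2) \<le> q\<^sup>2" "0 \<le> p" "0 \<le> q"
  shows "\<bar>\<Sum>i\<in>I. inner (u i) (v i)\<bar> \<le> p * q"
proof -
  have "\<bar>\<Sum>i\<in>I. inner (u i) (v i)\<bar> \<le> (\<Sum>i\<in>I. \<bar>inner (u i) (v i)\<bar>)" by (rule sum_abs)
  also have "\<dots> \<le> (\<Sum>i\<in>I. norm (u i) * norm (v i))" by (intro sum_mono Cauchy_Schwarz_ineq2)
  also have "\<dots> \<le> p * q" using abs_sum_mult_le[OF assms] by linarith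
  finally show ?thesis .
qed

lemma bounded_linear_coord: "bounded_linear (\<lambda>u. coord u x)"
  by (rule bounded_linear_intro[where K = 1]) (auto simp: abs_coord_le)

lemma bounded_linear_basis_combination:
  assumes "\<And>x. x \<in> X \<Longrightarrow> bounded_linear (\<phi> x)"
  shows "bounded_linear (\<lambda>u. \<Sum>x\<in>X. \<phi> x u *\<^sub>R basis x)"
  by (intro bounded_linear_sum bounded_linear_compose[OF bounded_linear_scaleR_left] assms)

lemma has_sum_coord_squares:
  assumes "finite I"
  shows "((\<lambda>x. \<Sum>i\<in>I. (coord (u i) x)\<^sup>2) has_sum (\<Sum>i\<in>I. (norm (u i))\<^sup>2)) UNIV"
  using assms
proof (induction I rule: finite_induct)
  case (insert i I)
  have "((\<lambda>x. (coord (u i) x)\<^sup>2) has_sum (norm (u i))\<^sup>2) UNIV"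
    by (simp add: norm_square_coord coord_square_summable)
  from has_sum_add[OF this insert.IH] show ?case using insert.hyps by simp
qed simp

context type_group
begin

text \<open>The translations are normalised by their effect on basis vectors, \<open>lt_basis\<close> and \<open>rt_basis\<close>.\<close>

definition lt :: "'a \<Rightarrow> 'a l2 \<Rightarrow> 'a l2" where "lt g = permute (\<lambda>x. \<iota> g \<odot> x)"
definition rt :: "'a \<Rightarrow> 'a l2 \<Rightarrow> 'a l2" where "rt h = permute (\<lambda>x. x \<odot> \<iota> h)"

lemma coord_lt [simp]: "coord (lt g u) x = coord u (\<iota> g \<odot> x)"
  unfolding lt_def by (rule coord_permute) (rule bij_is_inj[OF bij_mult_left])

lemma coord_rt [simp]: "coord (rt h u) x = coord u (x \<odot> \<iota> h)"
  unfolding rt_def by (rule coord_permute) (rule bij_is_inj[OF bij_mult_right])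

lemma norm_lt [simp]: "norm (lt g u) = norm u"
  unfolding lt_def by (rule norm_permute) (rule bij_mult_left)

lemma inner_lt [simp]: "inner (lt g u) (lt g v) = inner u v"
  unfolding lt_def by (rule inner_permute) (rule bij_mult_left)

lemma norm_rt [simp]: "norm (rt h u) = norm u"
  unfolding rt_def by (rule norm_permute) (rule bij_mult_right)

lemma inner_rt [simp]: "inner (rt h u) (rt h v) = inner u v"
  unfolding rt_def by (rule inner_permute) (rule bij_mult_right)

lemma rt_basis: "rt h (basis z) = basis (z \<odot> h)"
  by (rule l2_eqI) (auto simp: coord_basis)

lemma lt_basis: "lt g (basis x) = basis (g \<odot> x)"
  by (rule l2_eqI) (auto simp: coord_basis)

lemma linear_rt: "linear (rt h)"
  by (rule linearI; rule l2_eqI) auto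

lemma linear_lt: "linear (lt h)"
  by (rule linearI; rule l2_eqI) auto

lemma sum_right_translate_le:
  assumes "finite F"
  shows "(\<Sum>h\<in>F. (coord u (x \<odot> \<iota> h))\<^sup>2) \<le> (norm u)\<^sup>2"
proof -
  have inj: "inj_on (\<lambda>h. x \<odot> \<iota> h) F" by (rule inj_onI) (metis mult_left_cancel inver_inver)
  have "(\<Sum>h\<in>F. (coord u (x \<odot> \<iota> h))\<^sup>2) = (\<Sum>y\<in>(\<lambda>h. x \<odot> \<iota> h) ` F. (coord u y)\<^sup>2)"
    using inj by (simp add: sum.reindex)
  also have "\<dots> \<le> (norm u)\<^sup>2" using assms by (intro sum_coord_square_le) auto
  finally show ?thesis .
qed

end

text \<open>A finite piece \<open>F\<close> of the group and the matrix \<open>f (g h\<^sup>-\<^sup>1)\<close> on it, where \<open>f\<close> is a potential of a cocycle.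
On the whole group this matrix would commute with right translations, and the trace of such an
operator would be its diagonal entry at the neutral element; here the average over the diagonal takes its
place.\<close>

locale window = amenable_part +
  fixes F :: "'a set" and f :: "'a \<Rightarrow> real" and t :: real
  assumes fin_F: "finite F" and F_A: "F \<subseteq> A" and t_pos: "0 < t"
begin

definition W :: "'a l2 \<Rightarrow> 'a l2" where
  "W v = (\<Sum>g\<in>F. (\<Sum>h\<in>F. f (g \<odot> \<iota> h) * coord v h) *\<^sub>R basis g)"

definition W' :: "'a l2 \<Rightarrow> 'a l2" where
  "W' k = (\<Sum>h\<in>F. (\<Sum>g\<in>F. f (g \<odot> \<iota> h) * coord k g) *\<^sub>R basis h)"

lemma coord_W: "coord (W v) g = (if g \<in> F then \<Sum>h\<in>F. f (g \<odot> \<iota> h) * coord v h else 0)"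
  using fin_F by (simp add: W_def coord_basis if_distrib sum.delta' cong: if_cong)

lemma coord_W': "coord (W' k) h = (if h \<in> F then \<Sum>g\<in>F. f (g \<odot> \<iota> h) * coord k g else 0)"
  using fin_F by (simp add: W'_def coord_basis if_distrib sum.delta' cong: if_cong)

sublocale regularisation W W' t
proof (rule regularisation.intro)
  show "bounded_linear W" unfolding W_def
    by (intro bounded_linear_basis_combination bounded_linear_sum bounded_linear_const_mult
        bounded_linear_coord)
  show "bounded_linear W'" unfolding W'_def
    by (intro bounded_linear_basis_combination bounded_linear_sum bounded_linear_const_mult
        bounded_linear_coord)
  show "inner (W v) k = inner v (W' k)" for v k
  proof -
    have "inner (W v) k = (\<Sum>g\<in>F. \<Sum>h\<in>F. f (g \<odot> \<iota> h) * coord v h * coord k g)"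
      by (simp add: W_def inner_sum_left sum_distrib_right)
    also have "\<dots> = (\<Sum>h\<in>F. \<Sum>g\<in>F. f (g \<odot> \<iota> h) * coord v h * coord k g)" by (rule sum.swap)
    also have "\<dots> = inner v (W' k)"
      by (simp add: W'_def inner_sum_right sum_distrib_left sum_distrib_right mult.commute mult.left_commute)
    finally show ?thesis .
  qed
qed (rule t_pos)

text \<open>The columns of \<open>R\<close>, and below the columns \<open>w g\<close> of \<open>R W\<^sup>*\<close>; by \<open>coord_W_R_basis\<close> the latter are the rows of \<open>W R\<close>.\<close>

definition T :: "'a \<Rightarrow> 'a \<Rightarrow> real" where "T k h = coord (R (basis h)) k"

lemma T_symmetric: "T k h = T h k"
  unfolding T_def using R_symmetric[of "basis h" "basis k"] by simp

definition w :: "'a \<Rightarrow> 'a l2" where "w g = R (W' (basis g))"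

lemma coord_W_R_basis: "coord (W (R (basis h))) g = coord (w g) h"
proof -
  have "coord (W (R (basis h))) g = inner (R (basis h)) (W' (basis g))"
    by (simp flip: adjoint_A)
  then show ?thesis by (simp add: R_symmetric w_def)
qed

lemma norm_w_le: "norm (w g) \<le> 1 / (2 * sqrt t)"
  unfolding w_def using norm_R_adjoint_le[of "basis g"] by simp

lemma norm_W_w_le: "t * norm (W (w g)) \<le> 1"
  unfolding w_def using norm_A_R_adjoint_le[of "basis g"] by simp

text \<open>The cyclicity of the trace: \<open>1 - R = t R W\<^sup>* W\<close> has the same trace as \<open>t W R W\<^sup>*\<close>.\<close>

lemma trace_defect: "(\<Sum>h\<in>F. 1 - T h h) = (\<Sum>g\<in>F. t * coord (W (w g)) g)"
proof -
  have "1 - T h h = (\<Sum>g\<in>F. t * (f (g \<odot> \<iota> h) * coord (w g) h))" if "h \<in> F" for h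
    using arg_cong[OF diff_R[of "basis h"], of "\<lambda>u. coord u h"] that
    by (simp add: T_def coord_basis coord_W' coord_W_R_basis sum_distrib_left)
  then have "(\<Sum>h\<in>F. 1 - T h h) = (\<Sum>h\<in>F. \<Sum>g\<in>F. t * (f (g \<odot> \<iota> h) * coord (w g) h))" by simp
  also have "\<dots> = (\<Sum>g\<in>F. \<Sum>h\<in>F. t * (f (g \<odot> \<iota> h) * coord (w g) h))" by (rule sum.swap)
  also have "\<dots> = (\<Sum>g\<in>F. t * coord (W (w g)) g)"
    by (simp add: coord_W sum_distrib_left)
  finally show ?thesis .
qed

text \<open>The vector \<open>u\<close> is the value at \<open>a\<close> of the formal coboundary of \<open>f\<close>.\<close>

definition cobounds :: "'a \<Rightarrow> 'a l2 \<Rightarrow> bool" where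
  "cobounds a u \<longleftrightarrow> (\<forall>x\<in>A. coord u x = f x - f (\<iota> a \<odot> x))"

text \<open>The vector \<open>t W (w g)\<close> has norm at most \<open>1\<close>, and its values at \<open>g\<close> and at \<open>s\<^sup>-\<^sup>1 g\<close> differ by the inner product of
\<open>t w g\<close> with a row of the cocycle at \<open>s\<close>. So a large value at \<open>g\<close> would be repeated at all the points \<open>s\<^sup>-\<^sup>1 g\<close>.\<close>

lemma trace_term_le:
  assumes g: "g \<in> F" and S: "finite S" "S \<noteq> {}" "\<And>s. s \<in> S \<Longrightarrow> \<iota> s \<odot> g \<in> F"
    and c: "\<And>s. s \<in> S \<Longrightarrow> cobounds s (c s)" "\<And>s. s \<in> S \<Longrightarrow> norm (c s) \<le> \<beta>"
  shows "t * coord (W (w g)) g \<le> 1 / sqrt (card S) + sqrt t / 2 * \<beta>"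
proof -
  have \<beta>0: "0 \<le> \<beta>" using S(2) c(2) norm_ge_zero order_trans by blast
  have near: "\<bar>coord (W (w g)) g - coord (W (w g)) (\<iota> s \<odot> g)\<bar> \<le> \<beta> * (1 / (2 * sqrt t))" if s: "s \<in> S" for s
  proof -
    have "coord (W (w g)) g - coord (W (w g)) (\<iota> s \<odot> g)
        = (\<Sum>h\<in>F. (f (g \<odot> \<iota> h) - f (\<iota> s \<odot> g \<odot> \<iota> h)) * coord (w g) h)"
      using g S(3)[OF s] by (simp add: coord_W sum_subtractf algebra_simps)
    also have "\<dots> = (\<Sum>h\<in>F. coord (c s) (g \<odot> \<iota> h) * coord (w g) h)"
    proof (intro sum.cong refl arg_cong2[where f = times])
      fix h assume "h \<in> F"
      then have "g \<odot> \<iota> h \<in> A" using g F_A by (intro mult_A inver_A) auto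
      then show "f (g \<odot> \<iota> h) - f (\<iota> s \<odot> g \<odot> \<iota> h) = coord (c s) (g \<odot> \<iota> h)"
        using c(1)[OF s] by (simp add: cobounds_def)
    qed
    also have "\<bar>\<dots>\<bar> \<le> \<beta> * (1 / (2 * sqrt t))"
    proof (rule abs_sum_mult_le)
      have "(\<Sum>h\<in>F. (coord (c s) (g \<odot> \<iota> h))\<^sup>2) \<le> (norm (c s))\<^sup>2" by (rule sum_right_translate_le[OF fin_F])
      also have "\<dots> \<le> \<beta>\<^sup>2" using c(2)[OF s] by (intro power_mono) auto
      finally show "(\<Sum>h\<in>F. (coord (c s) (g \<odot> \<iota> h))\<^sup>2) \<le> \<beta>\<^sup>2" .
      have "(\<Sum>h\<in>F. (coord (w g) h)\<^sup>2) \<le> (norm (w g))\<^sup>2" by (rule sum_coord_square_le[OF fin_F])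
      also have "\<dots> \<le> (1 / (2 * sqrt t))\<^sup>2" using norm_w_le by (intro power_mono) auto
      finally show "(\<Sum>h\<in>F. (coord (w g) h)\<^sup>2) \<le> (1 / (2 * sqrt t))\<^sup>2" .
    qed (use \<beta>0 t_pos in auto)
    finally show ?thesis .
  qed
  define y where "y = t * coord (W (w g)) g - sqrt t / 2 * \<beta>"
  have y_le: "y \<le> t * coord (W (w g)) (\<iota> s \<odot> g)" if s: "s \<in> S" for s
  proof -
    have "t * (coord (W (w g)) g - coord (W (w g)) (\<iota> s \<odot> g)) \<le> t * (\<beta> * (1 / (2 * sqrt t)))"
      using near[OF s] t_pos by (intro mult_left_mono) auto
    also have "\<dots> = sqrt t / 2 * \<beta>"
      using t_pos real_div_sqrt[of t] by (simp add: field_simps)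
    finally show ?thesis by (simp add: y_def algebra_simps)
  qed
  have "y \<le> 1 / sqrt (card S)"
  proof (rule le_one_over_sqrt_card[OF S(1,2), where u = "t *\<^sub>R W (w g)"])
    show "inj_on (\<lambda>s. \<iota> s \<odot> g) S"
      by (auto intro!: inj_onI dest: arg_cong[of _ _ "\<iota>"])
    show "norm (t *\<^sub>R W (w g)) \<le> 1" using norm_W_w_le[of g] t_pos by simp
  qed (use y_le in simp)
  then show ?thesis by (simp add: y_def)
qed

lemma trace_defect_le:
  assumes S: "finite S" "S \<noteq> {}"
    and c: "\<And>s. s \<in> S \<Longrightarrow> cobounds s (c s)" "\<And>s. s \<in> S \<Longrightarrow> norm (c s) \<le> \<beta>"
  shows "(\<Sum>h\<in>F. 1 - T h h) \<le> card F * (1 / sqrt (card S) + sqrt t / 2 * \<beta>)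
    + card {g \<in> F. \<exists>s\<in>S. \<iota> s \<odot> g \<notin> F}"
proof -
  let ?b = "{g. \<exists>s\<in>S. \<iota> s \<odot> g \<notin> F}" and ?m = "1 / sqrt (card S) + sqrt t / 2 * \<beta>"
  have "0 \<le> \<beta>" using S(2) c(2) norm_ge_zero order_trans by blast
  then have m0: "0 \<le> ?m" using t_pos by simp
  have "(\<Sum>h\<in>F. 1 - T h h) \<le> (\<Sum>g\<in>F. ?m + (if g \<in> ?b then 1 else 0))"
    unfolding trace_defect
  proof (rule sum_mono)
    fix g assume g: "g \<in> F"
    show "t * coord (W (w g)) g \<le> ?m + (if g \<in> ?b then 1 else 0)"
    proof (cases "g \<in> ?b")
      case True
      have "t * coord (W (w g)) g \<le> t * norm (W (w g))"
        using abs_coord_le[of "W (w g)" g] t_pos by (intro mult_left_mono) auto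
      then show ?thesis using norm_W_w_le[of g] m0 True by simp
    next
      case False
      then have "t * coord (W (w g)) g \<le> ?m"
        using g by (intro trace_term_le[where c = c, OF g S _ c]) auto
      then show ?thesis using False by simp
    qed
  qed
  also have "\<dots> = card F * ?m + card (F \<inter> ?b)"
    using fin_F by (simp add: sum.distrib sum.If_cases)
  also have "F \<inter> ?b = {g \<in> F. \<exists>s\<in>S. \<iota> s \<odot> g \<notin> F}" by auto
  finally show ?thesis .
qed

text \<open>The resolvent remains a contraction after tensoring with another Hilbert space, as one sees coordinate by
coordinate in that space.\<close>

lemma T_contraction:
  "(\<Sum>h\<in>F. (norm (\<Sum>k\<in>F. T k h *\<^sub>R u k))\<^sup>2) \<le> (\<Sum>k\<in>F. (norm (u k :: 'b l2))\<^sup>2)"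
proof (rule has_sum_mono[OF has_sum_coord_squares[OF fin_F] has_sum_coord_squares[OF fin_F]])
  fix x
  define v where "v = (\<Sum>k\<in>F. coord (u k) x *\<^sub>R basis k)"
  have v: "coord v k = (if k \<in> F then coord (u k) x else 0)" for k
    using fin_F by (simp add: v_def coord_basis if_distrib sum.delta' cong: if_cong)
  have Rv: "coord (R v) h = (\<Sum>k\<in>F. T k h * coord (u k) x)" for h
    by (simp add: v_def linear_sum[OF linear_R] linear_scale[OF linear_R] mult.commute T_symmetric[of _ h])
      (simp add: T_def)
  have "(\<Sum>h\<in>F. (coord (\<Sum>k\<in>F. T k h *\<^sub>R u k) x)\<^sup>2) = (\<Sum>h\<in>F. (coord (R v) h)\<^sup>2)" by (simp add: Rv)
  also have "\<dots> \<le> (norm (R v))\<^sup>2" by (rule sum_coord_square_le[OF fin_F])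
  also have "\<dots> \<le> (norm v)\<^sup>2" by (intro power_mono norm_R_le) simp
  also have "\<dots> = inner v v" by (simp add: power2_norm_eq_inner)
  also have "\<dots> = (\<Sum>k\<in>F. coord (u k) x * coord v k)" by (subst (1) v_def) (simp add: inner_sum_left)
  also have "\<dots> = (\<Sum>k\<in>F. (coord (u k) x)\<^sup>2)" by (intro sum.cong) (auto simp: v power2_eq_square)
  finally show "(\<Sum>h\<in>F. (coord (\<Sum>k\<in>F. T k h *\<^sub>R u k) x)\<^sup>2) \<le> (\<Sum>k\<in>F. (coord (u k) x)\<^sup>2)" .
qed

text \<open>If the right translates \<open>rt h u\<close> are the columns of the matrix \<open>u (g h\<^sup>-\<^sup>1)\<close>, then the vectors \<open>D u h\<close> are the
columns of its product with \<open>T\<close>.\<close>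

definition D :: "'a l2 \<Rightarrow> 'a \<Rightarrow> 'a l2" where "D u h = (\<Sum>k\<in>F. T k h *\<^sub>R rt k u)"

lemma sum_norm_D_le: "(\<Sum>h\<in>F. (norm (D u h))\<^sup>2) \<le> (sqrt (card F) * norm u)\<^sup>2"
  unfolding D_def using T_contraction[of "\<lambda>k. rt k u"] by (simp add: power_mult_distrib)

lemma sum_norm_rt: "(\<Sum>h\<in>F. (norm (rt h u))\<^sup>2) \<le> (sqrt (card F) * norm u)\<^sup>2"
  by (simp add: power_mult_distrib)

text \<open>The error made in pairing with the translates of \<open>n\<close> when \<open>rt h u\<close> is replaced by \<open>D u h\<close>. It is small,
relative to the size of the window, when \<open>T\<close> is close to the identity in trace: for basis vectors \<open>u\<close>
this follows from \<open>(1 - R)\<^sup>2 \<le> 1 - R\<close>, and the general case by truncation of \<open>u\<close>.\<close>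

definition \<psi> :: "'a l2 \<Rightarrow> 'a l2 \<Rightarrow> real" where
  "\<psi> n u = (\<Sum>h\<in>F. inner (rt h u - D u h) (rt h n))"

lemma linear_\<psi>: "linear (\<psi> n)"
  by (rule linearI)
    (simp_all add: \<psi>_def D_def linear_add[OF linear_rt] linear_scale[OF linear_rt] inner_diff_left
      inner_add_left inner_sum_left algebra_simps sum.distrib sum_subtractf sum_distrib_left)

lemma \<psi>_bound: "\<bar>\<psi> n u\<bar> \<le> 2 * card F * (norm u * norm n)"
proof -
  have "\<psi> n u = (\<Sum>h\<in>F. inner (rt h u) (rt h n)) - (\<Sum>h\<in>F. inner (D u h) (rt h n))"
    by (simp add: \<psi>_def inner_diff_left sum_subtractf)
  moreover have "\<bar>\<Sum>h\<in>F. inner (rt h u) (rt h n)\<bar> \<le> (sqrt (card F) * norm u) * (sqrt (card F) * norm n)"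
    by (intro abs_sum_inner_le sum_norm_rt) auto
  moreover have "\<bar>\<Sum>h\<in>F. inner (D u h) (rt h n)\<bar> \<le> (sqrt (card F) * norm u) * (sqrt (card F) * norm n)"
    by (intro abs_sum_inner_le sum_norm_rt sum_norm_D_le) auto
  moreover have "(sqrt (card F) * norm u) * (sqrt (card F) * norm n) = card F * (norm u * norm n)"
  proof -
    have "(sqrt (card F) * norm u) * (sqrt (card F) * norm n)
        = (sqrt (card F) * sqrt (card F)) * (norm u * norm n)" by (simp only: mult_ac)
    then show ?thesis by simp
  qed
  ultimately show ?thesis by linarith
qed

lemma \<psi>_basis:
  fixes \<theta> :: real
  assumes \<theta>: "(\<Sum>h\<in>F. 1 - T h h) \<le> card F * \<theta>" "0 \<le> \<theta>"
  shows "\<bar>\<psi> n (basis z)\<bar> \<le> card F * sqrt \<theta> * norm n"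
proof -
  define r where "r h = norm (basis h - R (basis h))" for h
  have 1: "\<bar>inner (rt h (basis z) - D (basis z) h) (rt h n)\<bar> \<le> r h * norm n" if h: "h \<in> F" for h
  proof -
    have "inner (rt h (basis z) - D (basis z) h) (rt h n)
        = coord n z - (\<Sum>k\<in>F. T k h * coord n (z \<odot> k \<odot> \<iota> h))"
      by (simp add: D_def rt_basis inner_diff_left inner_sum_left)
    also have "coord n z = (\<Sum>k\<in>F. coord (basis h) k * coord n (z \<odot> k \<odot> \<iota> h))"
      using fin_F h by (simp add: coord_basis if_distrib if_distribR sum.delta cong: if_cong)
    also have "\<dots> - (\<Sum>k\<in>F. T k h * coord n (z \<odot> k \<odot> \<iota> h))
        = (\<Sum>k\<in>F. coord (basis h - R (basis h)) k * coord n (z \<odot> k \<odot> \<iota> h))"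
      by (simp add: T_def sum_subtractf algebra_simps)
    also have "\<bar>\<dots>\<bar> \<le> r h * norm n"
    proof (rule abs_sum_mult_le)
      show "(\<Sum>k\<in>F. (coord (basis h - R (basis h)) k)\<^sup>2) \<le> (r h)\<^sup>2"
        unfolding r_def by (rule sum_coord_square_le[OF fin_F])
      have "(\<Sum>k\<in>F. (coord n (z \<odot> k \<odot> \<iota> h))\<^sup>2) = (\<Sum>y\<in>(\<lambda>k. z \<odot> k \<odot> \<iota> h) ` F. (coord n y)\<^sup>2)"
        by (subst sum.reindex) (auto intro!: inj_onI)
      also have "\<dots> \<le> (norm n)\<^sup>2" using fin_F by (intro sum_coord_square_le) auto
      finally show "(\<Sum>k\<in>F. (coord n (z \<odot> k \<odot> \<iota> h))\<^sup>2) \<le> (norm n)\<^sup>2" .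
    qed (auto simp: r_def)
    finally show ?thesis .
  qed
  have r2: "(r h)\<^sup>2 \<le> 1 - T h h" for h
    using norm_diff_R_le[of "basis h"] by (simp add: r_def T_def coord_basis)
  have "\<bar>\<Sum>h\<in>F. 1 * r h\<bar> \<le> sqrt (card F) * (sqrt (card F) * sqrt \<theta>)"
  proof (rule abs_sum_mult_le)
    have "(\<Sum>h\<in>F. (r h)\<^sup>2) \<le> (\<Sum>h\<in>F. 1 - T h h)" by (intro sum_mono r2)
    then show "(\<Sum>h\<in>F. (r h)\<^sup>2) \<le> (sqrt (card F) * sqrt \<theta>)\<^sup>2"
      using \<theta> by (simp add: power_mult_distrib)
  qed (use \<theta> in auto)
  then have r1: "(\<Sum>h\<in>F. r h) \<le> card F * sqrt \<theta>" by (simp flip: mult.assoc)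
  have "\<bar>\<psi> n (basis z)\<bar> \<le> (\<Sum>h\<in>F. \<bar>inner (rt h (basis z) - D (basis z) h) (rt h n)\<bar>)"
    unfolding \<psi>_def by (rule sum_abs)
  also have "\<dots> \<le> (\<Sum>h\<in>F. r h) * norm n" unfolding sum_distrib_right by (intro sum_mono 1)
  also have "\<dots> \<le> card F * sqrt \<theta> * norm n" using r1 by (intro mult_right_mono) auto
  finally show ?thesis .
qed

lemma \<psi>_small:
  fixes \<theta> :: real
  assumes \<theta>: "(\<Sum>h\<in>F. 1 - T h h) \<le> card F * \<theta>" "0 \<le> \<theta>" and Z: "finite Z"
  shows "\<bar>\<psi> n u\<bar> \<le> card F * norm n * ((\<Sum>z\<in>Z. \<bar>coord u z\<bar>) * sqrt \<theta> + 2 * norm (u - trunc Z u))"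
proof -
  have "\<psi> n u = \<psi> n (trunc Z u) + \<psi> n (u - trunc Z u)"
    using linear_add[OF linear_\<psi>, of n "trunc Z u" "u - trunc Z u"] by simp
  moreover have "\<bar>\<psi> n (trunc Z u)\<bar> \<le> (\<Sum>z\<in>Z. \<bar>coord u z\<bar> * (card F * sqrt \<theta> * norm n))"
  proof -
    have "\<psi> n (trunc Z u) = (\<Sum>z\<in>Z. coord u z * \<psi> n (basis z))"
      by (simp add: trunc_def linear_sum[OF linear_\<psi>] linear_scale[OF linear_\<psi>])
    also have "\<bar>\<dots>\<bar> \<le> (\<Sum>z\<in>Z. \<bar>coord u z * \<psi> n (basis z)\<bar>)" by (rule sum_abs)
    also have "\<dots> \<le> (\<Sum>z\<in>Z. \<bar>coord u z\<bar> * (card F * sqrt \<theta> * norm n))"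
      unfolding abs_mult using \<psi>_basis[OF \<theta>] by (intro sum_mono mult_left_mono) auto
    finally show ?thesis .
  qed
  moreover have "\<bar>\<psi> n (u - trunc Z u)\<bar> \<le> 2 * card F * (norm (u - trunc Z u) * norm n)"
    by (rule \<psi>_bound)
  ultimately have "\<bar>\<psi> n u\<bar> \<le> (\<Sum>z\<in>Z. \<bar>coord u z\<bar> * (card F * sqrt \<theta> * norm n))
      + 2 * card F * (norm (u - trunc Z u) * norm n)" by linarith
  then show ?thesis unfolding sum_distrib_right[symmetric] by (simp add: algebra_simps)
qed

text \<open>Away from the boundary of the window the product with \<open>T\<close> is again a coboundary, now of \<open>W \<circ> R\<close>, whose
rows \<open>w g\<close> are bounded in terms of \<open>t\<close>.\<close>

lemma coord_D_interior:
  assumes "cobounds a u" "h \<in> F" "g \<in> F" "\<iota> a \<odot> g \<in> F"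
  shows "coord (D u h) g = coord (w g) h - coord (w (\<iota> a \<odot> g)) h"
proof -
  have "coord (D u h) g = (\<Sum>k\<in>F. T k h * coord u (g \<odot> \<iota> k))" by (simp add: D_def)
  also have "\<dots> = (\<Sum>k\<in>F. T k h * (f (g \<odot> \<iota> k) - f (\<iota> a \<odot> g \<odot> \<iota> k)))"
  proof (intro sum.cong refl arg_cong2[where f = times])
    fix k assume "k \<in> F"
    then have "g \<odot> \<iota> k \<in> A" using assms(3) F_A by (intro mult_A inver_A) auto
    then show "coord u (g \<odot> \<iota> k) = f (g \<odot> \<iota> k) - f (\<iota> a \<odot> g \<odot> \<iota> k)"
      using assms(1) by (simp add: cobounds_def)
  qed
  also have "\<dots> = coord (W (R (basis h))) g - coord (W (R (basis h))) (\<iota> a \<odot> g)"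
    using assms(3,4) by (simp add: coord_W T_def sum_subtractf algebra_simps)
  finally show ?thesis by (simp add: coord_W_R_basis)
qed

lemma boundary_sum_le:
  assumes "finite X"
  shows "\<bar>\<Sum>h\<in>F. \<Sum>g\<in>X. coord (w g) h * coord n (x g \<odot> \<iota> h)\<bar> \<le> card X * (1 / (2 * sqrt t) * norm n)"
proof -
  have "\<bar>\<Sum>h\<in>F. coord (w g) h * coord n (x g \<odot> \<iota> h)\<bar> \<le> 1 / (2 * sqrt t) * norm n" for g
  proof (rule abs_sum_mult_le)
    have "(\<Sum>h\<in>F. (coord (w g) h)\<^sup>2) \<le> (norm (w g))\<^sup>2" by (rule sum_coord_square_le[OF fin_F])
    also have "\<dots> \<le> (1 / (2 * sqrt t))\<^sup>2" using norm_w_le by (intro power_mono) auto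
    finally show "(\<Sum>h\<in>F. (coord (w g) h)\<^sup>2) \<le> (1 / (2 * sqrt t))\<^sup>2" .
  qed (use t_pos in \<open>auto intro: sum_right_translate_le[OF fin_F]\<close>)
  note 1 = this
  have "\<bar>\<Sum>h\<in>F. \<Sum>g\<in>X. coord (w g) h * coord n (x g \<odot> \<iota> h)\<bar>
      = \<bar>\<Sum>g\<in>X. \<Sum>h\<in>F. coord (w g) h * coord n (x g \<odot> \<iota> h)\<bar>" by (subst sum.swap) (rule refl)
  also have "\<dots> \<le> (\<Sum>g\<in>X. \<bar>\<Sum>h\<in>F. coord (w g) h * coord n (x g \<odot> \<iota> h)\<bar>)" by (rule sum_abs)
  also have "\<dots> \<le> (\<Sum>g\<in>X. 1 / (2 * sqrt t) * norm n)" by (intro sum_mono 1)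
  finally show ?thesis by simp
qed

text \<open>For most \<open>h\<close> the translate by \<open>h\<close> of the finite set \<open>Y\<close>, which carries almost all of \<open>n\<close>, lies inside \<open>X\<close>; the
exceptional \<open>h\<close> form the set \<open>b\<close>.\<close>

lemma sum_tails_le:
  assumes Y: "finite Y" and b: "finite b"
    and inside: "\<And>h y. h \<in> F - b \<Longrightarrow> y \<in> Y \<Longrightarrow> y \<odot> h \<in> X" and X: "finite X"
  shows "(\<Sum>h\<in>F. (norm (rt h n - trunc X (rt h n)))\<^sup>2) \<le> card F * (norm (n - trunc Y n))\<^sup>2 + card b * (norm n)\<^sup>2"
proof -
  have "(norm (rt h n - trunc X (rt h n)))\<^sup>2 \<le> (norm (n - trunc Y n))\<^sup>2 + (if h \<in> b then (norm n)\<^sup>2 else 0)"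
    if h: "h \<in> F" for h
  proof (cases "h \<in> b")
    case True
    have "(norm (rt h n - trunc X (rt h n)))\<^sup>2 \<le> (norm n)\<^sup>2"
      unfolding norm_minus_trunc[OF X] by (simp add: sum_nonneg)
    then show ?thesis using True zero_le_power2[of "norm (n - trunc Y n)"] by (simp only: if_True)
  next
    case False
    have "(\<Sum>y\<in>Y. (coord n y)\<^sup>2) = (\<Sum>y\<in>(\<lambda>y. y \<odot> h) ` Y. (coord n (y \<odot> \<iota> h))\<^sup>2)"
      by (subst sum.reindex) (auto intro!: inj_onI)
    also have "\<dots> \<le> (\<Sum>y\<in>X. (coord n (y \<odot> \<iota> h))\<^sup>2)"
      using X inside[of h] h False by (intro sum_mono2) auto
    finally show ?thesis
      using False unfolding norm_minus_trunc[OF X] norm_minus_trunc[OF Y] by simp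
  qed
  then have "(\<Sum>h\<in>F. (norm (rt h n - trunc X (rt h n)))\<^sup>2)
      \<le> (\<Sum>h\<in>F. (norm (n - trunc Y n))\<^sup>2 + (if h \<in> b then (norm n)\<^sup>2 else 0))" by (rule sum_mono)
  also have "\<dots> = card F * (norm (n - trunc Y n))\<^sup>2 + card (F \<inter> b) * (norm n)\<^sup>2"
    using fin_F by (simp add: sum.distrib sum.If_cases)
  also have "\<dots> \<le> card F * (norm (n - trunc Y n))\<^sup>2 + card b * (norm n)\<^sup>2"
    using b by (intro add_left_mono mult_right_mono of_nat_mono card_mono) auto
  finally show ?thesis .
qed

text \<open>Summation by parts on the window. The sum over the interior is a pairing of the rows \<open>w g\<close> with the
boundary of the cycle \<open>\<eta>\<close>, hence zero; what remains are the tails of \<open>\<eta>\<close> and terms on the boundary \<open>b\<close> of the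
window.\<close>

lemma pairing_le:
  assumes E: "finite E" and cob: "\<And>a. a \<in> E \<Longrightarrow> cobounds a (c a)"
    and cycle: "\<And>x. x \<in> A \<Longrightarrow> (\<Sum>a\<in>E. coord (\<eta> a) x - coord (\<eta> a) (a \<odot> x)) = 0"
    and Y: "\<And>a. a \<in> E \<Longrightarrow> finite (Y a)"
    and b: "b = {g \<in> F. \<exists>s\<in>E0. s \<odot> g \<notin> F}"
    and E0: "\<And>a. a \<in> E \<Longrightarrow> a \<in> E0 \<and> \<iota> a \<in> E0" "\<And>a y. a \<in> E \<Longrightarrow> y \<in> Y a \<Longrightarrow> y \<in> E0 \<and> \<iota> a \<odot> y \<in> E0"
  shows "\<bar>\<Sum>a\<in>E. \<Sum>h\<in>F. inner (D (c a) h) (rt h (\<eta> a))\<bar> \<le> (\<Sum>a\<in>E.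
    sqrt (card F) * norm (c a) * sqrt (card F * (norm (\<eta> a - trunc (Y a) (\<eta> a)))\<^sup>2 + card b * (norm (\<eta> a))\<^sup>2)
    + card b * (1 / sqrt t * norm (\<eta> a)))"
proof -
  define X where "X a = {g \<in> F. \<iota> a \<odot> g \<in> F}" for a
  have finX: "finite (X a)" and XF: "X a \<subseteq> F" for a using fin_F by (auto simp: X_def)
  have finb: "finite b" using fin_F by (simp add: b)
  define L where "L h g = coord (w g) h" for h g
  define N where "N a h = rt h (\<eta> a)" for a h
  have split: "inner (D (c a) h) (N a h) = inner (D (c a) h) (N a h - trunc (X a) (N a h))
      + (\<Sum>g\<in>F. L h g * (coord (\<eta> a) (g \<odot> \<iota> h) - coord (\<eta> a) (a \<odot> g \<odot> \<iota> h)))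
      - (\<Sum>g\<in>F - X a. L h g * coord (\<eta> a) (g \<odot> \<iota> h))
      + (\<Sum>g\<in>{g \<in> F. a \<odot> g \<notin> F}. L h g * coord (\<eta> a) (a \<odot> g \<odot> \<iota> h))"
    if a: "a \<in> E" and h: "h \<in> F" for a h
  proof -
    have "inner (D (c a) h) (trunc (X a) (N a h)) = (\<Sum>g\<in>X a. coord (\<eta> a) (g \<odot> \<iota> h) * coord (D (c a) h) g)"
      by (simp add: trunc_def inner_sum_right N_def)
    also have "\<dots> = (\<Sum>g\<in>X a. L h g * coord (\<eta> a) (g \<odot> \<iota> h)) - (\<Sum>g\<in>X a. L h (\<iota> a \<odot> g) * coord (\<eta> a) (g \<odot> \<iota> h))"
      unfolding sum_subtractf[symmetric]
      by (intro sum.cong refl)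
        (use h in \<open>auto simp: X_def L_def coord_D_interior[OF cob[OF a]] algebra_simps\<close>)
    also have "(\<Sum>g\<in>X a. L h (\<iota> a \<odot> g) * coord (\<eta> a) (g \<odot> \<iota> h))
        = (\<Sum>g\<in>{g \<in> F. a \<odot> g \<in> F}. L h g * coord (\<eta> a) (a \<odot> g \<odot> \<iota> h))"
      by (rule sum.reindex_bij_witness[where i = "\<lambda>g. a \<odot> g" and j = "\<lambda>g. \<iota> a \<odot> g"]) (auto simp: X_def)
    finally have 1: "inner (D (c a) h) (trunc (X a) (N a h)) = (\<Sum>g\<in>X a. L h g * coord (\<eta> a) (g \<odot> \<iota> h))
        - (\<Sum>g\<in>{g \<in> F. a \<odot> g \<in> F}. L h g * coord (\<eta> a) (a \<odot> g \<odot> \<iota> h))" .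
    have 2: "(\<Sum>g\<in>F. L h g * coord (\<eta> a) (g \<odot> \<iota> h)) = (\<Sum>g\<in>X a. L h g * coord (\<eta> a) (g \<odot> \<iota> h))
        + (\<Sum>g\<in>F - X a. L h g * coord (\<eta> a) (g \<odot> \<iota> h))"
      using sum.subset_diff[OF XF[of a] fin_F, of "\<lambda>g. L h g * coord (\<eta> a) (g \<odot> \<iota> h)"] by simp
    have "{g \<in> F. a \<odot> g \<notin> F} = F - {g \<in> F. a \<odot> g \<in> F}" by auto
    then have 3: "(\<Sum>g\<in>F. L h g * coord (\<eta> a) (a \<odot> g \<odot> \<iota> h))
        = (\<Sum>g\<in>{g \<in> F. a \<odot> g \<in> F}. L h g * coord (\<eta> a) (a \<odot> g \<odot> \<iota> h))
        + (\<Sum>g\<in>{g \<in> F. a \<odot> g \<notin> F}. L h g * coord (\<eta> a) (a \<odot> g \<odot> \<iota> h))"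
      using sum.subset_diff[of "{g \<in> F. a \<odot> g \<in> F}" F "\<lambda>g. L h g * coord (\<eta> a) (a \<odot> g \<odot> \<iota> h)"] fin_F
      by (simp add: add.commute)
    have "inner (D (c a) h) (N a h) = inner (D (c a) h) (N a h - trunc (X a) (N a h))
        + inner (D (c a) h) (trunc (X a) (N a h))" by (simp add: inner_diff_right)
    then show ?thesis
      unfolding 1 right_diff_distrib sum_subtractf 2 3 by simp
  qed
  have zero: "(\<Sum>a\<in>E. \<Sum>h\<in>F. \<Sum>g\<in>F. L h g * (coord (\<eta> a) (g \<odot> \<iota> h) - coord (\<eta> a) (a \<odot> g \<odot> \<iota> h))) = 0"
  proof -
    have "(\<Sum>a\<in>E. \<Sum>h\<in>F. \<Sum>g\<in>F. L h g * (coord (\<eta> a) (g \<odot> \<iota> h) - coord (\<eta> a) (a \<odot> g \<odot> \<iota> h)))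
        = (\<Sum>h\<in>F. \<Sum>a\<in>E. \<Sum>g\<in>F. L h g * (coord (\<eta> a) (g \<odot> \<iota> h) - coord (\<eta> a) (a \<odot> g \<odot> \<iota> h)))"
      by (rule sum.swap)
    also have "\<dots> = (\<Sum>h\<in>F. \<Sum>g\<in>F. \<Sum>a\<in>E. L h g * (coord (\<eta> a) (g \<odot> \<iota> h) - coord (\<eta> a) (a \<odot> g \<odot> \<iota> h)))"
      by (intro sum.cong refl sum.swap)
    also have "\<dots> = (\<Sum>h\<in>F. \<Sum>g\<in>F. L h g * 0)"
    proof (intro sum.cong refl)
      fix h g assume "h \<in> F" "g \<in> F"
      then have "g \<odot> \<iota> h \<in> A" using F_A by (intro mult_A inver_A) auto
      from cycle[OF this]
      show "(\<Sum>a\<in>E. L h g * (coord (\<eta> a) (g \<odot> \<iota> h) - coord (\<eta> a) (a \<odot> g \<odot> \<iota> h))) = L h g * 0"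
        unfolding sum_distrib_left[symmetric] by simp
    qed
    finally show ?thesis by simp
  qed
  have tail: "\<bar>\<Sum>h\<in>F. inner (D (c a) h) (N a h - trunc (X a) (N a h))\<bar>
      \<le> sqrt (card F) * norm (c a) * sqrt (card F * (norm (\<eta> a - trunc (Y a) (\<eta> a)))\<^sup>2 + card b * (norm (\<eta> a))\<^sup>2)"
    if a: "a \<in> E" for a
  proof (rule abs_sum_inner_le[OF sum_norm_D_le])
    have "y \<odot> h \<in> X a" if "h \<in> F - b" "y \<in> Y a" for h y
    proof -
      have "y \<odot> h \<in> F" "(\<iota> a \<odot> y) \<odot> h \<in> F" using that E0(2)[OF a that(2)] unfolding b by blast+
      then show ?thesis by (simp add: X_def)
    qed
    then have "(\<Sum>h\<in>F. (norm (N a h - trunc (X a) (N a h)))\<^sup>2)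
        \<le> card F * (norm (\<eta> a - trunc (Y a) (\<eta> a)))\<^sup>2 + card b * (norm (\<eta> a))\<^sup>2"
      unfolding N_def by (rule sum_tails_le[OF Y[OF a] finb _ finX])
    then show "(\<Sum>h\<in>F. (norm (N a h - trunc (X a) (N a h)))\<^sup>2)
        \<le> (sqrt (card F * (norm (\<eta> a - trunc (Y a) (\<eta> a)))\<^sup>2 + card b * (norm (\<eta> a))\<^sup>2))\<^sup>2"
      by (simp add: add_nonneg_nonneg)
  qed auto
  have bd1: "\<bar>\<Sum>h\<in>F. \<Sum>g\<in>F - X a. L h g * coord (\<eta> a) (g \<odot> \<iota> h)\<bar> \<le> card b * (1 / (2 * sqrt t) * norm (\<eta> a))"
    if a: "a \<in> E" for a
  proof -
    have "F - X a \<subseteq> b" using E0(1)[OF a] by (auto simp: X_def b)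
    then have "card (F - X a) * (1 / (2 * sqrt t) * norm (\<eta> a)) \<le> card b * (1 / (2 * sqrt t) * norm (\<eta> a))"
      using finb t_pos by (intro mult_right_mono of_nat_mono card_mono) auto
    with boundary_sum_le[of "F - X a" "\<eta> a" "\<lambda>g. g"] show ?thesis
      unfolding L_def using fin_F by (intro order_trans[OF boundary_sum_le]) auto
  qed
  have bd2: "\<bar>\<Sum>h\<in>F. \<Sum>g\<in>{g \<in> F. a \<odot> g \<notin> F}. L h g * coord (\<eta> a) (a \<odot> g \<odot> \<iota> h)\<bar>
      \<le> card b * (1 / (2 * sqrt t) * norm (\<eta> a))" if a: "a \<in> E" for a
  proof -
    have "{g \<in> F. a \<odot> g \<notin> F} \<subseteq> b" using E0(1)[OF a] by (auto simp: b)
    then have "card {g \<in> F. a \<odot> g \<notin> F} * (1 / (2 * sqrt t) * norm (\<eta> a)) \<le> card b * (1 / (2 * sqrt t) * norm (\<eta> a))"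
      using finb t_pos by (intro mult_right_mono of_nat_mono card_mono) auto
    then show ?thesis
      unfolding L_def using fin_F by (intro order_trans[OF boundary_sum_le]) auto
  qed
  define s1 where "s1 a = (\<Sum>h\<in>F. inner (D (c a) h) (N a h - trunc (X a) (N a h)))" for a
  define s2 where "s2 a = (\<Sum>h\<in>F. \<Sum>g\<in>F - X a. L h g * coord (\<eta> a) (g \<odot> \<iota> h))" for a
  define s3 where "s3 a = (\<Sum>h\<in>F. \<Sum>g\<in>{g \<in> F. a \<odot> g \<notin> F}. L h g * coord (\<eta> a) (a \<odot> g \<odot> \<iota> h))" for a
  define s0 where "s0 a = (\<Sum>h\<in>F. \<Sum>g\<in>F. L h g * (coord (\<eta> a) (g \<odot> \<iota> h) - coord (\<eta> a) (a \<odot> g \<odot> \<iota> h)))" for a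
  have "(\<Sum>a\<in>E. \<Sum>h\<in>F. inner (D (c a) h) (rt h (\<eta> a))) = (\<Sum>a\<in>E. s1 a + s0 a - s2 a + s3 a)"
  proof (rule sum.cong[OF refl])
    fix a assume "a \<in> E"
    have "(\<Sum>h\<in>F. inner (D (c a) h) (rt h (\<eta> a))) = (\<Sum>h\<in>F. inner (D (c a) h) (N a h))" by (simp add: N_def)
    also have "\<dots> = s1 a + s0 a - s2 a + s3 a"
      unfolding s1_def s0_def s2_def s3_def sum.distrib[symmetric] sum_subtractf[symmetric]
      by (rule sum.cong[OF refl split[OF \<open>a \<in> E\<close>]])
    finally show "(\<Sum>h\<in>F. inner (D (c a) h) (rt h (\<eta> a))) = s1 a + s0 a - s2 a + s3 a" .
  qed
  also have "\<dots> = (\<Sum>a\<in>E. s1 a - s2 a + s3 a)"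
    using zero unfolding s0_def[symmetric] by (simp add: sum.distrib sum_subtractf)
  also have "\<bar>\<dots>\<bar> \<le> (\<Sum>a\<in>E. \<bar>s1 a - s2 a + s3 a\<bar>)" by (rule sum_abs)
  also have "\<dots> \<le> (\<Sum>a\<in>E.
    sqrt (card F) * norm (c a) * sqrt (card F * (norm (\<eta> a - trunc (Y a) (\<eta> a)))\<^sup>2 + card b * (norm (\<eta> a))\<^sup>2)
    + card b * (1 / sqrt t * norm (\<eta> a)))"
  proof (rule sum_mono)
    fix a assume a: "a \<in> E"
    have "card b * (1 / (2 * sqrt t) * norm (\<eta> a)) + card b * (1 / (2 * sqrt t) * norm (\<eta> a))
        = card b * (1 / sqrt t * norm (\<eta> a))"
      using t_pos by (simp add: field_simps)
    moreover have "\<bar>x - y + z\<bar> \<le> p + q" if "r + r = q" "\<bar>x\<bar> \<le> p" "\<bar>y\<bar> \<le> r" "\<bar>z\<bar> \<le> r"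
      for x y z p q r :: real using that by linarith
    ultimately show "\<bar>s1 a - s2 a + s3 a\<bar> \<le> sqrt (card F) * norm (c a) *
        sqrt (card F * (norm (\<eta> a - trunc (Y a) (\<eta> a)))\<^sup>2 + card b * (norm (\<eta> a))\<^sup>2)
        + card b * (1 / sqrt t * norm (\<eta> a))"
      using tail[OF a] bd1[OF a] bd2[OF a] unfolding s1_def[symmetric] s2_def[symmetric] s3_def[symmetric]
      by blast
  qed
  finally show ?thesis .
qed

end

context amenable_part
begin

text \<open>Formally this is summation by parts against the potential \<open>f\<close>, but neither is \<open>f\<close> square-summable nor are the
boundary terms of a Foelner set small for unbounded \<open>f\<close>. After multiplication by the resolvent the
potential becomes an operator of norm at most \<open>1 / (2\<surd>t)\<close>, which makes the boundary terms negligible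
for good Foelner sets. The order of the choices is: first truncations of \<open>c\<close> and \<open>\<eta>\<close>, then \<open>S\<close> and \<open>t\<close>
such that the resolvent is close to the identity in trace, and the Foelner set last.\<close>

theorem coboundary_orthogonal_cycle:
  assumes inf: "infinite A"
    and E: "finite E" "E \<subseteq> A"
    and c: "\<And>a x. a \<in> A \<Longrightarrow> x \<in> A \<Longrightarrow> coord (c a) x = f x - f (\<iota> a \<odot> x)"
    and \<eta>: "\<And>a x. a \<in> E \<Longrightarrow> x \<notin> A \<Longrightarrow> coord (\<eta> a) x = 0"
    and cycle: "\<And>x. x \<in> A \<Longrightarrow> (\<Sum>a\<in>E. coord (\<eta> a) x - coord (\<eta> a) (a \<odot> x)) = 0"
  shows "(\<Sum>a\<in>E. inner (c a) (\<eta> a)) = 0"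
proof -
  define q where "q = (\<Sum>a\<in>E. inner (c a) (\<eta> a))"
  define K\<eta> where "K\<eta> = (\<Sum>a\<in>E. norm (\<eta> a))"
  define Kc where "Kc = (\<Sum>a\<in>E. norm (c a) * (1 + norm (\<eta> a)))"
  have small: "\<bar>q\<bar> \<le> \<delta> * (4 * K\<eta> + Kc)" if \<delta>: "0 < \<delta>" for \<delta>
  proof -
    have "\<exists>Z. finite Z \<and> norm (c a - trunc Z (c a)) < \<delta>" for a
      using trunc_approx[OF \<delta>] by blast
    then obtain Z where Z: "\<And>a. finite (Z a)" "\<And>a. norm (c a - trunc (Z a) (c a)) < \<delta>" by metis
    have "\<exists>Z. finite Z \<and> norm (\<eta> a - trunc Z (\<eta> a)) < \<delta>" for a
      using trunc_approx[OF \<delta>] by blast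
    then obtain Y0 where Y0: "\<And>a. finite (Y0 a)" "\<And>a. norm (\<eta> a - trunc (Y0 a) (\<eta> a)) < \<delta>" by metis
    define Y where "Y a = Y0 a \<inter> A" for a
    have Yf: "finite (Y a)" "Y a \<subseteq> A" for a using Y0 by (auto simp: Y_def)
    have Y: "norm (\<eta> a - trunc (Y a) (\<eta> a)) < \<delta>" if "a \<in> E" for a
    proof -
      have "trunc (Y a) (\<eta> a) = trunc (Y0 a) (\<eta> a)"
        by (rule l2_eqI) (use \<eta>[OF that] Y0 Yf in \<open>auto simp: coord_trunc Y_def\<close>)
      then show ?thesis using Y0 by simp
    qed
    define m where "m = (\<Sum>a\<in>E. \<Sum>z\<in>Z a. \<bar>coord (c a) z\<bar>)"
    have m0: "0 \<le> m" unfolding m_def by (intro sum_nonneg) auto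
    have m_ge: "(\<Sum>z\<in>Z a. \<bar>coord (c a) z\<bar>) \<le> m" if "a \<in> E" for a
      unfolding m_def using E(1) that by (intro member_le_sum) (auto intro: sum_nonneg)
    define \<theta> where "\<theta> = (\<delta> / (m + 1))\<^sup>2"
    have \<theta>: "0 < \<theta>" using m0 \<delta> by (simp add: \<theta>_def)
    have "m * sqrt \<theta> = \<delta> * (m / (m + 1))" using m0 \<delta> by (simp add: \<theta>_def)
    also have "\<dots> \<le> \<delta> * 1" using m0 \<delta> by (intro mult_left_mono) auto
    finally have m\<theta>: "m * sqrt \<theta> \<le> \<delta>" by simp
    obtain N :: nat where N: "(3 / \<theta>)\<^sup>2 < N" using reals_Archimedean2 by blast
    obtain S where S: "finite S" "card S = Suc N" "S \<subseteq> A"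
      using infinite_arbitrarily_large[OF inf] by blast
    have S_small: "1 / sqrt (card S) \<le> \<theta> / 3"
    proof -
      have "3 / \<theta> \<le> sqrt (card S)" using N by (intro real_le_rsqrt) (simp add: S(2))
      moreover have "0 < sqrt (card S)" by (simp add: S(2))
      ultimately show ?thesis using \<theta> by (simp add: field_simps)
    qed
    define \<beta> where "\<beta> = (\<Sum>s\<in>S. norm (c s))"
    have \<beta>: "norm (c s) \<le> \<beta>" if "s \<in> S" for s
      unfolding \<beta>_def using S(1) that by (intro member_le_sum) auto
    have \<beta>0: "0 \<le> \<beta>" unfolding \<beta>_def by (intro sum_nonneg) auto
    define t where "t = (2 * \<theta> / (3 * (\<beta> + 1)))\<^sup>2"
    have t: "0 < t" using \<theta> \<beta>0 by (simp add: t_def)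
    have "sqrt t = 2 * \<theta> / (3 * (\<beta> + 1))" using \<theta> \<beta>0 by (simp add: t_def)
    moreover have "2 * x / (3 * y) / 2 * z = x / 3 * (z / y)" for x y z :: real by simp
    ultimately have "sqrt t / 2 * \<beta> = \<theta> / 3 * (\<beta> / (\<beta> + 1))" by (simp only:)
    also have "\<dots> \<le> \<theta> / 3 * 1" using \<theta> \<beta>0 by (intro mult_left_mono) auto
    finally have t_small: "sqrt t / 2 * \<beta> \<le> \<theta> / 3" by simp
    define E0 where "E0 = \<iota> ` S \<union> E \<union> \<iota> ` E \<union> (\<Union>a\<in>E. Y a \<union> (\<lambda>y. \<iota> a \<odot> y) ` Y a)"
    have E0: "finite E0" "E0 \<subseteq> A"
      using S E Yf by (auto simp: E0_def subset_iff)
    define \<rho> where "\<rho> = min (\<theta> / 3) (min (\<delta> * sqrt t) (\<delta>\<^sup>2))"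
    have \<rho>: "0 < \<rho>" "\<rho> \<le> \<theta> / 3" "\<rho> \<le> \<delta> * sqrt t" "\<rho> \<le> \<delta>\<^sup>2"
      using \<theta> \<delta> t by (auto simp: \<rho>_def)
    obtain F where F: "finite F" "F \<noteq> {}" "F \<subseteq> A"
      "real (card {g \<in> F. \<exists>s\<in>E0. s \<odot> g \<notin> F}) \<le> \<rho> * card F"
      using folner[OF E0 \<rho>(1)] by blast
    interpret window mult neutral inver A \<mu> F f t
      by unfold_locales (use F t in auto)
    define b where "b = {g \<in> F. \<exists>s\<in>E0. s \<odot> g \<notin> F}"
    have b: "real (card b) \<le> \<rho> * card F" using F(4) by (simp add: b_def)
    have cob: "cobounds a (c a)" if "a \<in> A" for a
      using c[OF that] by (simp add: cobounds_def)
    have cF: "0 < real (card F)" using F by (simp add: card_gt_0_iff)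
    have tr: "(\<Sum>h\<in>F. 1 - T h h) \<le> card F * \<theta>"
    proof -
      have "{g \<in> F. \<exists>s\<in>S. \<iota> s \<odot> g \<notin> F} \<subseteq> b" by (auto simp: b_def E0_def)
      then have "real (card {g \<in> F. \<exists>s\<in>S. \<iota> s \<odot> g \<notin> F}) \<le> card b"
        using F(1) by (intro of_nat_mono card_mono) (auto simp: b_def)
      also have "\<dots> \<le> card F * (\<theta> / 3)"
        using b mult_right_mono[OF \<rho>(2), of "real (card F)"] by (simp add: mult.commute)
      finally have 1: "real (card {g \<in> F. \<exists>s\<in>S. \<iota> s \<odot> g \<notin> F}) \<le> card F * (\<theta> / 3)" .
      have "S \<noteq> {}" using S(2) by auto
      then have "(\<Sum>h\<in>F. 1 - T h h) \<le> card F * (1 / sqrt (card S) + sqrt t / 2 * \<beta>)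
          + card {g \<in> F. \<exists>s\<in>S. \<iota> s \<odot> g \<notin> F}"
        by (rule trace_defect_le[where c = c, OF S(1)]) (use S cob \<beta> in auto)
      also have "\<dots> \<le> card F * (\<theta> / 3 + \<theta> / 3) + card F * (\<theta> / 3)"
        using S_small t_small 1 by (intro add_mono mult_left_mono) auto
      also have "\<dots> = card F * \<theta>" by (simp add: algebra_simps)
      finally show ?thesis .
    qed
    have part1: "\<bar>\<psi> (\<eta> a) (c a)\<bar> \<le> card F * (\<delta> * (3 * norm (\<eta> a)))" if a: "a \<in> E" for a
    proof -
      have "\<bar>\<psi> (\<eta> a) (c a)\<bar> \<le> card F * norm (\<eta> a) *
          ((\<Sum>z\<in>Z a. \<bar>coord (c a) z\<bar>) * sqrt \<theta> + 2 * norm (c a - trunc (Z a) (c a)))"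
        using \<theta> by (intro \<psi>_small tr Z) auto
      also have "\<dots> \<le> card F * norm (\<eta> a) * (\<delta> + 2 * \<delta>)"
      proof (intro mult_left_mono add_mono)
        have "(\<Sum>z\<in>Z a. \<bar>coord (c a) z\<bar>) * sqrt \<theta> \<le> m * sqrt \<theta>"
          using m_ge[OF a] \<theta> by (intro mult_right_mono) auto
        then show "(\<Sum>z\<in>Z a. \<bar>coord (c a) z\<bar>) * sqrt \<theta> \<le> \<delta>" using m\<theta> by linarith
        show "norm (c a - trunc (Z a) (c a)) \<le> \<delta>" using Z(2)[of a] by simp
      qed auto
      finally show ?thesis by (simp add: algebra_simps)
    qed
    have "\<bar>\<Sum>a\<in>E. \<Sum>h\<in>F. inner (D (c a) h) (rt h (\<eta> a))\<bar> \<le> (\<Sum>a\<in>E.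
        sqrt (card F) * norm (c a) * sqrt (card F * (norm (\<eta> a - trunc (Y a) (\<eta> a)))\<^sup>2 + card b * (norm (\<eta> a))\<^sup>2)
        + card b * (1 / sqrt t * norm (\<eta> a)))"
    proof (rule pairing_le[where ?E0.0 = E0])
      show "cobounds a (c a)" if "a \<in> E" for a using cob E that by auto
    qed (use E cycle Yf in \<open>auto simp: b_def E0_def\<close>)
    also have "\<dots> \<le> (\<Sum>a\<in>E. card F * (\<delta> * (norm (c a) * (1 + norm (\<eta> a)))) + card F * (\<delta> * norm (\<eta> a)))"
    proof (intro sum_mono add_mono)
      fix a assume a: "a \<in> E"
      have "card F * (norm (\<eta> a - trunc (Y a) (\<eta> a)))\<^sup>2 + card b * (norm (\<eta> a))\<^sup>2
          \<le> card F * \<delta>\<^sup>2 + (card F * \<delta>\<^sup>2) * (norm (\<eta> a))\<^sup>2"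
      proof (intro add_mono mult_left_mono mult_right_mono power_mono)
        show "norm (\<eta> a - trunc (Y a) (\<eta> a)) \<le> \<delta>" using Y[OF a] by simp
        show "real (card b) \<le> card F * \<delta>\<^sup>2"
          using b mult_right_mono[OF \<rho>(4), of "real (card F)"] by (simp add: mult.commute)
      qed auto
      also have "\<dots> \<le> (sqrt (card F) * (\<delta> * (1 + norm (\<eta> a))))\<^sup>2"
      proof -
        have "card F * \<delta>\<^sup>2 + (card F * \<delta>\<^sup>2) * (norm (\<eta> a))\<^sup>2 = (card F * \<delta>\<^sup>2) * (1 + (norm (\<eta> a))\<^sup>2)"
          by (simp add: distrib_left)
        also have "\<dots> \<le> (card F * \<delta>\<^sup>2) * (1 + norm (\<eta> a))\<^sup>2"
          by (intro mult_left_mono) (auto simp: power2_sum)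
        finally show ?thesis by (simp add: power_mult_distrib)
      qed
      finally have "sqrt (card F * (norm (\<eta> a - trunc (Y a) (\<eta> a)))\<^sup>2 + card b * (norm (\<eta> a))\<^sup>2)
          \<le> sqrt (card F) * (\<delta> * (1 + norm (\<eta> a)))"
        using \<delta> by (intro real_le_lsqrt) auto
      then have "sqrt (card F) * norm (c a) * sqrt (card F * (norm (\<eta> a - trunc (Y a) (\<eta> a)))\<^sup>2 + card b * (norm (\<eta> a))\<^sup>2)
          \<le> sqrt (card F) * norm (c a) * (sqrt (card F) * (\<delta> * (1 + norm (\<eta> a))))"
        by (intro mult_left_mono) auto
      also have "\<dots> = (sqrt (card F) * sqrt (card F)) * (\<delta> * (norm (c a) * (1 + norm (\<eta> a))))"
        by (simp only: mult_ac)
      finally show "sqrt (card F) * norm (c a) * sqrt (card F * (norm (\<eta> a - trunc (Y a) (\<eta> a)))\<^sup>2 + card b * (norm (\<eta> a))\<^sup>2)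
          \<le> card F * (\<delta> * (norm (c a) * (1 + norm (\<eta> a))))" by simp
      have "real (card b) \<le> card F * (\<delta> * sqrt t)"
        using b mult_right_mono[OF \<rho>(3), of "real (card F)"] by (simp add: mult.commute)
      then have "card b * (1 / sqrt t * norm (\<eta> a)) \<le> card F * (\<delta> * sqrt t) * (1 / sqrt t * norm (\<eta> a))"
        using t by (intro mult_right_mono) auto
      then show "card b * (1 / sqrt t * norm (\<eta> a)) \<le> card F * (\<delta> * norm (\<eta> a))"
        using t by simp
    qed
    also have "\<dots> = card F * (\<delta> * (Kc + K\<eta>))"
      by (simp add: Kc_def K\<eta>_def sum.distrib sum_distrib_left algebra_simps)
    finally have part2: "\<bar>\<Sum>a\<in>E. \<Sum>h\<in>F. inner (D (c a) h) (rt h (\<eta> a))\<bar> \<le> card F * (\<delta> * (Kc + K\<eta>))" .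
    have "card F * q = (\<Sum>a\<in>E. \<Sum>h\<in>F. inner (rt h (c a)) (rt h (\<eta> a)))"
      by (simp add: q_def sum_distrib_left)
    also have "\<dots> = (\<Sum>a\<in>E. \<psi> (\<eta> a) (c a)) + (\<Sum>a\<in>E. \<Sum>h\<in>F. inner (D (c a) h) (rt h (\<eta> a)))"
      unfolding \<psi>_def sum.distrib[symmetric] inner_add_left[symmetric] by simp
    finally have "card F * q = (\<Sum>a\<in>E. \<psi> (\<eta> a) (c a)) + (\<Sum>a\<in>E. \<Sum>h\<in>F. inner (D (c a) h) (rt h (\<eta> a)))" .
    moreover have "\<bar>\<Sum>a\<in>E. \<psi> (\<eta> a) (c a)\<bar> \<le> card F * (\<delta> * (3 * K\<eta>))"
    proof -
      have "\<bar>\<Sum>a\<in>E. \<psi> (\<eta> a) (c a)\<bar> \<le> (\<Sum>a\<in>E. \<bar>\<psi> (\<eta> a) (c a)\<bar>)" by (rule sum_abs)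
      also have "\<dots> \<le> (\<Sum>a\<in>E. card F * (\<delta> * (3 * norm (\<eta> a))))" by (intro sum_mono part1)
      also have "\<dots> = card F * (\<delta> * (3 * K\<eta>))" by (simp add: K\<eta>_def sum_distrib_left)
      finally show ?thesis .
    qed
    ultimately have "\<bar>card F * q\<bar> \<le> card F * (\<delta> * (3 * K\<eta>)) + card F * (\<delta> * (Kc + K\<eta>))"
      using part2 by linarith
    also have "\<dots> = card F * (\<delta> * (4 * K\<eta> + Kc))" by (simp add: algebra_simps)
    finally have "card F * \<bar>q\<bar> \<le> card F * (\<delta> * (4 * K\<eta> + Kc))" by (simp add: abs_mult)
    then show ?thesis using cF by simp
  qed
  have K0: "0 \<le> 4 * K\<eta> + Kc"
    unfolding K\<eta>_def Kc_def by (intro add_nonneg_nonneg mult_nonneg_nonneg sum_nonneg) auto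
  have "\<bar>q\<bar> \<le> 0 + e" if e: "0 < e" for e
  proof -
    have "\<bar>q\<bar> \<le> e / (4 * K\<eta> + Kc + 1) * (4 * K\<eta> + Kc)"
      using K0 e by (intro small) auto
    also have "\<dots> = e * ((4 * K\<eta> + Kc) / (4 * K\<eta> + Kc + 1))" by simp
    also have "\<dots> \<le> e * 1" using K0 e by (intro mult_left_mono) auto
    finally show ?thesis by simp
  qed
  then have "\<bar>q\<bar> \<le> 0" by (rule field_le_epsilon)
  then show ?thesis by (simp add: q_def)
qed

end

section \<open>Families of vectors\<close>

text \<open>A vector over \<open>'a \<times> 'i\<close> is an orthogonal sum of its columns, which are vectors over \<open>'a\<close>.\<close>

definition col :: "'i \<Rightarrow> ('a \<times> 'i) l2 \<Rightarrow> 'a l2" where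
  "col i w = l2_of (\<lambda>x. coord w (x, i))"

definition emb :: "'i \<Rightarrow> 'a l2 \<Rightarrow> ('a \<times> 'i) l2" where
  "emb i u = l2_of (\<lambda>p. if snd p = i then coord u (fst p) else 0)"

lemma
  shows coord_col [simp]: "coord (col i w) x = coord w (x, i)"
    and norm_col_le: "norm (col i w) \<le> norm w"
proof -
  have 1: "(\<Sum>x\<in>X. (coord w (x, i))\<^sup>2) \<le> (norm w)\<^sup>2" if "finite X" for X
  proof -
    have "(\<Sum>x\<in>X. (coord w (x, i))\<^sup>2) = (\<Sum>p\<in>(\<lambda>x. (x, i)) ` X. (coord w p)\<^sup>2)"
      by (subst sum.reindex) (auto intro!: inj_onI)
    also have "\<dots> \<le> (norm w)\<^sup>2" using that by (intro sum_coord_square_le) auto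
    finally show ?thesis .
  qed
  show "coord (col i w) x = coord w (x, i)"
    unfolding col_def by (subst coord_l2_of_bounded[where C = "norm w"]) (use 1 in auto)
  show "norm (col i w) \<le> norm w"
    unfolding col_def by (rule norm_l2_of_bounded) (use 1 in auto)
qed

lemma coord_emb [simp]: "coord (emb i u) p = (if snd p = i then coord u (fst p) else 0)"
proof -
  have "(\<Sum>p\<in>P. (if snd p = i then coord u (fst p) else 0)\<^sup>2) \<le> (norm u)\<^sup>2"
    if P: "finite P" for P
  proof -
    have "(\<Sum>p\<in>P. (if snd p = i then coord u (fst p) else 0)\<^sup>2)
        = (\<Sum>p\<in>{p\<in>P. snd p = i}. (coord u (fst p))\<^sup>2)"
      using P by (intro sum.mono_neutral_cong_right) auto
    also have "\<dots> = (\<Sum>x\<in>fst ` {p\<in>P. snd p = i}. (coord u x)\<^sup>2)"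
      by (subst sum.reindex) (auto intro!: inj_onI prod_eqI)
    also have "\<dots> \<le> (norm u)\<^sup>2" using P by (intro sum_coord_square_le) auto
    finally show ?thesis .
  qed
  then show ?thesis
    unfolding emb_def by (subst coord_l2_of_bounded[where C = "norm u"]) auto
qed

lemma col_emb: "col j (emb i u) = (if j = i then u else 0)"
  by (rule l2_eqI) auto

lemma inner_emb: "inner (emb i u) w = inner u (col i w)"
proof -
  have "inner (emb i u) w = (\<Sum>\<^sub>\<infinity>p\<in>(\<lambda>x. (x, i)) ` UNIV. coord u (fst p) * coord w p)"
    unfolding inner_coord by (rule infsum_cong_neutral) (auto simp: image_iff)
  also have "\<dots> = (\<Sum>\<^sub>\<infinity>x. coord u x * coord w (x, i))"
    by (subst infsum_reindex) (auto intro!: inj_onI simp: o_def)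
  finally show ?thesis by (simp add: inner_coord)
qed

lemma inner_emb': "inner w (emb i u) = inner (col i w) u"
  by (metis inner_emb inner_commute)

lemma norm_emb [simp]: "norm (emb i u) = norm u"
  by (simp add: norm_eq_sqrt_inner inner_emb col_emb)

lemma linear_emb: "linear (emb i)" and linear_col: "linear (col i)"
  by (rule linearI; rule l2_eqI; simp)+

lemma bounded_linear_emb: "bounded_linear (emb i)"
  by (rule bounded_linear_intro[where K = 1])
    (simp_all add: linear_add[OF linear_emb] linear_scale[OF linear_emb])

lemma bounded_linear_col: "bounded_linear (col i)"
  by (rule bounded_linear_intro[where K = 1])
    (simp_all add: linear_add[OF linear_col] linear_scale[OF linear_col] norm_col_le)

lemma norm_mono_coord:
  assumes "\<And>x. \<bar>coord u x\<bar> \<le> \<bar>coord v x\<bar>"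
  shows "norm u \<le> norm v"
proof (rule norm_le_coord)
  fix F :: "'a set" assume "finite F"
  have "(\<Sum>x\<in>F. (coord u x)\<^sup>2) \<le> (\<Sum>x\<in>F. (coord v x)\<^sup>2)"
    by (intro sum_mono) (use assms in \<open>simp add: abs_le_square_iff\<close>)
  also have "\<dots> \<le> (norm v)\<^sup>2" by (rule sum_coord_square_le[OF \<open>finite F\<close>])
  finally show "(\<Sum>x\<in>F. (coord u x)\<^sup>2) \<le> (norm v)\<^sup>2" .
qed simp

lemma norm_sum_emb:
  assumes "finite I"
  shows "(norm (\<Sum>i\<in>I. emb i (u i)))\<^sup>2 = (\<Sum>i\<in>I. (norm (u i))\<^sup>2)"
proof -
  have "inner (emb i (u i)) (\<Sum>j\<in>I. emb j (u j)) = inner (u i) (u i)" if "i \<in> I" for i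
    using assms that by (simp add: inner_emb linear_sum[OF linear_col] col_emb)
  then show ?thesis
    unfolding power2_norm_eq_inner inner_sum_left by (intro sum.cong) auto
qed

lemma sum_norm_col_le:
  assumes "finite I"
  shows "(\<Sum>i\<in>I. (norm (col i w))\<^sup>2) \<le> (norm w)\<^sup>2"
  unfolding norm_sum_emb[OF assms, symmetric]
proof (rule power_mono)
  show "norm (\<Sum>i\<in>I. emb i (col i w)) \<le> norm w"
  proof (rule norm_mono_coord)
    fix p
    have "coord (\<Sum>i\<in>I. emb i (col i w)) p = (if snd p \<in> I then coord w p else 0)"
      using assms by simp
    then show "\<bar>coord (\<Sum>i\<in>I. emb i (col i w)) p\<bar> \<le> \<bar>coord w p\<bar>" by simp
  qed
qed simp

context type_group
begin

definition Lt :: "'a \<Rightarrow> ('a \<times> 'i) l2 \<Rightarrow> ('a \<times> 'i) l2" where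
  "Lt g = permute (map_prod (\<lambda>x. \<iota> g \<odot> x) id)"

lemma bij_Lt: "bij (map_prod (\<lambda>x. \<iota> g \<odot> x) (id :: 'i \<Rightarrow> 'i))"
  using bij_betw_map_prod[OF bij_mult_left bij_id] by simp

lemma coord_Lt [simp]: "coord (Lt g w) (x, i) = coord w (\<iota> g \<odot> x, i)"
  unfolding Lt_def by (subst coord_permute) (auto simp: bij_is_inj[OF bij_Lt])

lemma norm_Lt [simp]: "norm (Lt g w) = norm w"
  unfolding Lt_def by (rule norm_permute[OF bij_Lt])

lemma linear_Lt: "linear (Lt g)"
  by (rule linearI; rule l2_eqI) auto

lemma col_Lt: "col i (Lt g w) = lt g (col i w)"
  by (rule l2_eqI) simp

lemma emb_lt: "emb i (lt g u) = Lt g (emb i u)"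
  by (rule l2_eqI) (auto simp: coord_emb split: prod.splits)

end

section \<open>Limits along ultrafilters\<close>

definition ultra :: "'a filter \<Rightarrow> bool" where
  "ultra U \<longleftrightarrow> U \<noteq> bot \<and> (\<forall>P. eventually P U \<or> eventually (\<lambda>x. \<not> P x) U)"

text \<open>A filter is represented by the collection of its eventual predicates, so that a maximal collection in
Zorn's lemma is a minimal filter.\<close>

lemma ultrafilter_exists:
  assumes "F \<noteq> bot"
  obtains U where "U \<le> F" "ultra U"
proof -
  define ev where "ev U = {P. eventually P U}" for U :: "'a filter"
  have ev_le: "ev U \<subseteq> ev V \<longleftrightarrow> V \<le> U" for U V by (auto simp: ev_def le_filter_def)
  define \<A> where "\<A> = ev ` {U. U \<le> F \<and> U \<noteq> bot}"
  have "\<exists>u\<in>\<A>. \<forall>X\<in>C. X \<subseteq> u" if C: "subset.chain \<A> C" for C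
  proof (cases "C = {}")
    case False
    define B where "B = {U. U \<le> F \<and> U \<noteq> bot \<and> ev U \<in> C}"
    have CB: "C = ev ` B" using C by (auto simp: subset.chain_def \<A>_def B_def)
    then have "B \<noteq> {}" using False by auto
    have dir: "\<exists>W\<in>B. W \<le> inf U V" if "U \<in> B" "V \<in> B" for U V
    proof -
      have "ev U \<subseteq> ev V \<or> ev V \<subseteq> ev U" using C that by (auto simp: subset.chain_def B_def)
      then show ?thesis using that unfolding ev_le by auto
    qed
    have evI: "eventually P (Inf B) \<longleftrightarrow> (\<exists>U\<in>B. eventually P U)" for P
      by (rule eventually_Inf_base[OF \<open>B \<noteq> {}\<close> dir])
    have "Inf B \<noteq> bot"
      using evI[of "\<lambda>_. False"] by (auto simp: trivial_limit_def B_def)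
    moreover have "Inf B \<le> F" using \<open>B \<noteq> {}\<close> by (auto simp: B_def intro: Inf_lower2)
    ultimately have "ev (Inf B) \<in> \<A>" by (auto simp: \<A>_def)
    moreover have "X \<subseteq> ev (Inf B)" if XC: "X \<in> C" for X
    proof -
      obtain V where "V \<in> B" "X = ev V" using XC unfolding CB by blast
      then show ?thesis by (simp only: ev_le Inf_lower)
    qed
    ultimately show ?thesis by blast
  qed (use assms in \<open>auto simp: \<A>_def\<close>)
  then obtain M where M: "M \<in> \<A>" "\<And>X. X \<in> \<A> \<Longrightarrow> M \<subseteq> X \<Longrightarrow> X = M"
    using subset_Zorn[of \<A>] by metis
  then obtain U where U: "U \<le> F" "U \<noteq> bot" "M = ev U" by (auto simp: \<A>_def)
  have "eventually P U \<or> eventually (\<lambda>x. \<not> P x) U" for P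
  proof (rule ccontr)
    assume n: "\<not> ?thesis"
    define V where "V = inf U (principal {x. P x})"
    have "V \<noteq> bot"
      using n by (auto simp: V_def trivial_limit_def eventually_inf_principal)
    then have "ev V \<in> \<A>" using U by (auto simp: \<A>_def V_def intro: le_infI1)
    moreover have "M \<subseteq> ev V" unfolding U(3) ev_le by (simp add: V_def)
    ultimately have "ev V = ev U" using M(2) U(3) by metis
    moreover have "P \<in> ev V" by (simp add: ev_def V_def eventually_inf_principal)
    ultimately show False using n by (simp add: ev_def)
  qed
  then have "ultra U" using U(2) by (simp add: ultra_def)
  with U(1) show ?thesis by (rule that)
qed

lemma ultra_limit:
  fixes g :: "'a \<Rightarrow> real"
  assumes U: "ultra U" and bd: "\<forall>\<^sub>F x in U. \<bar>g x\<bar> \<le> C"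
  shows "(g \<longlongrightarrow> Lim U g) U"
proof -
  have nb: "U \<noteq> bot" using U by (simp add: ultra_def)
  have "filtermap g U \<noteq> bot" using nb by (simp add: filtermap_bot_iff)
  moreover have "eventually (\<lambda>y. y \<in> {-C..C}) (filtermap g U)"
    unfolding eventually_filtermap by (rule eventually_mono[OF bd]) auto
  ultimately obtain l where l: "inf (nhds l) (filtermap g U) \<noteq> bot"
    using compact_Icc[of "-C" C] unfolding compact_filter by blast
  have "(g \<longlongrightarrow> l) U"
  proof (rule topological_tendstoI)
    fix S assume S: "open S" "l \<in> S"
    show "\<forall>\<^sub>F x in U. g x \<in> S"
    proof (rule ccontr)
      assume "\<not> ?thesis"
      then have "\<forall>\<^sub>F x in U. g x \<notin> S" using U by (auto simp: ultra_def)
      then have "\<forall>\<^sub>F y in inf (nhds l) (filtermap g U). y \<notin> S"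
        by (intro filter_leD[OF inf_le2]) (simp add: eventually_filtermap)
      moreover have "\<forall>\<^sub>F y in inf (nhds l) (filtermap g U). y \<in> S"
        by (intro filter_leD[OF inf_le1] eventually_nhds_in_open S)
      ultimately have "\<forall>\<^sub>F y in inf (nhds l) (filtermap g U). False" by eventually_elim simp
      then show False using l by (simp add: trivial_limit_def)
    qed
  qed
  then show ?thesis using tendsto_Lim[OF nb] by metis
qed

text \<open>The limit is taken coordinate by coordinate. Bounds on norms survive, since they can be tested on finite sets
of coordinates.\<close>

lemma weak_limit_operator:
  fixes R :: "'k \<Rightarrow> 'a l2 \<Rightarrow> 'a l2"
  assumes U: "ultra U" and lin: "\<And>k. linear (R k)" and contr: "\<And>k v. norm (R k v) \<le> norm v"
  obtains Q where "linear Q" "\<And>v x. ((\<lambda>k. coord (R k v) x) \<longlongrightarrow> coord (Q v) x) U"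
    "\<And>v C. (\<forall>\<^sub>F k in U. norm (R k v) \<le> C) \<Longrightarrow> norm (Q v) \<le> C"
proof -
  have nb: "U \<noteq> bot" using U by (simp add: ultra_def)
  define q where "q v x = Lim U (\<lambda>k. coord (R k v) x)" for v x
  have q: "((\<lambda>k. coord (R k v) x) \<longlongrightarrow> q v x) U" for v x
    unfolding q_def
    by (rule ultra_limit[OF U, of _ "norm v"]) (intro always_eventually allI order_trans[OF abs_coord_le contr])
  have sum_le: "(\<Sum>x\<in>F. (q v x)\<^sup>2) \<le> C\<^sup>2" if F: "finite F" and C: "\<forall>\<^sub>F k in U. norm (R k v) \<le> C" for F v C
  proof (rule tendsto_upperbound)
    show "((\<lambda>k. \<Sum>x\<in>F. (coord (R k v) x)\<^sup>2) \<longlongrightarrow> (\<Sum>x\<in>F. (q v x)\<^sup>2)) U"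
      by (intro tendsto_intros q)
    show "\<forall>\<^sub>F k in U. (\<Sum>x\<in>F. (coord (R k v) x)\<^sup>2) \<le> C\<^sup>2"
      using C
    proof eventually_elim
      case (elim k)
      then show ?case
        using sum_coord_square_le[OF F, of "R k v"] power_mono[OF elim, of 2] by simp
    qed
  qed (rule nb)
  define Q where "Q v = l2_of (q v)" for v
  have Q: "coord (Q v) x = q v x" for v x
    unfolding Q_def by (subst coord_l2_of_bounded[where C = "norm v"]) (auto intro: sum_le simp: contr)
  show ?thesis
  proof (rule that[of Q])
    show "((\<lambda>k. coord (R k v) x) \<longlongrightarrow> coord (Q v) x) U" for v x
      unfolding Q by (rule q)
    show "linear Q"
    proof (rule linearI; rule l2_eqI)
      fix u v x
      show "coord (Q (u + v)) x = coord (Q u + Q v) x"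
      proof (rule tendsto_unique[OF nb])
        show "((\<lambda>k. coord (R k (u + v)) x) \<longlongrightarrow> coord (Q (u + v)) x) U" unfolding Q by (rule q)
        show "((\<lambda>k. coord (R k (u + v)) x) \<longlongrightarrow> coord (Q u + Q v) x) U"
          unfolding linear_add[OF lin] coord_add Q by (intro tendsto_intros q)
      qed
    next
      fix r v x
      show "coord (Q (r *\<^sub>R v)) x = coord (r *\<^sub>R Q v) x"
      proof (rule tendsto_unique[OF nb])
        show "((\<lambda>k. coord (R k (r *\<^sub>R v)) x) \<longlongrightarrow> coord (Q (r *\<^sub>R v)) x) U" unfolding Q by (rule q)
        show "((\<lambda>k. coord (R k (r *\<^sub>R v)) x) \<longlongrightarrow> coord (r *\<^sub>R Q v) x) U"
          unfolding linear_scale[OF lin] coord_scaleR Q by (intro tendsto_intros q)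
      qed
    qed
    show "norm (Q v) \<le> C" if C: "\<forall>\<^sub>F k in U. norm (R k v) \<le> C" for v C
    proof (rule norm_le_coord)
      show "0 \<le> C"
        using eventually_happens'[OF nb C] norm_ge_zero order_trans by blast
    qed (use sum_le[OF _ C] in \<open>simp add: Q\<close>)
  qed
qed

section \<open>Quasi-cocycles on an infinite amenable subgroup\<close>

context type_group
begin

text \<open>The part of \<open>u\<close> on the right coset \<open>A r\<close>, moved to \<open>A\<close>.\<close>

definition slice :: "'a set \<Rightarrow> 'a \<Rightarrow> 'a l2 \<Rightarrow> 'a l2" where
  "slice A r u = l2_of (\<lambda>y. if y \<in> A then coord u (y \<odot> r) else 0)"

lemma coord_slice: "coord (slice A r u) y = (if y \<in> A then coord u (y \<odot> r) else 0)"
proof -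
  have "(\<Sum>y\<in>Y. (if y \<in> A then coord u (y \<odot> r) else 0)\<^sup>2) \<le> (norm u)\<^sup>2" if Y: "finite Y" for Y
  proof -
    have "(\<Sum>y\<in>Y. (if y \<in> A then coord u (y \<odot> r) else 0)\<^sup>2) \<le> (\<Sum>y\<in>Y. (coord u (y \<odot> r))\<^sup>2)"
      by (intro sum_mono) auto
    also have "\<dots> = (\<Sum>x\<in>(\<lambda>y. y \<odot> r) ` Y. (coord u x)\<^sup>2)"
      by (subst sum.reindex) (auto intro!: inj_onI)
    also have "\<dots> \<le> (norm u)\<^sup>2" using Y by (intro sum_coord_square_le) auto
    finally show ?thesis .
  qed
  then show ?thesis
    unfolding slice_def by (subst coord_l2_of_bounded[where C = "norm u"]) auto
qed

end

definition fin_supp :: "'a l2 \<Rightarrow> bool" where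
  "fin_supp u \<longleftrightarrow> finite {x. coord u x \<noteq> 0}"

lemma subspace_fin_supp: "subspace {u. fin_supp u}"
proof (rule subspaceI)
  fix u v :: "'a l2" and r :: real
  assume "u \<in> {u. fin_supp u}" "v \<in> {u. fin_supp u}"
  then have "finite ({x. coord u x \<noteq> 0} \<union> {x. coord v x \<noteq> 0})" by (simp add: fin_supp_def)
  then show "u + v \<in> {u. fin_supp u}"
    unfolding mem_Collect_eq fin_supp_def by (rule finite_subset[rotated]) auto
next
  fix u :: "'a l2" and r :: real
  assume "u \<in> {u. fin_supp u}"
  then show "r *\<^sub>R u \<in> {u. fin_supp u}"
    unfolding mem_Collect_eq fin_supp_def by (rule finite_subset[rotated]) auto
qed (simp add: fin_supp_def)

lemma fin_supp_basis: "fin_supp (basis x)"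
  unfolding fin_supp_def by (rule finite_subset[of _ "{x}"]) (auto simp: coord_basis split: if_splits)

context amenable_part
begin

text \<open>Representatives of the right cosets of \<open>A\<close>.\<close>

definition rep :: "'a \<Rightarrow> 'a" where "rep x = (SOME y. \<exists>b\<in>A. y = b \<odot> x)"

lemma rep: "x \<odot> \<iota> (rep x) \<in> A"
proof -
  have "\<exists>y. \<exists>b\<in>A. y = b \<odot> x" using neutral_A by blast
  then have "\<exists>b\<in>A. rep x = b \<odot> x" unfolding rep_def by (rule someI_ex)
  then obtain b where b: "b \<in> A" "rep x = b \<odot> x" by blast
  then show ?thesis unfolding b(2) by (simp only: inver_mult inver_right_cancel) (rule inver_A)
qed

lemma rep_mult: "b \<in> A \<Longrightarrow> rep (b \<odot> x) = rep x"
proof -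
  assume b: "b \<in> A"
  have "(\<lambda>y. \<exists>d\<in>A. y = d \<odot> (b \<odot> x)) = (\<lambda>y. \<exists>d\<in>A. y = d \<odot> x)"
  proof (intro ext iffI)
    fix y assume "\<exists>d\<in>A. y = d \<odot> (b \<odot> x)"
    then obtain d where d: "d \<in> A" "y = d \<odot> (b \<odot> x)" by blast
    show "\<exists>d\<in>A. y = d \<odot> x"
      by (rule bexI[of _ "d \<odot> b"]) (simp_all add: d b)
  next
    fix y assume "\<exists>d\<in>A. y = d \<odot> x"
    then obtain d where d: "d \<in> A" "y = d \<odot> x" by blast
    show "\<exists>d\<in>A. y = d \<odot> (b \<odot> x)"
      by (rule bexI[of _ "d \<odot> \<iota> b"]) (simp_all add: d b)
  qed
  then show ?thesis unfolding rep_def by (rule arg_cong)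
qed

lemma coset_decomposition: "bij_betw (\<lambda>(r, y). y \<odot> r) (range rep \<times> A) UNIV"
proof (rule bij_betw_byWitness[where f' = "\<lambda>x. (rep x, x \<odot> \<iota> (rep x))"])
  have "rep (rep x) = rep x" for x
    using rep_mult[OF inver_A[OF rep[of x]], of x] by simp
  then show "\<forall>p\<in>range rep \<times> A. (\<lambda>x. (rep x, x \<odot> \<iota> (rep x))) ((\<lambda>(r, y). y \<odot> r) p) = p"
    by (auto simp: rep_mult)
qed (auto simp: rep)

text \<open>The mean over \<open>h\<close> of \<open>c (a h) - a (c h)\<close> is a cocycle in \<open>a\<close>, and it stays within the defect of \<open>c a\<close>. A cocycle
with values in functions on a free \<open>A\<close>-set is the coboundary of a function \<open>f\<close>, which is obtained by
evaluating it along each coset; \<open>f\<close> need not be square-summable.\<close>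

lemma quasi_cocycle_near_formal_coboundary:
  assumes defect: "\<And>a b. a \<in> A \<Longrightarrow> b \<in> A \<Longrightarrow> norm (lt a (c b) - c (a \<odot> b) + c a) \<le> D"
  obtains f c' where "\<And>a x. a \<in> A \<Longrightarrow> coord (c' a) x = f x - f (\<iota> a \<odot> x)"
    "\<And>a. a \<in> A \<Longrightarrow> norm (c a - c' a) \<le> D"
proof -
  define v where "v a h = c (a \<odot> h) - lt a (c h)" for a h
  have v: "norm (v a h - c a) \<le> D" if "a \<in> A" "h \<in> A" for a h
  proof -
    have eq: "v a h - c a = - (lt a (c h) - c (a \<odot> h) + c a)" by (simp add: v_def)
    show ?thesis unfolding eq norm_minus_cancel by (rule defect[OF that])
  qed
  have bdd_v: "bdd (\<lambda>h. coord (v a h) x)" if "a \<in> A" for a x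
  proof (rule bddI)
    fix h assume "h \<in> A"
    then show "\<bar>coord (v a h) x\<bar> \<le> D + norm (c a)"
      using abs_coord_le[of "v a h" x] v[OF that] norm_triangle_sub[of "v a h" "c a"]
      by (smt (verit))
  qed
  define e where "e a x = \<mu> (\<lambda>h. coord (v a h - c a) x)" for a x
  have bdd_e: "bdd (\<lambda>h. coord (v a h - c a) x)" if "a \<in> A" for a x
    unfolding coord_diff by (intro bdd_diff bdd_v that) simp
  have e_le: "(\<Sum>x\<in>F. (e a x)\<^sup>2) \<le> D\<^sup>2" if a: "a \<in> A" and F: "finite F" for a F
  proof -
    have "(\<Sum>x\<in>F. (e a x)\<^sup>2) \<le> (\<Sum>x\<in>F. \<mu> (\<lambda>h. (coord (v a h - c a) x)\<^sup>2))"
      unfolding e_def by (intro sum_mono mean_square_le bdd_e a)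
    also have "\<dots> = \<mu> (\<lambda>h. \<Sum>x\<in>F. (coord (v a h - c a) x)\<^sup>2)"
      by (intro mean_sum[symmetric] F bdd_square bdd_e a)
    also have "\<dots> \<le> \<mu> (\<lambda>h. D\<^sup>2)"
    proof (rule mean_mono)
      show "bdd (\<lambda>h. \<Sum>x\<in>F. (coord (v a h - c a) x)\<^sup>2)" by (intro bdd_sum bdd_square bdd_e a)
      fix h assume "h \<in> A"
      have "(\<Sum>x\<in>F. (coord (v a h - c a) x)\<^sup>2) \<le> (norm (v a h - c a))\<^sup>2"
        by (rule sum_coord_square_le[OF F])
      also have "\<dots> \<le> D\<^sup>2" using v[OF a \<open>h \<in> A\<close>] by (intro power_mono) auto
      finally show "(\<Sum>x\<in>F. (coord (v a h - c a) x)\<^sup>2) \<le> D\<^sup>2" .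
    qed simp
    finally show ?thesis by (simp add: mean_const)
  qed
  define c' where "c' a = c a + l2_of (e a)" for a
  have D0: "0 \<le> D" using order_trans[OF norm_ge_zero v[of \<u> \<u>]] by simp
  have c': "coord (c' a) x = \<mu> (\<lambda>h. coord (v a h) x)" if a: "a \<in> A" for a x
  proof -
    have "coord (l2_of (e a)) = e a"
      by (rule coord_l2_of_bounded[OF e_le[OF a]])
    moreover have "e a x = \<mu> (\<lambda>h. coord (v a h) x) - coord (c a) x"
      unfolding e_def coord_diff by (simp add: mean_diff bdd_v[OF a] mean_const)
    ultimately show ?thesis by (simp add: c'_def)
  qed
  define f where "f x = \<mu> (\<lambda>h. coord (v (x \<odot> \<iota> (rep x)) h) x)" for x
  show ?thesis
  proof (rule that[of c' f])
    fix a x assume a: "a \<in> A"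
    define b where "b = x \<odot> \<iota> (rep x)"
    have b: "b \<in> A" by (simp add: b_def rep)
    have ab: "\<iota> a \<odot> b \<in> A" using a b by simp
    have b': "(\<iota> a \<odot> x) \<odot> \<iota> (rep (\<iota> a \<odot> x)) = \<iota> a \<odot> b" by (simp add: rep_mult a b_def)
    have "f x - f (\<iota> a \<odot> x)
        = \<mu> (\<lambda>h. coord (v b h) x - coord (v (\<iota> a \<odot> b) h) (\<iota> a \<odot> x))"
      unfolding f_def b' b_def[symmetric] by (intro mean_diff[symmetric] bdd_v b ab)
    also have "\<dots> = \<mu> (\<lambda>h. coord (v a ((\<iota> a \<odot> b) \<odot> h)) x)"
      by (rule arg_cong[where f = \<mu>], rule ext) (simp add: v_def)
    also have "\<dots> = \<mu> (\<lambda>h. coord (v a h) x)"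
      by (rule mean_translate[OF ab bdd_v[OF a]])
    finally show "coord (c' a) x = f x - f (\<iota> a \<odot> x)" by (simp add: c'[OF a])
  next
    fix a assume a: "a \<in> A"
    have "norm (l2_of (e a)) \<le> D" by (rule norm_l2_of_bounded[OF e_le[OF a] D0])
    then show "norm (c a - c' a) \<le> D" by (simp add: c'_def)
  qed
qed

lemma has_sum_sum_inner:
  assumes "finite E"
  shows "((\<lambda>x. \<Sum>a\<in>E. coord (u a) x * coord (v a) x) has_sum (\<Sum>a\<in>E. inner (u a) (v a))) UNIV"
  using assms
proof (induction E rule: finite_induct)
  case (insert a E)
  have "((\<lambda>x. coord (u a) x * coord (v a) x) has_sum inner (u a) (v a)) UNIV"
    by (simp add: inner_coord coord_times_summable)
  from has_sum_add[OF this insert.IH] show ?case using insert.hyps by simp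
qed simp

text \<open>The pairing is the sum of the pairings over the cosets of \<open>A\<close>, each of which is covered by
\<open>coboundary_orthogonal_cycle\<close>.\<close>

lemma formal_coboundary_orthogonal_cycle:
  assumes inf: "infinite A"
    and E: "finite E" "E \<subseteq> A"
    and c: "\<And>a x. a \<in> A \<Longrightarrow> coord (c a) x = f x - f (\<iota> a \<odot> x)"
    and cycle: "\<And>x. (\<Sum>a\<in>E. coord (\<eta> a) x - coord (\<eta> a) (a \<odot> x)) = 0"
  shows "(\<Sum>a\<in>E. inner (c a) (\<eta> a)) = 0"
proof -
  define p where "p x = (\<Sum>a\<in>E. coord (c a) x * coord (\<eta> a) x)" for x
  have p: "(p has_sum (\<Sum>a\<in>E. inner (c a) (\<eta> a))) UNIV"
    unfolding p_def[abs_def] by (rule has_sum_sum_inner[OF E(1)])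
  have sliced: "(\<Sum>\<^sub>\<infinity>y\<in>A. p (y \<odot> r)) = 0" for r
  proof -
    have "(\<Sum>a\<in>E. inner (slice A r (c a)) (slice A r (\<eta> a))) = 0"
    proof (rule coboundary_orthogonal_cycle[where f = "\<lambda>y. f (y \<odot> r)", OF inf E])
      show "coord (slice A r (c a)) x = f (x \<odot> r) - f (\<iota> a \<odot> x \<odot> r)" if "a \<in> A" "x \<in> A" for a x
        using c[OF that(1)] that(2) by (simp add: coord_slice)
      show "(\<Sum>a\<in>E. coord (slice A r (\<eta> a)) x - coord (slice A r (\<eta> a)) (a \<odot> x)) = 0" if x: "x \<in> A" for x
      proof -
        have "(\<Sum>a\<in>E. coord (slice A r (\<eta> a)) x - coord (slice A r (\<eta> a)) (a \<odot> x))
            = (\<Sum>a\<in>E. coord (\<eta> a) (x \<odot> r) - coord (\<eta> a) (a \<odot> (x \<odot> r)))"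
          using E x by (intro sum.cong refl) (auto simp: coord_slice)
        then show ?thesis using cycle by simp
      qed
    qed (simp add: coord_slice)
    moreover have "((\<lambda>y. \<Sum>a\<in>E. coord (slice A r (c a)) y * coord (slice A r (\<eta> a)) y) has_sum
        (\<Sum>a\<in>E. inner (slice A r (c a)) (slice A r (\<eta> a)))) UNIV"
      by (rule has_sum_sum_inner[OF E(1)])
    ultimately have "(\<Sum>\<^sub>\<infinity>y. \<Sum>a\<in>E. coord (slice A r (c a)) y * coord (slice A r (\<eta> a)) y) = 0"
      by (simp add: infsumI)
    moreover have "(\<Sum>\<^sub>\<infinity>y. \<Sum>a\<in>E. coord (slice A r (c a)) y * coord (slice A r (\<eta> a)) y) = (\<Sum>\<^sub>\<infinity>y\<in>A. p (y \<odot> r))"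
      by (rule infsum_cong_neutral) (auto simp: coord_slice p_def)
    ultimately show ?thesis by simp
  qed
  have s: "(\<lambda>(r, y). p (y \<odot> r)) summable_on range rep \<times> A"
    using summable_on_reindex_bij_betw[OF coset_decomposition, of p] has_sum_imp_summable[OF p]
    by (simp add: case_prod_unfold)
  have "(\<Sum>a\<in>E. inner (c a) (\<eta> a)) = (\<Sum>\<^sub>\<infinity>x. p x)" using p by (simp add: infsumI)
  also have "\<dots> = (\<Sum>\<^sub>\<infinity>(r, y)\<in>range rep \<times> A. p (y \<odot> r))"
    using infsum_reindex_bij_betw[OF coset_decomposition, of p] by (simp add: case_prod_unfold)
  also have "\<dots> = (\<Sum>\<^sub>\<infinity>r\<in>range rep. \<Sum>\<^sub>\<infinity>y\<in>A. p (y \<odot> r))"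
    by (rule infsum_Sigma'_banach[symmetric]) (use s in simp)
  finally show ?thesis by (simp add: sliced)
qed

text \<open>Testing orthogonality to the coboundaries of basis vectors shows that a family orthogonal to all
coboundaries of finitely supported vectors is a cycle. Hence the nearby cocycle, which is orthogonal
to all cycles, lies in the closure of these coboundaries.\<close>

theorem quasi_cocycle_approximation:
  assumes inf: "infinite A"
    and defect: "\<And>a b. a \<in> A \<Longrightarrow> b \<in> A \<Longrightarrow> norm (lt a (c b) - c (a \<odot> b) + c a) \<le> D"
    and E: "finite E" "E \<subseteq> A" and \<epsilon>: "0 < \<epsilon>"
  shows "\<exists>\<xi>. fin_supp \<xi> \<and> (\<forall>a\<in>E. norm (c a - (\<xi> - lt a \<xi>)) \<le> D + \<epsilon>)"
proof -
  obtain f c' where c': "\<And>a x. a \<in> A \<Longrightarrow> coord (c' a) x = f x - f (\<iota> a \<odot> x)"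
    and near: "\<And>a. a \<in> A \<Longrightarrow> norm (c a - c' a) \<le> D"
    using quasi_cocycle_near_formal_coboundary[OF defect] by metis
  define \<Phi> where "\<Phi> \<xi> = (\<Sum>a\<in>E. emb a (\<xi> - lt a \<xi>))" for \<xi>
  have lin: "linear \<Phi>"
    unfolding \<Phi>_def
    by (intro linear_compose_sum ballI linear_compose[OF _ linear_emb, unfolded o_def] linear_compose_sub
        linear_ident linear_lt)
  define Z where "Z = \<Phi> ` {\<xi>. fin_supp \<xi>}"
  have Z: "subspace Z"
    unfolding Z_def by (rule linear_subspace_image[OF lin subspace_fin_supp])
  define C where "C = (\<Sum>a\<in>E. emb a (c' a))"
  have "C \<in> closure Z"
  proof (rule ccontr)
    assume "C \<notin> closure Z"
    then obtain e where e: "\<And>z. z \<in> Z \<Longrightarrow> inner e z = 0" "inner e C \<noteq> 0"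
      using orthogonal_witness[OF Z] by blast
    have "(\<Sum>a\<in>E. inner (c' a) (col a e)) = 0"
    proof (rule formal_coboundary_orthogonal_cycle[OF inf E c'])
      fix x
      have "0 = inner e (\<Phi> (basis x))"
        by (rule e(1)[symmetric]) (auto simp: Z_def fin_supp_basis)
      also have "\<dots> = (\<Sum>a\<in>E. inner (col a e) (basis x - lt a (basis x)))"
        by (simp add: \<Phi>_def inner_sum_right inner_emb')
      also have "\<dots> = (\<Sum>a\<in>E. coord (col a e) x - coord (col a e) (a \<odot> x))"
        by (simp add: lt_basis inner_diff_right)
      finally show "(\<Sum>a\<in>E. coord (col a e) x - coord (col a e) (a \<odot> x)) = 0" by simp
    qed
    moreover have "inner e C = (\<Sum>a\<in>E. inner (c' a) (col a e))"
      by (simp add: C_def inner_sum_right inner_emb' inner_commute)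
    ultimately show False using e(2) by simp
  qed
  then obtain \<xi> where \<xi>: "fin_supp \<xi>" "dist (\<Phi> \<xi>) C < \<epsilon>"
    using \<epsilon> unfolding closure_approachable Z_def by blast
  have "norm (c a - (\<xi> - lt a \<xi>)) \<le> D + \<epsilon>" if a: "a \<in> E" for a
  proof -
    have "col a (C - \<Phi> \<xi>) = c' a - (\<xi> - lt a \<xi>)"
      using E(1) a by (simp add: C_def \<Phi>_def linear_diff[OF linear_col] linear_sum[OF linear_col] col_emb)
    then have "norm (c' a - (\<xi> - lt a \<xi>)) \<le> norm (C - \<Phi> \<xi>)" by (metis norm_col_le)
    also have "\<dots> < \<epsilon>" using \<xi>(2) by (simp add: dist_norm norm_minus_commute)
    finally have "norm (c' a - (\<xi> - lt a \<xi>)) < \<epsilon>" .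
    moreover have "norm (c a - (\<xi> - lt a \<xi>)) \<le> norm (c a - c' a) + norm (c' a - (\<xi> - lt a \<xi>))"
    proof -
      have "c a - (\<xi> - lt a \<xi>) = (c a - c' a) + (c' a - (\<xi> - lt a \<xi>))" by simp
      then show ?thesis by (metis norm_triangle_ineq)
    qed
    moreover have "norm (c a - c' a) \<le> D" by (rule near[OF subsetD[OF E(2) a]])
    ultimately show ?thesis by linarith
  qed
  then show ?thesis using \<xi>(1) by blast
qed

end

section \<open>Operators that make a quasi-cocycle bounded on amenable subgroups\<close>

text \<open>The frame operator of the left translates of finitely many vectors \<open>\<xi> j\<close>. By \<open>coord_V\<close>, the coordinates of
\<open>V v\<close> are the inner products of \<open>v\<close> with these translates; the definition through right translations shows at
once that \<open>V\<close> is bounded.\<close>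

locale translate_frame = type_group +
  fixes J :: "'j set" and \<xi> :: "'j \<Rightarrow> 'a l2" and t :: real
  assumes fin_J: "finite J" and fin_\<xi>: "\<And>j. j \<in> J \<Longrightarrow> fin_supp (\<xi> j)" and t_pos: "0 < t"
begin

definition X :: "'j \<Rightarrow> 'a set" where "X j = {k. coord (\<xi> j) k \<noteq> 0}"

lemma fin_X: "j \<in> J \<Longrightarrow> finite (X j)"
  using fin_\<xi> by (simp add: X_def fin_supp_def)

lemma inner_\<xi>: "j \<in> J \<Longrightarrow> inner (\<xi> j) u = (\<Sum>k\<in>X j. coord (\<xi> j) k * coord u k)"
proof -
  assume j: "j \<in> J"
  have "inner (\<xi> j) u = (\<Sum>\<^sub>\<infinity>k\<in>X j. coord (\<xi> j) k * coord u k)"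
    unfolding inner_coord by (rule infsum_cong_neutral) (auto simp: X_def)
  then show ?thesis using fin_X[OF j] by simp
qed

definition V :: "'a l2 \<Rightarrow> ('a \<times> 'j) l2" where
  "V v = (\<Sum>j\<in>J. \<Sum>k\<in>X j. coord (\<xi> j) k *\<^sub>R emb j (rt (\<iota> k) v))"

definition V' :: "('a \<times> 'j) l2 \<Rightarrow> 'a l2" where
  "V' w = (\<Sum>j\<in>J. \<Sum>k\<in>X j. coord (\<xi> j) k *\<^sub>R rt k (col j w))"

lemma bounded_linear_rt: "bounded_linear (rt k)"
  by (rule bounded_linear_intro[where K = 1])
    (simp_all add: linear_add[OF linear_rt] linear_scale[OF linear_rt])

lemma inner_rt_swap: "inner (rt (\<iota> k) u) v = inner u (rt k v)"
proof -
  have "rt (\<iota> k) (rt k v) = v" by (rule l2_eqI) simp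
  then show ?thesis using inner_rt[of "\<iota> k" u "rt k v"] by simp
qed

sublocale regularisation V V' t
proof (rule regularisation.intro)
  show "bounded_linear V" unfolding V_def
    by (intro bounded_linear_sum bounded_linear_const_scaleR bounded_linear_compose[OF bounded_linear_emb]
        bounded_linear_rt)
  show "bounded_linear V'" unfolding V'_def
    by (intro bounded_linear_sum bounded_linear_const_scaleR bounded_linear_compose[OF bounded_linear_rt]
        bounded_linear_col)
  show "inner (V v) w = inner v (V' w)" for v w
    by (simp add: V_def V'_def inner_sum_left inner_sum_right inner_emb inner_rt_swap)
qed (rule t_pos)

lemma lt_rt: "lt g (rt h u) = rt h (lt g u)"
  by (rule l2_eqI) simp

lemma V_lt: "V (lt g v) = Lt g (V v)"
  by (simp add: V_def linear_sum[OF linear_Lt] linear_scale[OF linear_Lt] flip: emb_lt lt_rt)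

lemma V'_Lt: "V' (Lt g w) = lt g (V' w)"
  by (simp add: V'_def linear_sum[OF linear_lt] linear_scale[OF linear_lt] col_Lt lt_rt)

lemma R_lt: "R (lt g v) = lt g (R v)"
proof (rule R_eqI)
  have "B (lt g (R v)) = lt g (B (R v))"
    by (simp add: B_def V_lt V'_Lt linear_add[OF linear_lt] linear_scale[OF linear_lt])
  then show "B (lt g (R v)) = lt g v" by (simp add: B_R)
qed

lemma coord_V: "j \<in> J \<Longrightarrow> coord (V v) (x, j) = inner (lt x (\<xi> j)) v"
proof -
  assume j: "j \<in> J"
  have "coord (V v) (x, j) = (\<Sum>i\<in>J. if i = j then \<Sum>k\<in>X i. coord (\<xi> i) k * coord v (x \<odot> k) else 0)"
    by (auto simp: V_def intro!: sum.cong sum.neutral)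
  also have "\<dots> = (\<Sum>k\<in>X j. coord (\<xi> j) k * coord (lt (\<iota> x) v) k)" using fin_J j by simp
  also have "\<dots> = inner (\<xi> j) (lt (\<iota> x) v)" using j by (simp add: inner_\<xi>)
  also have "\<dots> = inner (lt x (\<xi> j)) v"
  proof -
    have "lt x (lt (\<iota> x) v) = v" by (rule l2_eqI) simp
    then show ?thesis using inner_lt[of x "\<xi> j" "lt (\<iota> x) v"] by simp
  qed
  finally show ?thesis .
qed

lemma V'_basis: "j \<in> J \<Longrightarrow> V' (emb j (basis \<u>)) = \<xi> j"
proof (rule l2_eqI)
  fix x assume j: "j \<in> J"
  have "coord (V' (emb j (basis \<u>))) x
      = (\<Sum>i\<in>J. if i = j then \<Sum>k\<in>X i. coord (\<xi> i) k * coord (basis k) x else 0)"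
    unfolding V'_def coord_sum col_emb
    by (intro sum.cong refl) (auto simp: rt_basis coord_basis linear_0[OF linear_rt] simp del: coord_rt)
  also have "\<dots> = (\<Sum>k\<in>X j. if x = k then coord (\<xi> j) k else 0)"
    using fin_J j by (simp add: coord_basis if_distrib cong: if_cong)
  also have "\<dots> = coord (\<xi> j) x" using fin_X[OF j] by (simp add: X_def)
  finally show "coord (V' (emb j (basis \<u>))) x = coord (\<xi> j) x" .
qed

lemma norm_R_\<xi>_le: "j \<in> J \<Longrightarrow> norm (R (\<xi> j)) \<le> 1 / (2 * sqrt t)"
  using norm_R_adjoint_le[of "emb j (basis \<u>)"] by (simp add: V'_basis)

lemma norm_V_R_\<xi>_le: "j \<in> J \<Longrightarrow> t * norm (V (R (\<xi> j))) \<le> 1"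
  using norm_A_R_adjoint_le[of "emb j (basis \<u>)"] by (simp add: V'_basis)

lemma V_basis: "V (basis \<u>) = (\<Sum>j\<in>J. \<Sum>k\<in>X j. coord (\<xi> j) k *\<^sub>R Lt (\<iota> k) (emb j (basis \<u>)))"
proof -
  have "emb j (rt (\<iota> k) (basis \<u>)) = Lt (\<iota> k) (emb j (basis \<u>))" for j :: 'j and k
  proof -
    have "rt (\<iota> k) (basis \<u>) = lt (\<iota> k) (basis \<u>)"
      by (simp add: rt_basis lt_basis)
    then show ?thesis by (simp add: emb_lt)
  qed
  then show ?thesis by (simp add: V_def)
qed

text \<open>The cyclicity of the trace \<open>S \<mapsto> \<langle>S \<delta>, \<delta>\<rangle>\<close> on operators that commute with left translations, applied to
\<open>1 - R = t R V\<^sup>* V\<close>.\<close>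

lemma trace_defect: "1 - coord (R (basis \<u>)) \<u> = t * (\<Sum>j\<in>J. inner (\<xi> j) (R (\<xi> j)))"
proof -
  have lin: "linear (\<lambda>w. R (V' w))"
    using linear_compose[OF bounded_linear.linear[OF bounded_A'] linear_R] by (simp add: o_def)
  have eq: "basis \<u> = R (basis \<u>) + t *\<^sub>R R (V' (V (basis \<u>)))"
    using R_B[of "basis \<u>"] by (simp add: B_def linear_add[OF linear_R] linear_scale[OF linear_R])
  have "1 = coord (R (basis \<u>)) \<u> + t * coord (R (V' (V (basis \<u>)))) \<u>"
    using arg_cong[OF eq, of "\<lambda>u. coord u \<u>"] unfolding coord_add coord_scaleR
    by (simp only: coord_basis simp_thms if_True)
  moreover have "coord (R (V' (V (basis \<u>)))) \<u> = (\<Sum>j\<in>J. inner (\<xi> j) (R (\<xi> j)))"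
  proof -
    have "R (V' (V (basis \<u>))) = (\<Sum>j\<in>J. \<Sum>k\<in>X j. coord (\<xi> j) k *\<^sub>R R (V' (Lt (\<iota> k) (emb j (basis \<u>)))))"
      unfolding V_basis by (simp add: linear_sum[OF lin] linear_scale[OF lin])
    also have "\<dots> = (\<Sum>j\<in>J. \<Sum>k\<in>X j. coord (\<xi> j) k *\<^sub>R lt (\<iota> k) (R (\<xi> j)))"
      by (simp add: V'_Lt R_lt V'_basis)
    finally show ?thesis by (simp add: inner_\<xi>)
  qed
  ultimately show ?thesis by simp
qed

text \<open>The function \<open>x \<mapsto> t\<langle>x\<xi>\<^sub>j, R\<xi>\<^sub>j\<rangle>\<close> has norm at most \<open>1\<close> and almost the same value at the neutral element
and at every point of \<open>S\<close>.\<close>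

lemma trace_term_le:
  assumes j: "j \<in> J" and S: "finite S" "S \<noteq> {}" and \<beta>: "\<And>s. s \<in> S \<Longrightarrow> norm (\<xi> j - lt s (\<xi> j)) \<le> \<beta>"
  shows "t * inner (\<xi> j) (R (\<xi> j)) \<le> 1 / sqrt (card S) + sqrt t / 2 * \<beta>"
proof -
  have \<beta>0: "0 \<le> \<beta>" using S(2) \<beta> norm_ge_zero order_trans by blast
  define y where "y = t * inner (\<xi> j) (R (\<xi> j)) - sqrt t / 2 * \<beta>"
  have y_le: "y \<le> t * coord (V (R (\<xi> j))) (s, j)" if s: "s \<in> S" for s
  proof -
    have "inner (\<xi> j) (R (\<xi> j)) - inner (lt s (\<xi> j)) (R (\<xi> j)) \<le> \<beta> * (1 / (2 * sqrt t))"
    proof -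
      have "inner (\<xi> j - lt s (\<xi> j)) (R (\<xi> j)) \<le> norm (\<xi> j - lt s (\<xi> j)) * norm (R (\<xi> j))"
        by (rule norm_cauchy_schwarz)
      also have "\<dots> \<le> \<beta> * (1 / (2 * sqrt t))"
        using \<beta>[OF s] norm_R_\<xi>_le[OF j] \<beta>0 by (intro mult_mono) auto
      finally show ?thesis by (simp add: inner_diff_left)
    qed
    then have "t * (inner (\<xi> j) (R (\<xi> j)) - inner (lt s (\<xi> j)) (R (\<xi> j))) \<le> t * (\<beta> * (1 / (2 * sqrt t)))"
      using t_pos by (intro mult_left_mono) auto
    also have "\<dots> = sqrt t / 2 * \<beta>"
      using t_pos real_div_sqrt[of t] by (simp add: field_simps)
    finally show ?thesis by (simp add: y_def coord_V[OF j] algebra_simps)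
  qed
  have "y \<le> 1 / sqrt (card S)"
  proof (rule le_one_over_sqrt_card[OF S, where u = "t *\<^sub>R V (R (\<xi> j))"])
    show "norm (t *\<^sub>R V (R (\<xi> j))) \<le> 1" using norm_V_R_\<xi>_le[OF j] t_pos by simp
  qed (use y_le in \<open>auto intro: inj_onI\<close>)
  then show ?thesis by (simp add: y_def)
qed

text \<open>A vector near a coboundary of \<open>\<xi> j\<close> has a short image, however long \<open>\<xi> j\<close> is.\<close>

lemma norm_R_le_of_near:
  assumes j: "j \<in> J" and near: "norm (u - (\<xi> j - lt a (\<xi> j))) \<le> d"
  shows "norm (R u) \<le> d + 1 / sqrt t"
proof -
  have "R u = R (u - (\<xi> j - lt a (\<xi> j))) + (R (\<xi> j) - lt a (R (\<xi> j)))"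
    by (simp add: linear_diff[OF linear_R] R_lt)
  then have "norm (R u) \<le> norm (R (u - (\<xi> j - lt a (\<xi> j)))) + norm (R (\<xi> j) - lt a (R (\<xi> j)))"
    by (metis norm_triangle_ineq)
  also have "\<dots> \<le> d + (norm (R (\<xi> j)) + norm (lt a (R (\<xi> j))))"
    by (intro add_mono order_trans[OF norm_R_le near] norm_triangle_ineq4)
  also have "\<dots> \<le> d + (1 / (2 * sqrt t) + 1 / (2 * sqrt t))"
    using norm_R_\<xi>_le[OF j] by (simp add: add_mono)
  finally show ?thesis using t_pos by simp
qed

end

context type_group
begin

text \<open>The parameters \<open>S\<close> and \<open>t\<close> are chosen from \<open>\<delta>\<close> and the values of \<open>c\<close> on finitely many elements. For every
finite set \<open>E\<close> the quasi-cocycle is approximated on \<open>E\<close> by coboundaries of finitely supported vectors,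
whose resolvent is a contraction with the required properties on \<open>E\<close>. The bounds do not depend on \<open>E\<close>, so they
pass to a weak limit along an ultrafilter that contains, for every finite set, the set of its supersets.\<close>

theorem bounding_operator:
  fixes A :: "'j \<Rightarrow> 'a set" and c :: "'a \<Rightarrow> 'a l2"
  assumes J: "finite J" and sub: "\<And>j. j \<in> J \<Longrightarrow> type_subgroup (A j)"
    and mean: "\<And>j. j \<in> J \<Longrightarrow> \<exists>\<mu>. left_invariant_mean (group_on (A j)) \<mu>"
    and inf: "\<And>j. j \<in> J \<Longrightarrow> infinite (A j)"
    and defect: "\<And>a b. norm (lt a (c b) - c (a \<odot> b) + c a) \<le> D"
    and \<delta>: "0 < \<delta>"
  obtains Q M where "linear Q" "\<And>v. norm (Q v) \<le> norm v" "\<And>g v. Q (lt g v) = lt g (Q v)"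
    "\<And>j a. j \<in> J \<Longrightarrow> a \<in> A j \<Longrightarrow> norm (Q (c a)) \<le> M" "norm (basis \<u> - Q (basis \<u>)) \<le> \<delta>"
proof -
  define k where "k = real (card J) + 1"
  have k: "1 \<le> k" by (simp add: k_def)
  define \<theta> where "\<theta> = \<delta>\<^sup>2 / (2 * k)"
  have \<theta>: "0 < \<theta>" using \<delta> k by (simp add: \<theta>_def)
  obtain N :: nat where N: "(1 / \<theta>)\<^sup>2 < N" using reals_Archimedean2 by blast
  have "\<exists>S. finite S \<and> card S = Suc N \<and> S \<subseteq> A j" if "j \<in> J" for j
    using infinite_arbitrarily_large[OF inf[OF that]] by metis
  then obtain S where S: "\<And>j. j \<in> J \<Longrightarrow> finite (S j) \<and> card (S j) = Suc N \<and> S j \<subseteq> A j" by metis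
  have S_small: "1 / sqrt (Suc N) \<le> \<theta>"
  proof -
    have "1 / \<theta> \<le> sqrt (Suc N)" using N by (intro real_le_rsqrt) simp
    then show ?thesis using \<theta> by (simp add: field_simps)
  qed
  define \<beta> where "\<beta> = (\<Sum>j\<in>J. \<Sum>s\<in>S j. norm (c s)) + D + 1"
  have D0: "0 \<le> D" using order_trans[OF norm_ge_zero defect] .
  have \<beta>: "norm (c s) + (D + 1) \<le> \<beta>" if "j \<in> J" "s \<in> S j" for j s
  proof -
    have "norm (c s) \<le> (\<Sum>s\<in>S j. norm (c s))" using S that by (intro member_le_sum) auto
    also have "\<dots> \<le> (\<Sum>j\<in>J. \<Sum>s\<in>S j. norm (c s))"
      using J that by (intro member_le_sum) (auto intro: sum_nonneg)
    finally show ?thesis by (simp add: \<beta>_def)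
  qed
  have \<beta>1: "1 \<le> \<beta>" using D0 by (auto simp: \<beta>_def intro!: add_nonneg_nonneg sum_nonneg)
  define t where "t = (2 * \<theta> / \<beta>)\<^sup>2"
  have t: "0 < t" using \<theta> \<beta>1 by (simp add: t_def)
  have t_small: "sqrt t / 2 * \<beta> = \<theta>" using \<theta> \<beta>1 by (simp add: t_def)
  define U0 where "U0 = (\<Union>j\<in>J. S j)"
  have U0: "finite U0" using J S by (simp add: U0_def)
  have "\<exists>\<xi>. fin_supp \<xi> \<and> (\<forall>a\<in>E \<inter> A j. norm (c a - (\<xi> - lt a \<xi>)) \<le> D + 1)"
    if j: "j \<in> J" and E: "finite E" for j E
  proof -
    obtain \<mu> where \<mu>: "left_invariant_mean (group_on (A j)) \<mu>" using mean[OF j] by blast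
    interpret amenable_part mult neutral inver "A j" \<mu>
      by unfold_locales (use sub[OF j] \<mu> in auto)
    show ?thesis
      by (rule quasi_cocycle_approximation[OF inf[OF j] defect]) (use E in auto)
  qed
  then have "\<forall>j E. \<exists>\<xi>. j \<in> J \<longrightarrow> finite E \<longrightarrow>
      fin_supp \<xi> \<and> (\<forall>a\<in>E \<inter> A j. norm (c a - (\<xi> - lt a \<xi>)) \<le> D + 1)" by blast
  then obtain \<xi> where \<xi>: "\<And>j E. j \<in> J \<Longrightarrow> finite E \<Longrightarrow>
      fin_supp (\<xi> j E) \<and> (\<forall>a\<in>E \<inter> A j. norm (c a - (\<xi> j E - lt a (\<xi> j E))) \<le> D + 1)" by metis
  define good where "good E R \<longleftrightarrow> linear R \<and> (\<forall>v. norm (R v) \<le> norm v) \<and> (\<forall>g v. R (lt g v) = lt g (R v)) \<and>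
      (finite E \<longrightarrow> (\<forall>j\<in>J. \<forall>a\<in>E \<inter> A j. norm (R (c a)) \<le> D + 1 + 1 / sqrt t)) \<and>
      (finite E \<longrightarrow> U0 \<subseteq> E \<longrightarrow> norm (basis \<u> - R (basis \<u>)) \<le> \<delta>)"
    for E R
  have "\<exists>R. good E R" for E
  proof (cases "finite E")
    case True
    interpret translate_frame mult neutral inver J "\<lambda>j. \<xi> j E" t
      by unfold_locales (use J \<xi> True t in auto)
    have "norm (basis \<u> - R (basis \<u>)) \<le> \<delta>" if UE: "U0 \<subseteq> E"
    proof -
      have "(norm (basis \<u> - R (basis \<u>)))\<^sup>2 \<le> 1 - coord (R (basis \<u>)) \<u>"
        using norm_diff_R_le[of "basis \<u>"] by (simp add: coord_basis)
      also have "\<dots> = (\<Sum>j\<in>J. t * inner (\<xi> j E) (R (\<xi> j E)))"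
        unfolding trace_defect by (simp add: sum_distrib_left)
      also have "\<dots> \<le> (\<Sum>j\<in>J. \<theta> + \<theta>)"
      proof (rule sum_mono)
        fix j assume j: "j \<in> J"
        have "t * inner (\<xi> j E) (R (\<xi> j E)) \<le> 1 / sqrt (card (S j)) + sqrt t / 2 * \<beta>"
        proof (rule trace_term_le[OF j])
          show "finite (S j)" "S j \<noteq> {}" using S[OF j] by auto
          fix s assume s: "s \<in> S j"
          have "s \<in> E \<inter> A j" using s S[OF j] UE j by (auto simp: U0_def)
          then have "norm (c s - (\<xi> j E - lt s (\<xi> j E))) \<le> D + 1" using \<xi>[OF j True] by blast
          then show "norm (\<xi> j E - lt s (\<xi> j E)) \<le> \<beta>"
            using \<beta>[OF j s] norm_triangle_ineq4[of "c s" "c s - (\<xi> j E - lt s (\<xi> j E))"] by simp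
        qed
        then show "t * inner (\<xi> j E) (R (\<xi> j E)) \<le> \<theta> + \<theta>"
          unfolding t_small using S[OF j] S_small by simp
      qed
      also have "\<dots> \<le> k * (\<theta> + \<theta>)" using \<theta> by (simp add: k_def)
      also have "\<dots> = \<delta>\<^sup>2" using k by (simp add: \<theta>_def)
      finally show ?thesis by (rule power2_le_imp_le) (use \<delta> in simp)
    qed
    moreover have "norm (R (c a)) \<le> D + 1 + 1 / sqrt t" if "j \<in> J" "a \<in> E \<inter> A j" for j a
      by (rule norm_R_le_of_near[OF that(1), where a = a]) (use \<xi>[OF that(1) True] that(2) in blast)
    ultimately have "good E R" using linear_R norm_R_le R_lt by (auto simp: good_def)
    then show ?thesis by blast
  \<comment> \<open>infinite \<open>E\<close> are not seen by the ultrafilter; any contraction will do\<close>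
  qed (intro exI[of _ "\<lambda>v. v"], simp add: linear_ident good_def)
  then obtain R where G: "\<And>E. good E (R E)" by metis
  note G = G[unfolded good_def]
  have R: "linear (R E)" "norm (R E v) \<le> norm v" "R E (lt g v) = lt g (R E v)" for E v g
    using G[of E] by simp_all
  have R_c: "norm (R E (c a)) \<le> D + 1 + 1 / sqrt t" if "finite E" "j \<in> J" "a \<in> E \<inter> A j" for E j a
    using G[THEN conjunct2, THEN conjunct2, THEN conjunct2, THEN conjunct1, of E] that by blast
  have R_basis: "norm (basis \<u> - R E (basis \<u>)) \<le> \<delta>" if "finite E" "U0 \<subseteq> E" for E
    using G[of E] that by simp
  have "finite_subsets_at_top (UNIV :: 'a set) \<noteq> bot" by simp
  then obtain U where U: "U \<le> finite_subsets_at_top (UNIV :: 'a set)" "ultra U"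
    by (rule ultrafilter_exists)
  have nb: "U \<noteq> bot" using U(2) by (simp add: ultra_def)
  have ev: "\<forall>\<^sub>F E in U. finite E \<and> Y \<subseteq> E" if "finite Y" for Y
  proof (rule filter_leD[OF U(1)])
    show "\<forall>\<^sub>F E in finite_subsets_at_top UNIV. finite E \<and> Y \<subseteq> E"
      unfolding eventually_finite_subsets_at_top using that by (intro exI[of _ Y]) simp
  qed
  obtain Q where Q: "linear Q" "\<And>v x. ((\<lambda>E. coord (R E v) x) \<longlongrightarrow> coord (Q v) x) U"
    "\<And>v C. (\<forall>\<^sub>F E in U. norm (R E v) \<le> C) \<Longrightarrow> norm (Q v) \<le> C"
    by (rule weak_limit_operator[OF U(2) R(1,2)]) (erule that)
  show ?thesis
  proof (rule that[of Q "D + 1 + 1 / sqrt t"])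
    show "linear Q" by (rule Q(1))
    show "norm (Q v) \<le> norm v" for v by (rule Q(3)) (simp add: R(2))
    show "Q (lt g v) = lt g (Q v)" for g v
    proof (rule l2_eqI)
      fix x
      show "coord (Q (lt g v)) x = coord (lt g (Q v)) x"
        using tendsto_unique[OF nb Q(2)[of "lt g v" x], of "coord (Q v) (\<iota> g \<odot> x)"] Q(2)[of v "\<iota> g \<odot> x"]
        by (simp add: R(3))
    qed
    show "norm (Q (c a)) \<le> D + 1 + 1 / sqrt t" if "j \<in> J" "a \<in> A j" for j a
    proof (rule Q(3))
      have "\<forall>\<^sub>F E in U. finite E \<and> {a} \<subseteq> E" by (rule ev) simp
      then show "\<forall>\<^sub>F E in U. norm (R E (c a)) \<le> D + 1 + 1 / sqrt t"
        by (rule eventually_mono) (use that in \<open>auto intro: R_c\<close>)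
    qed
    show "norm (basis \<u> - Q (basis \<u>)) \<le> \<delta>"
    proof (rule norm_le_coord)
      fix F :: "'a set" assume F: "finite F"
      show "(\<Sum>x\<in>F. (coord (basis \<u> - Q (basis \<u>)) x)\<^sup>2) \<le> \<delta>\<^sup>2"
      proof (rule tendsto_upperbound[OF _ _ nb])
        show "((\<lambda>E. \<Sum>x\<in>F. (coord (basis \<u> - R E (basis \<u>)) x)\<^sup>2) \<longlongrightarrow>
            (\<Sum>x\<in>F. (coord (basis \<u> - Q (basis \<u>)) x)\<^sup>2)) U"
          unfolding coord_diff by (intro tendsto_intros Q(2))
        show "\<forall>\<^sub>F E in U. (\<Sum>x\<in>F. (coord (basis \<u> - R E (basis \<u>)) x)\<^sup>2) \<le> \<delta>\<^sup>2"
          using ev[OF U0]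
        proof (rule eventually_mono)
          fix E assume "finite E \<and> U0 \<subseteq> E"
          then have "(norm (basis \<u> - R E (basis \<u>)))\<^sup>2 \<le> \<delta>\<^sup>2" using R_basis by (intro power_mono) auto
          then show "(\<Sum>x\<in>F. (coord (basis \<u> - R E (basis \<u>)) x)\<^sup>2) \<le> \<delta>\<^sup>2"
            by (rule order_trans[OF sum_coord_square_le[OF F]])
        qed
      qed
    qed (use \<delta> in simp)
  qed
qed

end

section \<open>Boundedness of quasi-cocycles\<close>

context type_group
begin

text \<open>By equivariance, closeness to the identity at one basis vector is closeness at all of them, and so at
every vector.\<close>

lemma near_identity:
  assumes \<epsilon>: "0 < \<epsilon>"
  obtains \<delta> where "0 < \<delta>"
    "\<And>Q. linear Q \<Longrightarrow> (\<And>v. norm (Q v) \<le> norm v) \<Longrightarrow> (\<And>g v. Q (lt g v) = lt g (Q v)) \<Longrightarrow>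
      norm (basis \<u> - Q (basis \<u>)) \<le> \<delta> \<Longrightarrow> norm (u - Q u) \<le> \<epsilon>"
proof -
  obtain Z where Z: "finite Z" "norm (u - trunc Z u) < \<epsilon> / 3"
    using trunc_approx[of "\<epsilon> / 3" u] \<epsilon> by auto
  define m where "m = (\<Sum>z\<in>Z. \<bar>coord u z\<bar>)"
  have m0: "0 \<le> m" unfolding m_def by (intro sum_nonneg) auto
  define \<delta> where "\<delta> = \<epsilon> / 3 / (m + 1)"
  have \<delta>: "0 < \<delta>" using \<epsilon> m0 by (simp add: \<delta>_def)
  have m\<delta>: "m * \<delta> \<le> \<epsilon> / 3"
  proof -
    have "m * \<delta> = \<epsilon> / 3 * (m / (m + 1))" by (simp add: \<delta>_def)
    also have "\<dots> \<le> \<epsilon> / 3 * 1" using \<epsilon> m0 by (intro mult_left_mono) auto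
    finally show ?thesis by simp
  qed
  show ?thesis
  proof (rule that[OF \<delta>])
    fix Q :: "'a l2 \<Rightarrow> 'a l2"
    assume lin: "linear Q" and contr: "\<And>v. norm (Q v) \<le> norm v" and eqv: "\<And>g v. Q (lt g v) = lt g (Q v)"
      and near: "norm (basis \<u> - Q (basis \<u>)) \<le> \<delta>"
    have nb: "norm (basis z - Q (basis z)) \<le> \<delta>" for z
    proof -
      have "basis z - Q (basis z) = lt z (basis \<u> - Q (basis \<u>))"
        using eqv[of z "basis \<u>"] by (simp add: lt_basis linear_diff[OF linear_lt])
      then show ?thesis using near by simp
    qed
    define w where "w = u - trunc Z u"
    have "trunc Z u - Q (trunc Z u) = (\<Sum>z\<in>Z. coord u z *\<^sub>R (basis z - Q (basis z)))"
      by (simp add: trunc_def linear_sum[OF lin] linear_scale[OF lin] sum_subtractf scaleR_diff_right)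
    then have "norm (trunc Z u - Q (trunc Z u)) \<le> (\<Sum>z\<in>Z. norm (coord u z *\<^sub>R (basis z - Q (basis z))))"
      by (simp only: norm_sum)
    also have "\<dots> \<le> (\<Sum>z\<in>Z. \<bar>coord u z\<bar> * \<delta>)"
      unfolding norm_scaleR by (intro sum_mono mult_left_mono nb) auto
    also have "\<dots> = m * \<delta>" by (simp add: m_def sum_distrib_right)
    finally have 1: "norm (trunc Z u - Q (trunc Z u)) \<le> \<epsilon> / 3" using m\<delta> by linarith
    have "norm (w - Q w) \<le> norm w + norm (Q w)" by (rule norm_triangle_ineq4)
    moreover have "norm w < \<epsilon> / 3" unfolding w_def by (rule Z(2))
    ultimately have 2: "norm (w - Q w) \<le> \<epsilon> / 3 + \<epsilon> / 3" using contr[of w] by linarith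
    have "u - Q u = (trunc Z u - Q (trunc Z u)) + (w - Q w)"
      by (simp add: w_def linear_diff[OF lin])
    then have "norm (u - Q u) \<le> norm (trunc Z u - Q (trunc Z u)) + norm (w - Q w)"
      by (metis norm_triangle_ineq)
    then show "norm (u - Q u) \<le> \<epsilon>" using 1 2 by linarith
  qed
qed

lemma product_bound:
  fixes b :: "'a \<Rightarrow> 'h :: real_normed_vector" and M D :: real
  assumes iso: "\<And>g v. norm (\<pi> g v) = norm v"
    and defect: "\<And>g h. norm (\<pi> g (b h) - b (g \<odot> h) + b g) \<le> D"
    and gen: "\<And>x. x \<in> X \<Longrightarrow> norm (b x) \<le> M"
  shows "set xs \<subseteq> X \<Longrightarrow> norm (b (foldr mult xs \<u>)) \<le> length xs * (M + D) + norm (b \<u>)"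
proof (induction xs)
  case (Cons x xs)
  let ?h = "foldr mult xs \<u>"
  have eq: "b (x \<odot> ?h) = (\<pi> x (b ?h) + b x) - (\<pi> x (b ?h) - b (x \<odot> ?h) + b x)" by simp
  have "norm (b (x \<odot> ?h)) \<le> norm (\<pi> x (b ?h) + b x) + norm (\<pi> x (b ?h) - b (x \<odot> ?h) + b x)"
    by (subst eq) (rule norm_triangle_ineq4)
  also have "\<dots> \<le> (norm (b ?h) + norm (b x)) + D"
    using norm_triangle_ineq[of "\<pi> x (b ?h)" "b x"] iso[of x "b ?h"] defect[of x ?h] by linarith
  also have "\<dots> \<le> ((length xs * (M + D) + norm (b \<u>)) + M) + D"
    using Cons gen[of x] by (intro add_mono) auto
  finally show ?case by (simp add: algebra_simps)
qed simp

text \<open>Given \<open>g0\<close>, finitely many columns carry almost all of \<open>c g0\<close>. Applying a bounding operator in each of these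
columns and \<open>0\<close> in the others yields an equivariant contraction \<open>T\<close> that hardly moves \<open>c g0\<close> and makes \<open>c\<close> bounded on
all \<open>A j\<close>, hence everywhere by bounded generation. The uniform bound for \<open>T \<circ> c\<close> does not depend on \<open>g0\<close>.\<close>

theorem quasi_cocycle_bounded:
  fixes A :: "'j \<Rightarrow> 'a set" and c :: "'a \<Rightarrow> ('a \<times> 'i) l2"
  assumes J: "finite J" and sub: "\<And>j. j \<in> J \<Longrightarrow> type_subgroup (A j)"
    and mean: "\<And>j. j \<in> J \<Longrightarrow> \<exists>\<mu>. left_invariant_mean (group_on (A j)) \<mu>"
    and defect: "\<And>a b. norm (Lt a (c b) - c (a \<odot> b) + c a) \<le> D"
    and generated: "\<And>g. \<exists>xs. length xs < n \<and> set xs \<subseteq> (\<Union>j\<in>J. A j) \<and> g = foldr mult xs \<u>"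
    and gap: "\<And>\<xi> :: ('a \<times> 'i) l2. norm \<xi> \<le> \<kappa> * (\<Sum>s\<in>S. norm (Lt s \<xi> - \<xi>))" and \<kappa>: "0 \<le> \<kappa>"
  shows "bounded (range c)"
proof -
  define P where "P = 1 + 2 * \<kappa> * card S"
  define \<beta> where "\<beta> = (\<Sum>s\<in>S. norm (c s))"
  define C where "C = 2 * (P * (1 + D)\<^sup>2 + P * (4 * P * D + 1) + 2 * \<kappa> * \<beta>)"
  have D0: "0 \<le> D" using order_trans[OF norm_ge_zero defect] .
  have "norm (c g0) \<le> C + 2" for g0
  proof -
    obtain X where X: "finite X" "norm (c g0 - trunc X (c g0)) < 1"
      using trunc_approx[of 1 "c g0"] by auto
    define I where "I = snd ` X"
    have I: "finite I" using X by (simp add: I_def)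
    define \<epsilon> where "\<epsilon> = 1 / (real (card I) + 1)"
    have \<epsilon>: "0 < \<epsilon>" by (simp add: \<epsilon>_def add_nonneg_pos)
    define J' where "J' = {j \<in> J. infinite (A j)}"
    define good where "good i Q M \<longleftrightarrow> linear Q \<and> (\<forall>v. norm (Q v) \<le> norm v) \<and> (\<forall>g v. Q (lt g v) = lt g (Q v))
      \<and> (\<forall>j\<in>J'. \<forall>a\<in>A j. norm (Q (col i (c a))) \<le> M)
      \<and> norm (col i (c g0) - Q (col i (c g0))) \<le> \<epsilon>" for i Q and M :: real
    have "\<exists>Q M. good i Q M" for i
    proof -
      obtain \<delta> where \<delta>: "0 < \<delta>"
        "\<And>Q. linear Q \<Longrightarrow> (\<And>v. norm (Q v) \<le> norm v) \<Longrightarrow> (\<And>g v. Q (lt g v) = lt g (Q v)) \<Longrightarrow>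
          norm (basis \<u> - Q (basis \<u>)) \<le> \<delta> \<Longrightarrow> norm (col i (c g0) - Q (col i (c g0))) \<le> \<epsilon>"
        by (rule near_identity[OF \<epsilon>, of "col i (c g0)"]) blast
      have "norm (lt a (col i (c b)) - col i (c (a \<odot> b)) + col i (c a)) \<le> D" for a b
      proof -
        have "lt a (col i (c b)) - col i (c (a \<odot> b)) + col i (c a) = col i (Lt a (c b) - c (a \<odot> b) + c a)"
          by (simp add: linear_add[OF linear_col] linear_diff[OF linear_col] col_Lt)
        then show ?thesis using order_trans[OF norm_col_le defect] by simp
      qed
      note d = this
      obtain Q M where "linear Q" "\<And>v. norm (Q v) \<le> norm v" "\<And>g v. Q (lt g v) = lt g (Q v)"
        "\<And>j a. j \<in> J' \<Longrightarrow> a \<in> A j \<Longrightarrow> norm (Q (col i (c a))) \<le> M" "norm (basis \<u> - Q (basis \<u>)) \<le> \<delta>"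
      proof (rule bounding_operator[of J' A "\<lambda>a. col i (c a)" D \<delta>])
        show "finite J'" using J by (simp add: J'_def)
      qed (use sub mean d \<delta>(1) in \<open>auto simp: J'_def\<close>)
      then have "good i Q M" using \<delta>(2)[of Q] by (auto simp: good_def)
      then show ?thesis by blast
    qed
    then have "\<forall>i. \<exists>Q M. good i Q M" by blast
    then obtain Q M where good: "\<And>i. good i (Q i) (M i)" by metis
    have lin: "linear (Q i)" and contr: "norm (Q i v) \<le> norm v" and eqv: "Q i (lt g v) = lt g (Q i v)"
      and near: "norm (col i (c g0) - Q i (col i (c g0))) \<le> \<epsilon>" for i v g
      using good[of i] by (simp_all add: good_def)
    have QM: "norm (Q i (col i (c a))) \<le> M i" if "j \<in> J'" "a \<in> A j" for i j a
      using good[of i] that unfolding good_def by blast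
    define T where "T w = (\<Sum>i\<in>I. emb i (Q i (col i w)))" for w
    have linT: "linear T"
      unfolding T_def
      by (intro linear_compose_sum ballI linear_compose[OF _ linear_emb, unfolded o_def]
          linear_compose[OF linear_col lin, unfolded o_def])
    have T_contr: "norm (T w) \<le> norm w" for w
    proof (rule power2_le_imp_le)
      have "(norm (T w))\<^sup>2 = (\<Sum>i\<in>I. (norm (Q i (col i w)))\<^sup>2)" unfolding T_def by (rule norm_sum_emb[OF I])
      also have "\<dots> \<le> (\<Sum>i\<in>I. (norm (col i w))\<^sup>2)" by (intro sum_mono power_mono contr) auto
      also have "\<dots> \<le> (norm w)\<^sup>2" by (rule sum_norm_col_le[OF I])
      finally show "(norm (T w))\<^sup>2 \<le> (norm w)\<^sup>2" .
    qed simp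
    have T_Lt: "T (Lt g w) = Lt g (T w)" for g w
      by (simp add: T_def col_Lt eqv emb_lt linear_sum[OF linear_Lt])
    define b where "b g = T (c g)" for g
    have b_defect: "norm (Lt g (b h) - b (g \<odot> h) + b g) \<le> D" for g h
    proof -
      have "Lt g (b h) - b (g \<odot> h) + b g = T (Lt g (c h) - c (g \<odot> h) + c g)"
        by (simp add: b_def linear_add[OF linT] linear_diff[OF linT] T_Lt)
      then show ?thesis using order_trans[OF T_contr defect] by simp
    qed
    define M1 where "M1 = (\<Sum>i\<in>I. \<bar>M i\<bar>)"
    define M2 where "M2 = (\<Sum>j\<in>J. \<Sum>a\<in>A j. norm (c a))"
    have M0: "0 \<le> M1" "0 \<le> M2" unfolding M1_def M2_def by (intro sum_nonneg; simp)+
    have b_gen: "norm (b a) \<le> M1 + M2" if a: "a \<in> (\<Union>j\<in>J. A j)" for a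
    proof -
      obtain j where j: "j \<in> J" "a \<in> A j" using a by blast
      show ?thesis
      proof (cases "infinite (A j)")
        case True
        then have "j \<in> J'" using j by (simp add: J'_def)
        have "norm (b a) \<le> (\<Sum>i\<in>I. norm (Q i (col i (c a))))"
          unfolding b_def T_def by (rule sum_norm_le) simp
        also have "\<dots> \<le> M1"
          unfolding M1_def
        proof (rule sum_mono)
          fix i
          show "norm (Q i (col i (c a))) \<le> \<bar>M i\<bar>"
            using QM[OF \<open>j \<in> J'\<close> j(2), of i] by linarith
        qed
        finally show ?thesis using M0 by linarith
      next
        case False
        have "norm (b a) \<le> norm (c a)" unfolding b_def by (rule T_contr)
        also have "\<dots> \<le> (\<Sum>a\<in>A j. norm (c a))" using False j(2) by (intro member_le_sum) auto
        also have "\<dots> \<le> M2" unfolding M2_def using J j(1) by (intro member_le_sum) (auto intro: sum_nonneg)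
        finally show ?thesis using M0 by linarith
      qed
    qed
    have "norm (b g) \<le> n * (M1 + M2 + D) + norm (b \<u>)" for g
    proof -
      obtain xs where xs: "length xs < n" "set xs \<subseteq> (\<Union>j\<in>J. A j)" "g = foldr mult xs \<u>"
        using generated by blast
      have "norm (b g) \<le> length xs * (M1 + M2 + D) + norm (b \<u>)"
        unfolding xs(3) using product_bound[OF norm_Lt b_defect b_gen xs(2)] by simp
      also have "\<dots> \<le> n * (M1 + M2 + D) + norm (b \<u>)"
        using xs(1) M0 D0 by (intro add_right_mono mult_right_mono) auto
      finally show ?thesis .
    qed
    then have b_bounded: "bounded (range b)" by (auto simp: bounded_iff)
    have "norm (b g0) \<le> C"
      unfolding C_def
    proof (rule bounded_quasi_cocycle_uniform_bound[where \<pi> = Lt and m = mult and b = b and S = S])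
      show "norm (Lt g u - Lt g v) = norm (u - v)" for g and u v :: "('a \<times> 'i) l2"
        using norm_Lt[of g "u - v"] by (simp add: linear_diff[OF linear_Lt])
      show "Lt g 0 = (0 :: ('a \<times> 'i) l2)" for g by (rule linear_0[OF linear_Lt])
      show "\<exists>h. x = g \<odot> h" for g x by (rule exI[of _ "\<iota> g \<odot> x"]) simp
      show "(\<Sum>s\<in>S. norm (b s)) \<le> \<beta>" unfolding \<beta>_def b_def by (intro sum_mono T_contr)
    qed (use b_defect b_bounded gap \<kappa> P_def in auto)
    moreover have "norm (c g0 - b g0) \<le> 2"
    proof -
      define w where "w = (\<Sum>i\<in>I. emb i (col i (c g0)))"
      have "norm (c g0 - w) \<le> norm (c g0 - trunc X (c g0))"
      proof (rule norm_mono_coord)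
        fix p
        have "coord w p = (if snd p \<in> I then coord (c g0) p else 0)"
          using I by (simp add: w_def)
        then show "\<bar>coord (c g0 - w) p\<bar> \<le> \<bar>coord (c g0 - trunc X (c g0)) p\<bar>"
          using X(1) by (auto simp: coord_trunc I_def)
      qed
      then have 1: "norm (c g0 - w) \<le> 1" using X(2) by linarith
      have "w - b g0 = (\<Sum>i\<in>I. emb i (col i (c g0) - Q i (col i (c g0))))"
        by (simp add: w_def b_def T_def linear_diff[OF linear_emb] sum_subtractf)
      moreover have "norm (\<Sum>i\<in>I. emb i (col i (c g0) - Q i (col i (c g0)))) \<le> (\<Sum>i\<in>I. \<epsilon>)"
        by (rule sum_norm_le) (simp add: near)
      ultimately have "norm (w - b g0) \<le> (\<Sum>i\<in>I. \<epsilon>)" by (simp only:)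
      also have "\<dots> \<le> 1" by (simp add: \<epsilon>_def)
      finally have 2: "norm (w - b g0) \<le> 1" .
      have "c g0 - b g0 = (c g0 - w) + (w - b g0)" by simp
      then have "norm (c g0 - b g0) \<le> norm (c g0 - w) + norm (w - b g0)" by (metis norm_triangle_ineq)
      then show ?thesis using 1 2 by linarith
    qed
    ultimately show ?thesis using norm_triangle_sub[of "c g0" "b g0"] by linarith
  qed
  then show ?thesis by (auto simp: bounded_iff)
qed

end

section \<open>The spectral gap of a non-amenable group\<close>

definition scale_by :: "('a \<Rightarrow> real) \<Rightarrow> ('a \<times> 'i) l2 \<Rightarrow> ('a \<times> 'i) l2" where
  "scale_by f u = l2_of (\<lambda>p. f (fst p) * coord u p)"

lemma
  assumes f: "\<And>x. \<bar>f x\<bar> \<le> C"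
  shows coord_scale_by: "coord (scale_by f u) p = f (fst p) * coord u p"
    and norm_scale_by: "norm (scale_by f u) \<le> C * norm u"
proof -
  have C0: "0 \<le> C" using order_trans[OF abs_ge_zero f] .
  have 1: "(\<Sum>p\<in>P. (f (fst p) * coord u p)\<^sup>2) \<le> (C * norm u)\<^sup>2" if P: "finite P" for P
  proof -
    have "(\<Sum>p\<in>P. (f (fst p) * coord u p)\<^sup>2) \<le> (\<Sum>p\<in>P. C\<^sup>2 * (coord u p)\<^sup>2)"
      unfolding power_mult_distrib
      using f C0 by (intro sum_mono mult_right_mono) (auto simp: abs_le_square_iff[symmetric])
    also have "\<dots> \<le> C\<^sup>2 * (norm u)\<^sup>2"
      unfolding sum_distrib_left[symmetric] by (intro mult_left_mono sum_coord_square_le P) auto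
    finally show ?thesis by (simp add: power_mult_distrib)
  qed
  show "coord (scale_by f u) p = f (fst p) * coord u p"
    unfolding scale_by_def by (subst coord_l2_of_bounded[OF 1]) auto
  show "norm (scale_by f u) \<le> C * norm u"
    unfolding scale_by_def by (rule norm_l2_of_bounded[OF 1]) (use C0 in auto)
qed

context type_group
begin

text \<open>Without a gap there are unit vectors \<open>x S\<close> that every element of the group eventually moves by arbitrarily little.
The squares of their coordinates, summed over the second index, are probability measures on the group that are
asymptotically invariant, and their limit along an ultrafilter is an invariant mean.\<close>

theorem spectral_gap:
  assumes inf: "infinite (UNIV :: 'a set)"
    and no_mean: "\<nexists>\<mu>. left_invariant_mean (group_on UNIV) \<mu>"
  obtains S \<kappa> where "0 \<le> \<kappa>" "\<And>\<xi> :: ('a \<times> 'i) l2. norm \<xi> \<le> \<kappa> * (\<Sum>s\<in>S. norm (Lt s \<xi> - \<xi>))"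
proof (rule ccontr)
  assume neg: "\<not> thesis"
  \<comment> \<open>the factor \<open>card S\<close> tends to infinity along the finite subsets of an infinite group\<close>
  have "\<exists>x :: ('a \<times> 'i) l2. norm x = 1 \<and> real (card S) * (\<Sum>s\<in>S. norm (Lt s x - x)) < 1" for S
  proof -
    have "\<not> (\<forall>\<xi> :: ('a \<times> 'i) l2. norm \<xi> \<le> real (card S) * (\<Sum>s\<in>S. norm (Lt s \<xi> - \<xi>)))"
    proof
      assume "\<forall>\<xi> :: ('a \<times> 'i) l2. norm \<xi> \<le> real (card S) * (\<Sum>s\<in>S. norm (Lt s \<xi> - \<xi>))"
      then show False using neg that[of "real (card S)" S] by simp
    qed
    then obtain \<xi> :: "('a \<times> 'i) l2" where \<xi>: "real (card S) * (\<Sum>s\<in>S. norm (Lt s \<xi> - \<xi>)) < norm \<xi>"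
      by (auto simp: not_le)
    then have pos: "0 < norm \<xi>"
      by (rule le_less_trans[rotated]) (auto intro!: mult_nonneg_nonneg sum_nonneg)
    define x where "x = (1 / norm \<xi>) *\<^sub>R \<xi>"
    have "Lt s x - x = (1 / norm \<xi>) *\<^sub>R (Lt s \<xi> - \<xi>)" for s
      by (simp add: x_def linear_scale[OF linear_Lt] scaleR_diff_right)
    then have "(\<Sum>s\<in>S. norm (Lt s x - x)) = (\<Sum>s\<in>S. norm (Lt s \<xi> - \<xi>)) / norm \<xi>"
      by (simp add: sum_divide_distrib)
    then have "real (card S) * (\<Sum>s\<in>S. norm (Lt s x - x)) < 1" using \<xi> pos by simp
    moreover have "norm x = 1" using pos by (simp add: x_def)
    ultimately show ?thesis by blast
  qed
  then obtain x :: "'a set \<Rightarrow> ('a \<times> 'i) l2" where x: "\<And>S. norm (x S) = 1"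
    "\<And>S. real (card S) * (\<Sum>s\<in>S. norm (Lt s (x S) - x S)) < 1" by metis
  have "finite_subsets_at_top (UNIV :: 'a set) \<noteq> bot" by simp
  then obtain U where U: "U \<le> finite_subsets_at_top (UNIV :: 'a set)" "ultra U"
    by (rule ultrafilter_exists)
  have nb: "U \<noteq> bot" using U(2) by (simp add: ultra_def)
  have ev: "\<forall>\<^sub>F E in U. finite E \<and> Y \<subseteq> E" if "finite Y" for Y
  proof (rule filter_leD[OF U(1)])
    show "\<forall>\<^sub>F E in finite_subsets_at_top UNIV. finite E \<and> Y \<subseteq> E"
      unfolding eventually_finite_subsets_at_top using that by (intro exI[of _ Y]) simp
  qed
  define m where "m S f = inner (scale_by f (x S)) (x S)" for S f
  define \<mu> where "\<mu> f = Lim U (\<lambda>S. m S f)" for f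
  have bd: "bounded_funs (group_on UNIV) = {f. \<exists>C. \<forall>x. \<bar>f x\<bar> \<le> C}"
    by (auto simp: bounded_funs_def bounded_iff)
  have lim: "((\<lambda>S. m S f) \<longlongrightarrow> \<mu> f) U" if f: "\<And>x. \<bar>f x\<bar> \<le> C" for f C
    unfolding \<mu>_def
  proof (rule ultra_limit[OF U(2)], intro always_eventually allI)
    fix S
    have "\<bar>m S f\<bar> \<le> norm (scale_by f (x S)) * norm (x S)" unfolding m_def by (rule Cauchy_Schwarz_ineq2)
    also have "\<dots> \<le> C" using norm_scale_by[OF f, where u = "x S"] by (simp add: x)
    finally show "\<bar>m S f\<bar> \<le> C" .
  qed
  have \<mu>_eqI: "\<mu> f = l" if "\<And>x. \<bar>f x\<bar> \<le> C" "((\<lambda>S. m S f) \<longlongrightarrow> l) U" for f C l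
    using tendsto_unique[OF nb lim[OF that(1)] that(2)] .
  have "left_invariant_mean (group_on UNIV) \<mu>"
    unfolding left_invariant_mean_def bd
  proof (intro conjI ballI allI impI)
    fix f f' :: "'a \<Rightarrow> real" assume "f \<in> {f. \<exists>C. \<forall>x. \<bar>f x\<bar> \<le> C}" "f' \<in> {f. \<exists>C. \<forall>x. \<bar>f x\<bar> \<le> C}"
    then obtain C C' where C: "\<And>x. \<bar>f x\<bar> \<le> C" "\<And>x. \<bar>f' x\<bar> \<le> C'" by blast
    have C2: "\<bar>f x + f' x\<bar> \<le> C + C'" for x using C(1)[of x] C(2)[of x] by linarith
    have "m S (\<lambda>x. f x + f' x) = m S f + m S f'" for S
    proof -
      have "scale_by (\<lambda>x. f x + f' x) (x S) = scale_by f (x S) + scale_by f' (x S)"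
        by (rule l2_eqI)
          (simp add: coord_scale_by[OF C(1)] coord_scale_by[OF C(2)] coord_scale_by[OF C2] distrib_right)
      then show ?thesis by (simp add: m_def inner_add_left)
    qed
    then show "\<mu> (\<lambda>x. f x + f' x) = \<mu> f + \<mu> f'"
      by (intro \<mu>_eqI[OF C2]) (simp add: tendsto_add lim[OF C(1)] lim[OF C(2)])
  next
    fix a and f :: "'a \<Rightarrow> real" assume "f \<in> {f. \<exists>C. \<forall>x. \<bar>f x\<bar> \<le> C}"
    then obtain C where C: "\<And>x. \<bar>f x\<bar> \<le> C" by blast
    have C2: "\<bar>a * f x\<bar> \<le> \<bar>a\<bar> * C" for x unfolding abs_mult using C by (intro mult_left_mono) auto
    have "m S (\<lambda>x. a * f x) = a * m S f" for S
    proof -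
      have "scale_by (\<lambda>x. a * f x) (x S) = a *\<^sub>R scale_by f (x S)"
        by (rule l2_eqI) (simp add: coord_scale_by[OF C] coord_scale_by[OF C2])
      then show ?thesis by (simp add: m_def)
    qed
    then show "\<mu> (\<lambda>x. a * f x) = a * \<mu> f"
      by (intro \<mu>_eqI[OF C2]) (simp add: tendsto_mult_left lim[OF C])
  next
    fix f :: "'a \<Rightarrow> real" assume "f \<in> {f. \<exists>C. \<forall>x. \<bar>f x\<bar> \<le> C}" and f0: "\<forall>x\<in>carrier (group_on UNIV). 0 \<le> f x"
    then obtain C where C: "\<And>x. \<bar>f x\<bar> \<le> C" by blast
    have "0 \<le> m S f" for S
      unfolding m_def inner_coord coord_scale_by[OF C]
      by (intro infsum_nonneg) (use f0 in \<open>simp add: mult.assoc\<close>)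
    then show "0 \<le> \<mu> f"
      by (intro tendsto_lowerbound[OF lim[OF C] _ nb]) auto
  next
    have C: "\<bar>1 :: real\<bar> \<le> 1" by simp
    have "scale_by (\<lambda>_. 1) u = u" for u :: "('a \<times> 'i) l2"
      by (rule l2_eqI) (simp add: coord_scale_by[of "\<lambda>_. 1", OF C])
    then have "m S (\<lambda>_. 1) = 1" for S using x(1)[of S] by (simp add: m_def norm_eq_sqrt_inner)
    then show "\<mu> (\<lambda>_. 1) = 1" by (intro \<mu>_eqI[of "\<lambda>_. 1", OF C]) simp
  next
    fix g and f :: "'a \<Rightarrow> real" assume "f \<in> {f. \<exists>C. \<forall>x. \<bar>f x\<bar> \<le> C}"
    then obtain C where C: "\<And>x. \<bar>f x\<bar> \<le> C" by blast
    have C0: "0 \<le> C" using order_trans[OF abs_ge_zero C] .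
    have C2: "\<bar>f (g \<odot> x)\<bar> \<le> C" for x by (rule C)
    have shift: "m S (\<lambda>x. f (g \<odot> x)) = inner (scale_by f (Lt g (x S))) (Lt g (x S))" for S
    proof -
      have "scale_by f (Lt g (x S)) = Lt g (scale_by (\<lambda>x. f (g \<odot> x)) (x S))"
        by (rule l2_eqI) (auto simp: coord_scale_by[OF C] coord_scale_by[OF C2])
      moreover have "inner (Lt g u) (Lt g v) = inner u v" for u v :: "('a \<times> 'i) l2"
        unfolding Lt_def by (rule inner_permute[OF bij_Lt])
      ultimately show ?thesis by (simp add: m_def)
    qed
    have diff: "\<bar>m S (\<lambda>x. f (g \<odot> x)) - m S f\<bar> \<le> 2 * C * norm (Lt g (x S) - x S)" for S
    proof -
      let ?y = "Lt g (x S)"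
      have "scale_by f (?y - x S) = scale_by f ?y - scale_by f (x S)"
        by (rule l2_eqI) (simp add: coord_scale_by[OF C] right_diff_distrib)
      then have "m S (\<lambda>x. f (g \<odot> x)) - m S f = inner (scale_by f (?y - x S)) ?y + inner (scale_by f (x S)) (?y - x S)"
        by (simp add: shift m_def inner_diff_left inner_diff_right)
      moreover have "\<bar>inner (scale_by f (?y - x S)) ?y\<bar> \<le> (C * norm (?y - x S)) * 1"
        by (rule order_trans[OF Cauchy_Schwarz_ineq2]) (use norm_scale_by[OF C] x(1) in simp)
      moreover have "\<bar>inner (scale_by f (x S)) (?y - x S)\<bar> \<le> (C * 1) * norm (?y - x S)"
        by (rule order_trans[OF Cauchy_Schwarz_ineq2], rule mult_right_mono)
          (use norm_scale_by[OF C, where u = "x S"] x(1) in simp_all)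
      ultimately show ?thesis by linarith
    qed
    have "((\<lambda>S. m S (\<lambda>x. f (g \<odot> x)) - m S f) \<longlongrightarrow> 0) U"
    proof (rule tendstoI)
      fix e :: real assume e: "0 < e"
      obtain N :: nat where N: "2 * C / e < N" using reals_Archimedean2 by blast
      obtain Y :: "'a set" where Y: "finite Y" "card Y = Suc N"
        using infinite_arbitrarily_large[OF inf] by blast
      have "\<forall>\<^sub>F S in U. finite S \<and> insert g Y \<subseteq> S" by (rule ev) (use Y in simp)
      then show "\<forall>\<^sub>F S in U. dist (m S (\<lambda>x. f (g \<odot> x)) - m S f) 0 < e"
      proof (rule eventually_mono)
        fix S assume S: "finite S \<and> insert g Y \<subseteq> S"
        have cS: "real N + 1 \<le> card S" using card_mono[of S Y] S Y by simp
        let ?d = "norm (Lt g (x S) - x S)"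
        have "?d \<le> (\<Sum>s\<in>S. norm (Lt s (x S) - x S))" using S by (intro member_le_sum) auto
        then have "real (card S) * ?d \<le> real (card S) * (\<Sum>s\<in>S. norm (Lt s (x S) - x S))"
          by (intro mult_left_mono) auto
        then have 1: "real (card S) * ?d < 1" using x(2)[of S] by linarith
        have "(real N + 1) * ?d \<le> real (card S) * ?d" using cS by (intro mult_right_mono) auto
        then have 2: "(real N + 1) * ?d < 1" using 1 by linarith
        have "2 * C < e * (real N + 1)" using N e by (simp add: field_simps)
        then have "2 * C * ?d \<le> e * ((real N + 1) * ?d)"
          unfolding mult.assoc[symmetric] by (intro mult_right_mono) auto
        also have "\<dots> < e * 1" using 2 e by (intro mult_strict_left_mono)
        finally show "dist (m S (\<lambda>x. f (g \<odot> x)) - m S f) 0 < e"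
          using diff[of S] by (simp add: dist_real_def)
      qed
    qed
    from tendsto_add[OF this lim[of f C, OF C]]
    have "((\<lambda>S. m S (\<lambda>x. f (g \<odot> x))) \<longlongrightarrow> \<mu> f) U" by simp
    then show "\<mu> (\<lambda>x. f (g \<otimes>\<^bsub>group_on UNIV\<^esub> x)) = \<mu> f" by (simp add: \<mu>_eqI[of "\<lambda>x. f (g \<odot> x)" C, OF C2])
  qed
  then show False using no_mean by blast
qed

end

section \<open>Coordinates for the Hilbert space over a subgroup\<close>

lemma ell2_add:
  assumes "f \<in> ell2 G" "g \<in> ell2 G"
  shows "f + g \<in> ell2 G"
    and "(ell2_norm G (f + g))\<^sup>2 \<le> 2 * (ell2_norm G f)\<^sup>2 + 2 * (ell2_norm G g)\<^sup>2"
proof -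
  have s: "(\<lambda>x. (cmod (f x))\<^sup>2) summable_on carrier G" "(\<lambda>x. (cmod (g x))\<^sup>2) summable_on carrier G"
    using assms by (auto simp: ell2_def)
  have le: "(cmod ((f + g) x))\<^sup>2 \<le> 2 * (cmod (f x))\<^sup>2 + 2 * (cmod (g x))\<^sup>2" for x
  proof -
    have "(cmod ((f + g) x))\<^sup>2 \<le> (cmod (f x) + cmod (g x))\<^sup>2"
      by (intro power_mono) (auto simp: norm_triangle_ineq)
    also have "\<dots> \<le> 2 * (cmod (f x))\<^sup>2 + 2 * (cmod (g x))\<^sup>2"
      using sum_squares_bound[of "cmod (f x)" "cmod (g x)"] by (simp add: power2_sum)
    finally show ?thesis .
  qed
  have s2: "(\<lambda>x. 2 * (cmod (f x))\<^sup>2 + 2 * (cmod (g x))\<^sup>2) summable_on carrier G"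
    by (intro summable_on_add summable_on_cmult_right s)
  have s3: "(\<lambda>x. (cmod ((f + g) x))\<^sup>2) summable_on carrier G"
    by (rule summable_on_comparison_test[OF s2]) (use le in auto)
  then show "f + g \<in> ell2 G" using assms by (simp add: ell2_def)
  have "(ell2_norm G (f + g))\<^sup>2 = (\<Sum>\<^sub>\<infinity>x\<in>carrier G. (cmod ((f + g) x))\<^sup>2)"
    by (simp add: ell2_norm_def infsum_nonneg)
  also have "\<dots> \<le> (\<Sum>\<^sub>\<infinity>x\<in>carrier G. 2 * (cmod (f x))\<^sup>2 + 2 * (cmod (g x))\<^sup>2)"
    by (intro infsum_mono s2 s3 le)
  also have "\<dots> = 2 * (ell2_norm G f)\<^sup>2 + 2 * (ell2_norm G g)\<^sup>2"
    by (simp add: ell2_norm_def infsum_nonneg infsum_add summable_on_cmult_right s infsum_cmult_right')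
  finally show "(ell2_norm G (f + g))\<^sup>2 \<le> 2 * (ell2_norm G f)\<^sup>2 + 2 * (ell2_norm G g)\<^sup>2" .
qed

lemma ell2_sum_add:
  assumes "F \<in> ell2_sum G" "F' \<in> ell2_sum G"
  shows "F + F' \<in> ell2_sum G"
proof -
  have F: "F n \<in> ell2 G" "F' n \<in> ell2 G" for n using assms by (auto simp: ell2_sum_def)
  have s: "summable (\<lambda>n. 2 * (ell2_norm G (F n))\<^sup>2 + 2 * (ell2_norm G (F' n))\<^sup>2)"
    using assms by (intro summable_add summable_mult) (auto simp: ell2_sum_def)
  have "summable (\<lambda>n. (ell2_norm G ((F + F') n))\<^sup>2)"
    by (rule summable_comparison_test'[OF s, of 0]) (use ell2_add(2)[OF F] in simp)
  then show ?thesis using ell2_add(1)[OF F] by (simp add: ell2_sum_def)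
qed

lemma ell2_sum_uminus: "F \<in> ell2_sum G \<Longrightarrow> - F \<in> ell2_sum G"
  by (simp add: ell2_sum_def ell2_def ell2_norm_def)

lemma ell2_sum_diff: "F \<in> ell2_sum G \<Longrightarrow> F' \<in> ell2_sum G \<Longrightarrow> F - F' \<in> ell2_sum G"
  using ell2_sum_add[of F G "- F'"] ell2_sum_uminus[of F' G] by simp

definition part :: "bool \<Rightarrow> complex \<Rightarrow> real" where "part \<beta> z = (if \<beta> then Re z else Im z)"

lemma has_sum_ell2_sum:
  assumes F: "F \<in> ell2_sum G"
  shows "((\<lambda>((j, x), \<beta>). (part \<beta> (F j x))\<^sup>2) has_sum (ell2_sum_norm G F)\<^sup>2) ((UNIV \<times> carrier G) \<times> UNIV)"
proof -
  have Fj: "F j \<in> ell2 G" for j using F by (simp add: ell2_sum_def)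
  have 1: "((\<lambda>x. (cmod (F j x))\<^sup>2) has_sum (ell2_norm G (F j))\<^sup>2) (carrier G)" for j
    using Fj[of j] by (simp add: ell2_norm_def infsum_nonneg ell2_def)
  have sm: "summable (\<lambda>j. (ell2_norm G (F j))\<^sup>2)" using F by (simp add: ell2_sum_def)
  have "(\<lambda>j. (ell2_norm G (F j))\<^sup>2) sums (ell2_sum_norm G F)\<^sup>2"
    using summable_sums[OF sm] by (simp add: ell2_sum_norm_def suminf_nonneg[OF sm])
  then have 2: "((\<lambda>j. (ell2_norm G (F j))\<^sup>2) has_sum (ell2_sum_norm G F)\<^sup>2) UNIV"
    by (rule sums_nonneg_imp_has_sum) simp
  have 3: "((\<lambda>p. (cmod (F (fst p) (snd p)))\<^sup>2) has_sum (ell2_sum_norm G F)\<^sup>2) (UNIV \<times> carrier G)"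
  proof (rule has_sum_SigmaI)
    show "(\<lambda>p. (cmod (F (fst p) (snd p)))\<^sup>2) summable_on UNIV \<times> carrier G"
      by (rule summable_on_SigmaI[where g = "\<lambda>j. (ell2_norm G (F j))\<^sup>2"])
        (use 1 has_sum_imp_summable[OF 2] in auto)
  qed (use 1 2 in auto)
  have 4: "((\<lambda>\<beta>. (part \<beta> z)\<^sup>2) has_sum (cmod z)\<^sup>2) UNIV" for z
  proof -
    have "(\<Sum>\<beta>\<in>UNIV. (part \<beta> z)\<^sup>2) = (cmod z)\<^sup>2"
      by (simp add: UNIV_bool part_def cmod_power2)
    then show ?thesis by (metis finite has_sum_finite)
  qed
  have "((\<lambda>q. (part (snd q) (F (fst (fst q)) (snd (fst q))))\<^sup>2) has_sum (ell2_sum_norm G F)\<^sup>2)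
      ((UNIV \<times> carrier G) \<times> UNIV)"
  proof (rule has_sum_SigmaI[where g = "\<lambda>p. (cmod (F (fst p) (snd p)))\<^sup>2"])
    show "(\<lambda>q. (part (snd q) (F (fst (fst q)) (snd (fst q))))\<^sup>2) summable_on (UNIV \<times> carrier G) \<times> UNIV"
      by (rule summable_on_SigmaI[where g = "\<lambda>p. (cmod (F (fst p) (snd p)))\<^sup>2"])
        (use 4 has_sum_imp_summable[OF 3] in auto)
  qed (use 3 4 in auto)
  then show ?thesis by (simp add: case_prod_unfold)
qed

text \<open>A subgroup \<open>L\<close> of \<open>G\<close> together with a bijection from a type. The group structure is carried over to this
type, and \<open>L\<close> then acts on \<open>l2\<close> as in the previous sections.\<close>

locale subgroup_chart = group G for G (structure) +
  fixes L :: "'g set" and b :: "'a \<Rightarrow> 'g"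
  assumes sub_L: "subgroup L G" and bij_b: "bij_betw b UNIV L"
begin

definition d :: "'g \<Rightarrow> 'a" where "d = inv_into UNIV b"

lemma b_d: "l \<in> L \<Longrightarrow> b (d l) = l" and d_b [simp]: "d (b n) = n" and b_L: "b n \<in> L"
  using bij_b by (auto simp: d_def bij_betw_def f_inv_into_f)

lemma L_carrier: "l \<in> L \<Longrightarrow> l \<in> carrier G"
  using subgroup.subset[OF sub_L] by blast

lemma b_carrier [simp]: "b n \<in> carrier G" by (rule L_carrier[OF b_L])

definition mul :: "'a \<Rightarrow> 'a \<Rightarrow> 'a" where "mul m n = d (b m \<otimes> b n)"
definition un :: 'a where "un = d \<one>"
definition iv :: "'a \<Rightarrow> 'a" where "iv n = d (inv b n)"

lemma b_mul: "b (mul m n) = b m \<otimes> b n" and b_un: "b un = \<one>" and b_iv: "b (iv n) = inv b n"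
  by (simp_all add: mul_def un_def iv_def b_d b_L subgroup.m_closed[OF sub_L] subgroup.one_closed[OF sub_L]
      subgroup.m_inv_closed[OF sub_L])

lemma b_eqI: "b m = b n \<Longrightarrow> m = n" by (metis d_b)

sublocale T: type_group mul un iv
  by unfold_locales (rule b_eqI; simp add: b_mul b_un b_iv m_assoc)+

lemma d_mult: "k \<in> L \<Longrightarrow> l \<in> L \<Longrightarrow> d (k \<otimes> l) = mul (d k) (d l)"
  by (simp add: mul_def b_d)

definition rep :: "'g \<Rightarrow> 'g" where "rep x = (SOME y. \<exists>l\<in>L. y = l \<otimes> x)"

lemma rep: assumes "x \<in> carrier G" shows "rep x \<in> carrier G" "x \<otimes> inv (rep x) \<in> L"
proof -
  have "\<exists>y. \<exists>l\<in>L. y = l \<otimes> x" using subgroup.one_closed[OF sub_L] by blast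
  then have "\<exists>l\<in>L. rep x = l \<otimes> x" unfolding rep_def by (rule someI_ex)
  then obtain l where l: "l \<in> L" "rep x = l \<otimes> x" by blast
  have lc: "l \<in> carrier G" using L_carrier l(1) .
  show "rep x \<in> carrier G" using l(2) lc assms by simp
  have "x \<otimes> inv (rep x) = inv l"
    using assms lc by (simp add: l(2) inv_mult_group flip: m_assoc)
  then show "x \<otimes> inv (rep x) \<in> L" using subgroup.m_inv_closed[OF sub_L l(1)] by simp
qed

lemma rep_mult: assumes l: "l \<in> L" and x: "x \<in> carrier G" shows "rep (l \<otimes> x) = rep x"
proof -
  have lc: "l \<in> carrier G" using L_carrier l .
  have "(\<lambda>y. \<exists>k\<in>L. y = k \<otimes> (l \<otimes> x)) = (\<lambda>y. \<exists>k\<in>L. y = k \<otimes> x)"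
  proof (intro ext iffI)
    fix y assume "\<exists>k\<in>L. y = k \<otimes> (l \<otimes> x)"
    then obtain k where k: "k \<in> L" "y = k \<otimes> (l \<otimes> x)" by blast
    show "\<exists>k\<in>L. y = k \<otimes> x"
      by (rule bexI[of _ "k \<otimes> l"]) (use k l lc x in \<open>simp_all add: L_carrier m_assoc subgroup.m_closed[OF sub_L]\<close>)
  next
    fix y assume "\<exists>k\<in>L. y = k \<otimes> x"
    then obtain k where k: "k \<in> L" "y = k \<otimes> x" by blast
    have kc: "k \<in> carrier G" using L_carrier k(1) .
    have "inv l \<otimes> (l \<otimes> x) = x" using lc x by (simp flip: m_assoc)
    then have "y = (k \<otimes> inv l) \<otimes> (l \<otimes> x)" using k(2) kc lc x by (simp add: m_assoc)
    then show "\<exists>k\<in>L. y = k \<otimes> (l \<otimes> x)"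
      using subgroup.m_closed[OF sub_L k(1) subgroup.m_inv_closed[OF sub_L l]] by blast
  qed
  then show ?thesis unfolding rep_def by (rule arg_cong)
qed

definition reps :: "'g set" where "reps = rep ` carrier G"

lemma reps: "r \<in> reps \<Longrightarrow> r \<in> carrier G \<and> rep r = r"
proof -
  assume "r \<in> reps"
  then obtain x where x: "x \<in> carrier G" "r = rep x" by (auto simp: reps_def)
  have "r = inv (x \<otimes> inv (rep x)) \<otimes> x"
    using x rep(1)[OF x(1)] by (simp add: inv_mult_group m_assoc)
  moreover have "rep (inv (x \<otimes> inv (rep x)) \<otimes> x) = rep x"
    by (rule rep_mult[OF subgroup.m_inv_closed[OF sub_L rep(2)[OF x(1)]] x(1)])
  ultimately show ?thesis using x rep(1)[OF x(1)] by simp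
qed

text \<open>A vector of \<open>ell2_sum G\<close> is read along the right cosets of \<open>L\<close>, with real and imaginary
  parts separated. The action of \<open>L\<close> then only moves the first coordinate.\<close>

definition chart :: "(nat \<Rightarrow> 'g \<Rightarrow> complex) \<Rightarrow> 'a \<times> ('g \<times> nat \<times> bool) \<Rightarrow> real" where
  "chart F = (\<lambda>(k, r, j, \<beta>). if r \<in> reps then part \<beta> (F j (b k \<otimes> r)) else 0)"

lemma bij_chart: "bij_betw (\<lambda>(k, r, j, \<beta>). ((j, b k \<otimes> r), \<beta>))
  (UNIV \<times> reps \<times> UNIV \<times> UNIV) ((UNIV \<times> carrier G) \<times> UNIV)"
proof (rule bij_betw_byWitness[where f' = "\<lambda>((j, x), \<beta>). (d (x \<otimes> inv (rep x)), rep x, j, \<beta>)"])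
  have "rep (b k \<otimes> r) = r \<and> d (b k \<otimes> r \<otimes> inv r) = k" if "r \<in> reps" for k r
    using reps[OF that] rep_mult[OF b_L, of r k] by (simp add: m_assoc)
  then show "\<forall>p\<in>UNIV \<times> reps \<times> UNIV \<times> UNIV.
      (\<lambda>((j, x), \<beta>). (d (x \<otimes> inv (rep x)), rep x, j, \<beta>)) ((\<lambda>(k, r, j, \<beta>). ((j, b k \<otimes> r), \<beta>)) p) = p"
    by (auto simp: reps)
  have "b (d (x \<otimes> inv (rep x))) \<otimes> rep x = x" if "x \<in> carrier G" for x
    using rep[OF that] that by (simp add: b_d m_assoc)
  then show "\<forall>p\<in>(UNIV \<times> carrier G) \<times> UNIV.
      (\<lambda>(k, r, j, \<beta>). ((j, b k \<otimes> r), \<beta>)) ((\<lambda>((j, x), \<beta>). (d (x \<otimes> inv (rep x)), rep x, j, \<beta>)) p) = p"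
    by auto
  show "(\<lambda>(k, r, j, \<beta>). ((j, b k \<otimes> r), \<beta>)) ` (UNIV \<times> reps \<times> UNIV \<times> UNIV) \<subseteq> (UNIV \<times> carrier G) \<times> UNIV"
    using reps by auto
  show "(\<lambda>((j, x), \<beta>). (d (x \<otimes> inv (rep x)), rep x, j, \<beta>)) ` ((UNIV \<times> carrier G) \<times> UNIV)
      \<subseteq> UNIV \<times> reps \<times> UNIV \<times> UNIV"
    by (auto simp: reps_def)
qed

lemma has_sum_chart:
  assumes "F \<in> ell2_sum G"
  shows "((\<lambda>p. (chart F p)\<^sup>2) has_sum (ell2_sum_norm G F)\<^sup>2) UNIV"
proof -
  have "((\<lambda>p. (\<lambda>((j, x), \<beta>). (part \<beta> (F j x))\<^sup>2) ((\<lambda>(k, r, j, \<beta>). ((j, b k \<otimes> r), \<beta>)) p))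
      has_sum (ell2_sum_norm G F)\<^sup>2) (UNIV \<times> reps \<times> UNIV \<times> UNIV)"
    using has_sum_reindex_bij_betw[OF bij_chart] has_sum_ell2_sum[OF assms] by blast
  then show ?thesis
    by (rule has_sum_cong_neutral[THEN iffD1, rotated -1]) (auto simp: chart_def split: if_splits)
qed

lemma
  assumes "F \<in> ell2_sum G"
  shows coord_chart: "coord (l2_of (chart F)) = chart F"
    and norm_chart: "norm (l2_of (chart F)) = ell2_sum_norm G F"
proof -
  show c: "coord (l2_of (chart F)) = chart F"
    by (rule coord_l2_of) (rule has_sum_imp_summable[OF has_sum_chart[OF assms]])
  have "(norm (l2_of (chart F)))\<^sup>2 = (ell2_sum_norm G F)\<^sup>2"
    unfolding norm_square_coord c by (rule infsumI[OF has_sum_chart[OF assms]])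
  moreover have "0 \<le> ell2_sum_norm G F"
    using assms by (simp add: ell2_sum_norm_def ell2_sum_def suminf_nonneg)
  ultimately show "norm (l2_of (chart F)) = ell2_sum_norm G F"
    by (simp add: power2_eq_iff_nonneg)
qed

lemma chart_left_regular:
  assumes g: "g \<in> L" and F: "F \<in> ell2_sum G"
  shows "l2_of (chart (left_regular_sum G g F)) = T.Lt (d g) (l2_of (chart F))"
proof (rule l2_eqI)
  fix p :: "'a \<times> ('g \<times> nat \<times> bool)"
  obtain k r j \<beta> where p: "p = (k, r, j, \<beta>)" by (metis surj_pair)
  have gc: "g \<in> carrier G" using L_carrier g .
  have "b (mul (iv (d g)) k) \<otimes> r = inv g \<otimes> (b k \<otimes> r)" if "r \<in> reps"
    using reps[OF that] gc g by (simp add: b_mul b_iv b_d m_assoc)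
  then have "chart (left_regular_sum G g F) p = chart F (mul (iv (d g)) k, r, j, \<beta>)"
    using reps by (auto simp: chart_def p left_regular_sum_def left_regular_def)
  then show "coord (l2_of (chart (left_regular_sum G g F))) p = coord (T.Lt (d g) (l2_of (chart F))) p"
    using coord_chart[OF F] coord_chart[OF left_regular_sum_closed[OF is_group gc F]]
    by (simp add: p)
qed

lemma chart_add:
  assumes "F \<in> ell2_sum G" "F' \<in> ell2_sum G"
  shows "l2_of (chart (F + F')) = l2_of (chart F) + l2_of (chart F')"
    and "l2_of (chart (F - F')) = l2_of (chart F) - l2_of (chart F')"
proof -
  have "chart (F + F') p = chart F p + chart F' p" "chart (F - F') p = chart F p - chart F' p" for p
    by (auto simp: chart_def part_def split: prod.splits)
  then show "l2_of (chart (F + F')) = l2_of (chart F) + l2_of (chart F')"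
    and "l2_of (chart (F - F')) = l2_of (chart F) - l2_of (chart F')"
    by (auto intro!: l2_eqI simp: coord_chart assms ell2_sum_add ell2_sum_diff)
qed

text \<open>The chart is isometric and intertwines the two actions of \<open>L\<close>, so it does not change the defect.\<close>

lemma chart_quasi_cocycle:
  assumes c: "quasi_1_cocycle G (ell2_sum G) (ell2_sum_norm G) (left_regular_sum G) c"
  obtains D where "\<And>m n. norm (T.Lt m (l2_of (chart (c (b n)))) - l2_of (chart (c (b (mul m n))))
    + l2_of (chart (c (b m)))) \<le> D"
proof -
  have cG: "c g \<in> ell2_sum G" if "g \<in> carrier G" for g
    using c that by (auto simp: quasi_1_cocycle_def)
  obtain D where D: "\<And>g h. g \<in> carrier G \<Longrightarrow> h \<in> carrier G \<Longrightarrow>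
      ell2_sum_norm G (left_regular_sum G g (c h) - c (g \<otimes> h) + c g) \<le> D"
    using c by (auto simp: quasi_1_cocycle_def)
  show ?thesis
  proof (rule that[of D])
    fix m n
    let ?F = "left_regular_sum G (b m) (c (b n))"
    have F: "?F \<in> ell2_sum G" by (intro left_regular_sum_closed[OF is_group] cG) auto
    have H: "c (b m \<otimes> b n) \<in> ell2_sum G" "c (b m) \<in> ell2_sum G" by (intro cG; simp)+
    have "T.Lt m (l2_of (chart (c (b n)))) = l2_of (chart ?F)"
      using chart_left_regular[OF b_L cG[OF b_carrier], of m n] by simp
    then have "T.Lt m (l2_of (chart (c (b n)))) - l2_of (chart (c (b (mul m n)))) + l2_of (chart (c (b m)))
        = l2_of (chart (?F - c (b m \<otimes> b n) + c (b m)))"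
      by (simp add: b_mul chart_add[OF ell2_sum_diff[OF F H(1)] H(2)] chart_add[OF F H(1)])
    then have "norm (T.Lt m (l2_of (chart (c (b n)))) - l2_of (chart (c (b (mul m n)))) + l2_of (chart (c (b m))))
        = ell2_sum_norm G (?F - c (b m \<otimes> b n) + c (b m))"
      by (simp add: norm_chart ell2_sum_add[OF ell2_sum_diff[OF F H(1)] H(2)])
    then show "norm (T.Lt m (l2_of (chart (c (b n)))) - l2_of (chart (c (b (mul m n)))) + l2_of (chart (c (b m)))) \<le> D"
      using D[of "b m" "b n"] by simp
  qed
qed

lemma mean_transport:
  assumes "left_invariant_mean (T.group_on UNIV) \<mu>"
  shows "left_invariant_mean (G\<lparr>carrier := L\<rparr>) (\<lambda>f. \<mu> (\<lambda>n. f (b n)))"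
proof -
  have bd: "(\<lambda>n. f (b n)) \<in> bounded_funs (T.group_on UNIV)" if "f \<in> bounded_funs (G\<lparr>carrier := L\<rparr>)" for f
  proof -
    have "bounded (f ` L)" using that by (simp add: bounded_funs_def)
    moreover have "range (\<lambda>n. f (b n)) \<subseteq> f ` L" using b_L by auto
    ultimately show ?thesis by (simp add: bounded_funs_def bounded_subset)
  qed
  note \<mu> = assms[unfolded left_invariant_mean_def]
  have inv: "\<mu> (\<lambda>n. u (mul m n)) = \<mu> u" if "u \<in> bounded_funs (T.group_on UNIV)" for u m
    using \<mu> that by simp
  have "\<mu> (\<lambda>n. f (g \<otimes> b n)) = \<mu> (\<lambda>n. f (b n))" if g: "g \<in> L" and f: "f \<in> bounded_funs (G\<lparr>carrier := L\<rparr>)" for g f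
  proof -
    show ?thesis using inv[OF bd[OF f], of "d g"] by (simp add: b_mul b_d g)
  qed
  then show ?thesis
    unfolding left_invariant_mean_def using \<mu> bd b_L by simp
qed

end

section \<open>Images of boundedly generated groups\<close>

lemma left_invariant_mean_cong:
  assumes m: "left_invariant_mean G m" and f: "f \<in> bounded_funs G" and eq: "\<And>x. x \<in> carrier G \<Longrightarrow> f x = f' x"
  shows "m f = m f'"
proof -
  have f': "f' \<in> bounded_funs G" using f eq by (simp add: bounded_funs_def)
  have add: "m (\<lambda>x. u x + v x) = m u + m v" if "u \<in> bounded_funs G" "v \<in> bounded_funs G" for u v
    using m that by (simp add: left_invariant_mean_def)
  have scale: "m (\<lambda>x. a * u x) = a * m u" if "u \<in> bounded_funs G" for a u
    using m that by (simp add: left_invariant_mean_def)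
  have sc: "(\<lambda>x. - 1 * u x) \<in> bounded_funs G" if "u \<in> bounded_funs G" for u
    using that by (auto simp: bounded_funs_def bounded_iff)
  have zero: "0 \<le> m u" if "u \<in> bounded_funs G" "\<And>x. x \<in> carrier G \<Longrightarrow> u x = 0" for u
    using m that by (simp add: left_invariant_mean_def)
  have bd: "(\<lambda>x. u x + - 1 * v x) \<in> bounded_funs G" if "u \<in> bounded_funs G" "\<And>x. x \<in> carrier G \<Longrightarrow> u x = v x" for u v
    using that by (auto simp: bounded_funs_def bounded_iff)
  have "0 \<le> m (\<lambda>x. f x + - 1 * f' x)" by (rule zero[OF bd[OF f eq]]) (simp_all add: eq)
  then have 1: "m f' \<le> m f" unfolding add[OF f sc[OF f']] scale[OF f'] by simp
  have "0 \<le> m (\<lambda>x. f' x + - 1 * f x)" by (rule zero[OF bd[OF f']]) (simp_all add: eq)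
  then have 2: "m f \<le> m f'" unfolding add[OF f' sc[OF f]] scale[OF f] by simp
  show ?thesis using 1 2 by simp
qed

lemma finite_group_mean:
  assumes "group G" and fin: "finite (carrier G)"
  shows "left_invariant_mean G (\<lambda>f. (\<Sum>x\<in>carrier G. f x) / card (carrier G))"
proof -
  interpret group G by fact
  have pos: "0 < card (carrier G)" using fin one_closed by (auto simp: card_gt_0_iff)
  have "(\<Sum>x\<in>carrier G. f (g \<otimes>\<^bsub>G\<^esub> x)) = (\<Sum>x\<in>carrier G. f x)" if g: "g \<in> carrier G" for g and f :: "'a \<Rightarrow> real"
  proof (rule sum.reindex_bij_witness[where i = "\<lambda>x. inv\<^bsub>G\<^esub> g \<otimes>\<^bsub>G\<^esub> x" and j = "\<lambda>x. g \<otimes>\<^bsub>G\<^esub> x"])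
  qed (use g in \<open>auto simp flip: m_assoc\<close>)
  then show ?thesis
    unfolding left_invariant_mean_def using pos
    by (auto simp: sum.distrib add_divide_distrib sum_distrib_left intro!: divide_nonneg_nonneg sum_nonneg)
qed

theorem theorem4p3:
  fixes G :: "('g, 'm) monoid_scheme"
    and H :: "('h, 'n) monoid_scheme"
    and c :: "'g \<Rightarrow> nat \<Rightarrow> 'g \<Rightarrow> complex"
    and \<K> :: "'h set set"
    and \<phi> :: "'h \<Rightarrow> 'g"
  assumes "group G" and "countable (carrier G)"
    and "quasi_1_cocycle G (ell2_sum G) (ell2_sum_norm G) (left_regular_sum G) c"
    and "proper_on_group G (ell2_sum_norm G) c"
    and "group H"
    and "boundedly_generated_by_subgroups H \<K>"
    and "\<forall>K\<in>\<K>. amenable_subgroup K H"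
    and "\<phi> \<in> hom H G"
  shows "amenable_subgroup (\<phi> ` carrier H) G"
proof -
  interpret G: group G by fact
  interpret H: group H by fact
  interpret \<phi>: group_hom H G \<phi>
    using assms(8) by (simp add: group_hom_def group_hom_axioms_def G.is_group H.is_group)
  define L where "L = \<phi> ` carrier H"
  have subL: "subgroup L G" unfolding L_def by (rule \<phi>.img_is_subgroup)
  have groupL: "group (G\<lparr>carrier := L\<rparr>)" by (rule G.subgroup_imp_group[OF subL])
  have LG: "L \<subseteq> carrier G" by (rule subgroup.subset[OF subL])
  have "\<exists>m. left_invariant_mean (G\<lparr>carrier := L\<rparr>) m"
  proof (rule ccontr)
    assume no_mean: "\<nexists>m. left_invariant_mean (G\<lparr>carrier := L\<rparr>) m"
    have infL: "infinite L"
    proof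
      assume "finite L"
      then have "left_invariant_mean (G\<lparr>carrier := L\<rparr>) (\<lambda>f. (\<Sum>x\<in>L. f x) / card L)"
        using finite_group_mean[OF groupL] by simp
      with no_mean show False by blast
    qed
    have countL: "countable L" using LG assms(2) by (rule countable_subset)
    define b where "b = from_nat_into L"
    have bij_b: "bij_betw b UNIV L" unfolding b_def by (rule bij_betw_from_nat_into[OF countL infL])
    interpret C: subgroup_chart G L b 
      by (intro subgroup_chart.intro subgroup_chart_axioms.intro G.is_group subL bij_b)
    have "\<nexists>\<mu>. left_invariant_mean (C.T.group_on UNIV) \<mu>" using C.mean_transport no_mean by blast
    then obtain S \<kappa> where gap: "0 \<le> \<kappa>"
      "\<And>\<xi> :: (nat \<times> ('g \<times> nat \<times> bool)) l2. norm \<xi> \<le> \<kappa> * (\<Sum>s\<in>S. norm (C.T.Lt s \<xi> - \<xi>))"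
      by (rule C.T.spectral_gap[OF infinite_UNIV_nat]) blast
    obtain D where D: "\<And>m n. norm (C.T.Lt m (l2_of (C.chart (c (b n)))) - l2_of (C.chart (c (b (C.mul m n))))
      + l2_of (C.chart (c (b m)))) \<le> D"
      using C.chart_quasi_cocycle[OF assms(3)] by blast
    define \<psi> where "\<psi> h = C.d (\<phi> h)" for h
    have \<phi>L: "\<phi> h \<in> L" if "h \<in> carrier H" for h using that by (simp add: L_def)
    have \<psi>_mult: "\<psi> (x \<otimes>\<^bsub>H\<^esub> y) = C.mul (\<psi> x) (\<psi> y)" if "x \<in> carrier H" "y \<in> carrier H" for x y
      using that by (simp add: \<psi>_def C.d_mult \<phi>L)
    have \<psi>_one: "\<psi> \<one>\<^bsub>H\<^esub> = C.un" by (simp add: \<psi>_def C.un_def)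
    have \<psi>_inv: "\<psi> (inv\<^bsub>H\<^esub> x) = C.iv (\<psi> x)" if "x \<in> carrier H" for x
      using that by (simp add: \<psi>_def C.iv_def C.b_d \<phi>L)
    have fin: "finite \<K>" and subK: "\<And>K. K \<in> \<K> \<Longrightarrow> subgroup K H" and bg: "boundedly_generated H (\<Union>\<K>)"
      using assms(6) by (auto simp: boundedly_generated_by_subgroups_def)
    have KH: "x \<in> carrier H" if "K \<in> \<K>" "x \<in> K" for K x
      by (rule subsetD[OF subgroup.subset[OF subK[OF that(1)]] that(2)])
    \<comment> \<open>the means on the members of \<open>\<K>\<close> are pushed forward along \<open>\<psi>\<close>\<close>
    have "bounded (range (\<lambda>n. l2_of (C.chart (c (b n)))))"
    proof -
      obtain k where k: "\<forall>h\<in>carrier H. \<exists>xs. length xs < k \<and>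
          set xs \<subseteq> \<Union>\<K> \<union> m_inv H ` \<Union>\<K> \<and> h = foldr (mult H) xs \<one>\<^bsub>H\<^esub>"
        using bg[unfolded boundedly_generated_def, THEN conjunct2] by (rule exE)
      show ?thesis
      proof (rule C.T.quasi_cocycle_bounded[where J = \<K> and A = "\<lambda>K. \<psi> ` K" and n = k and D = D])
        show "finite \<K>" by (rule fin)
        show "C.T.type_subgroup (\<psi> ` K)" if K: "K \<in> \<K>" for K
          unfolding C.T.type_subgroup_def
        proof (intro conjI ballI)
          show "C.un \<in> \<psi> ` K"
            unfolding \<psi>_one[symmetric] by (rule imageI[OF subgroup.one_closed[OF subK[OF K]]])
          fix x assume "x \<in> \<psi> ` K"
          then obtain h where h: "h \<in> K" "x = \<psi> h" by blast
          show "C.iv x \<in> \<psi> ` K"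
            unfolding h(2) \<psi>_inv[OF KH[OF K h(1)], symmetric]
            by (rule imageI[OF subgroup.m_inv_closed[OF subK[OF K] h(1)]])
          fix y assume "y \<in> \<psi> ` K"
          then obtain h' where h': "h' \<in> K" "y = \<psi> h'" by blast
          show "C.mul x y \<in> \<psi> ` K"
            unfolding h(2) h'(2) \<psi>_mult[OF KH[OF K h(1)] KH[OF K h'(1)], symmetric]
            by (rule imageI[OF subgroup.m_closed[OF subK[OF K] h(1) h'(1)]])
        qed
        show "\<exists>\<mu>. left_invariant_mean (C.T.group_on (\<psi> ` K)) \<mu>" if K: "K \<in> \<K>" for K
        proof -
          obtain m where m: "left_invariant_mean (H\<lparr>carrier := K\<rparr>) m"
            using assms(7) K by (auto simp: amenable_subgroup_def amenable_def)
          have bd: "(\<lambda>h. f (\<psi> h)) \<in> bounded_funs (H\<lparr>carrier := K\<rparr>)" if "f \<in> bounded_funs (C.T.group_on (\<psi> ` K))" for f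
            using that by (simp add: bounded_funs_def image_image)
          note m' = m[unfolded left_invariant_mean_def]
          have inv0: "m (\<lambda>h. u (k \<otimes>\<^bsub>H\<^esub> h)) = m u"
            if "k \<in> K" "u \<in> bounded_funs (H\<lparr>carrier := K\<rparr>)" for k u
            using m' that by simp
          have inv: "m (\<lambda>h. f (C.mul g (\<psi> h))) = m (\<lambda>h. f (\<psi> h))"
            if g: "g \<in> \<psi> ` K" and f: "f \<in> bounded_funs (C.T.group_on (\<psi> ` K))" for g f
          proof -
            obtain k where k: "k \<in> K" "g = \<psi> k" using g by blast
            have "(\<lambda>h. f (\<psi> (k \<otimes>\<^bsub>H\<^esub> h))) \<in> bounded_funs (H\<lparr>carrier := K\<rparr>)"
            proof -
              have "(\<lambda>h. f (\<psi> (k \<otimes>\<^bsub>H\<^esub> h))) ` K \<subseteq> (\<lambda>h. f (\<psi> h)) ` K"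
                using subgroup.m_closed[OF subK[OF K] k(1)] by blast
              then show ?thesis using bd[OF f] by (auto simp: bounded_funs_def intro: bounded_subset)
            qed
            then have "m (\<lambda>h. f (\<psi> (k \<otimes>\<^bsub>H\<^esub> h))) = m (\<lambda>h. f (C.mul g (\<psi> h)))"
              by (rule left_invariant_mean_cong[OF m]) (simp add: k(2) \<psi>_mult KH[OF K] k(1))
            moreover have "m (\<lambda>h. f (\<psi> (k \<otimes>\<^bsub>H\<^esub> h))) = m (\<lambda>h. f (\<psi> h))"
              by (rule inv0[OF k(1) bd[OF f]])
            ultimately show ?thesis by simp
          qed
          have "left_invariant_mean (C.T.group_on (\<psi> ` K)) (\<lambda>f. m (\<lambda>h. f (\<psi> h)))"
            unfolding left_invariant_mean_def using m' bd inv by simp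
          then show ?thesis by blast
        qed
        show "\<exists>xs. length xs < k \<and> set xs \<subseteq> (\<Union>K\<in>\<K>. \<psi> ` K) \<and> g = foldr C.mul xs C.un" for g
        proof -
          obtain h where h: "h \<in> carrier H" "\<phi> h = b g"
            using C.b_L[of g] unfolding L_def by auto
          obtain xs where xs: "length xs < k" "set xs \<subseteq> \<Union>\<K> \<union> m_inv H ` \<Union>\<K>" "h = foldr (mult H) xs \<one>\<^bsub>H\<^esub>"
            using bspec[OF k h(1)] by blast
          have "m_inv H ` \<Union>\<K> \<subseteq> \<Union>\<K>"
          proof
            fix y assume "y \<in> m_inv H ` \<Union>\<K>"
            then obtain K x where K: "K \<in> \<K>" "x \<in> K" "y = inv\<^bsub>H\<^esub> x" by blast
            then show "y \<in> \<Union>\<K>" using subgroup.m_inv_closed[OF subK[OF K(1)] K(2)] by blast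
          qed
          then have xsK: "set xs \<subseteq> \<Union>\<K>" using xs(2) by blast
          have "foldr (mult H) ys \<one>\<^bsub>H\<^esub> \<in> carrier H \<and>
              \<psi> (foldr (mult H) ys \<one>\<^bsub>H\<^esub>) = foldr C.mul (map \<psi> ys) C.un" if "set ys \<subseteq> \<Union>\<K>" for ys
            using that
          proof (induction ys)
            case (Cons y ys)
            then have "y \<in> carrier H" using KH by auto
            with Cons show ?case by (simp add: \<psi>_mult)
          qed (simp add: \<psi>_one)
          then have "\<psi> h = foldr C.mul (map \<psi> xs) C.un" using xsK xs(3) by simp
          moreover have "\<psi> h = g" by (simp add: \<psi>_def h(2))
          ultimately show ?thesis
            using xs(1) xsK by (intro exI[of _ "map \<psi> xs"]) auto
        qed
      qed (use D gap in auto)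
    qed
    then obtain B where B: "\<And>n. norm (l2_of (C.chart (c (b n)))) \<le> B" by (auto simp: bounded_iff)
    have cG: "c g \<in> ell2_sum G" if "g \<in> carrier G" for g
      using assms(3) that by (auto simp: quasi_1_cocycle_def)
    have "L \<subseteq> {g \<in> carrier G. ell2_sum_norm G (c g) \<le> max B 1}"
    proof
      fix g assume g: "g \<in> L"
      have "ell2_sum_norm G (c g) \<le> B"
        using B[of "C.d g"] C.norm_chart[OF cG, of g] g LG by (auto simp: C.b_d)
      then show "g \<in> {g \<in> carrier G. ell2_sum_norm G (c g) \<le> max B 1}" using g LG by auto
    qed
    moreover have "finite {g \<in> carrier G. ell2_sum_norm G (c g) \<le> max B 1}"
      using assms(4) by (auto simp: proper_on_group_def)
    ultimately have "finite L" by (rule finite_subset)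
    then show False using infL by simp
  qed
  then show ?thesis
    using subL groupL unfolding amenable_subgroup_def amenable_def L_def by blast
qed

end
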